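(* The RCWA solution $u^{h,M}\in V_M$ solves the variational problem $$B_{\varepsilon_h}(u^{h,M},v_M)=f(v_M)\qquad\text{for all }v_M\in V_M,$$ where $$f(v_M)=-\int_\Omega\nabla\cdot\big[(\varepsilon_+^{-1}-\varepsilon_h^{-1})\nabla u^{\rm inc}\big]\,\overline{v_M},$$ $V_M=H^1(-H,H)\otimes E_M$ and $E_M=\operatorname{span}\{e^{i\alpha_nx_1}:-M\le n\le M\}$.
   Context: Fix $L_x,H,\kappa>0$, positive constants $\varepsilon_+,\varepsilon_-$, and an angle of incidence $\theta$. Put $\alpha_0=\kappa\sqrt{\varepsilon_+}\sin\theta$, $\alpha_n=\alpha_0+2\pi n/L_x$ ($n\in\mathbb{Z}$), and assume $\alpha_n^2\neq\kappa^2\varepsilon_\pm$ for all $n$. Points are $\mathbf{x}=(x_1,x_2)$; $\Omega=(0,L_x)\times(-H,H)$, $\Gamma_{\pm H}=(0,L_x)\times\{\pm H\}$. The relative permittivity $\varepsilon$ on $\mathbb{R}^2$ is $L_x$-periodic in $x_1$, with $\varepsilon=\varepsilon_+$ for $x_2>H$ and $\varepsilon=\varepsilon_-$ for $x_2<-H$; it is piecewise $C^2$ ($C^2$ in each of finitely many subregions, with possible jumps across the interfaces between them), and either (I) $\varepsilon$ is real and positive, or (II) $\Im(\varepsilon)>c_1>0$ and $\Re(\varepsilon)>c_2>0$ in $\Omega$ for some constants $c_1,c_2$. Let $\beta_n^\pm=\sqrt{\kappa^2\varepsilon_\pm-\alpha_n^2}$ if $\alpha_n^2<\kappa^2\varepsilon_\pm$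 and $\beta_n^\pm=i\sqrt{\alpha_n^2-\kappa^2\varepsilon_\pm}$ if $\alpha_n^2>\kappa^2\varepsilon_\pm$. For $\phi=\sum_n\phi_ne^{i\alpha_nx_1}$ on $\Gamma_{\pm H}$, the Dirichlet-to-Neumann operators are $T^\pm\phi=\frac{i}{\varepsilon_\pm}\sum_n\beta_n^\pm\phi_ne^{i\alpha_nx_1}$. Slicing: for a mesh $-H=h_0<h_1<\dots<h_S=H$, let $S_j=(0,L_x)\times(h_{j-1},h_j)$, $h=\max_j(h_j-h_{j-1})$, and $\varepsilon_h(x_1,x_2)=\varepsilon(x_1,\tfrac12(h_{j-1}+h_j))$ for $\mathbf{x}\in S_j$. The sesquilinear form is $$B_{\varepsilon_h}(w,v)=\int_\Omega\Big(\frac1{\varepsilon_h}\nabla w\cdot\nabla\overline v-\kappa^2w\overline v\Big)-\int_{\Gamma_{-H}}\overline v\,T^-(w)-\int_{\Gamma_H}\overline v\,T^+(w).$$ Incident field: $u^{\rm inc}(x_1,x_2)=\exp[i\kappa\sqrt{\varepsilon_+}(x_1\sin\theta-x_2\cos\theta)]$. RCWA solution, with $2M+1$ retained Fourier modes: $u^{h,M}(x_1,x_2)=\sum_{n=-M}^Mu_n^{h,M}(x_2)e^{i\alpha_nx_1}$ in $\Omega$. Here, in each slice $S_j$, $$\sum_{m=-M}^M\varepsilon^{-1}_{h,n-m}\frac{\partial^2u_m^{h,M}}{\partial x_2^2}=\alpha_n\sum_{m=-M}^M\varepsilon^{-1}_{h,n-m}\alpha_mu_m^{h,M}-\kappa^2u_n^{h,M}+f_n,\qquad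 -M\le n\le M,$$ where $\varepsilon^{-1}_{h,n-m}$ is the $(n,m)$ entry of the Toeplitz matrix formed from the Fourier coefficients (in $x_1$) of $1/\varepsilon_h$, and $f_n$ is the $n$-th Fourier coefficient (with respect to $e^{i\alpha_nx_1}$) of $\nabla\cdot[(\varepsilon_+^{-1}-\varepsilon_h^{-1})\nabla u^{\rm inc}]$. The modes $u_n^{h,M}$ and the quantities $\sum_{m=-M}^M\varepsilon^{-1}_{h,n-m}\frac{\partial u_m^{h,M}}{\partial x_2}$ are required to be continuous across the inter-slice boundaries, and $\frac1{\varepsilon_+}\frac{\partial u^{h,M}}{\partial x_2}=T^+(u^{h,M})$ on $\Gamma_H$, $\frac1{\varepsilon_-}\frac{\partial u^{h,M}}{\partial x_2}=-T^-(u^{h,M})$ on $\Gamma_{-H}$.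
   Formalization: On Γ_{±H} the derivative in the T^± conditions is taken from the half-plane side and matched to the flux Σ ε⁻¹_{h,n-m}∂₂u_m inside (with the inner derivative the claim fails if ε_h≠ε_± in the outer slices); "real and positive" means bounded below by a positive constant. *)

theory Defs
  imports "HOL-Analysis.Analysis"
begin

section \<open>Weak derivatives and Sobolev functions\<close>

definition L2_on :: "'a::euclidean_space set \<Rightarrow> ('a \<Rightarrow> complex) \<Rightarrow> bool" where
  "L2_on A f \<longleftrightarrow> set_borel_measurable lebesgue A f \<and> set_integrable lebesgue A (\<lambda>x. (cmod (f x))\<^sup>2)"

text \<open>Test functions are taken in \<open>C\<^sup>1\<^sub>c\<close>; by density this gives the same weak derivatives as
  \<open>C\<^sup>\<infinity>\<^sub>c\<close>.\<close>

definition test_function :: "'a::euclidean_space set \<Rightarrow> ('a \<Rightarrow> real) \<Rightarrow> bool" where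
  "test_function A \<phi> \<longleftrightarrow>
     (\<exists>\<phi>' :: 'a \<Rightarrow> 'a \<Rightarrow>\<^sub>L real.
        (\<forall>x. (\<phi> has_derivative blinfun_apply (\<phi>' x)) (at x)) \<and> continuous_on UNIV \<phi>') \<and>
     (\<exists>K. compact K \<and> K \<subseteq> A \<and> (\<forall>x. x \<notin> K \<longrightarrow> \<phi> x = 0))"

definition has_weak_derivative ::
    "('a::euclidean_space \<Rightarrow> complex) \<Rightarrow> ('a \<Rightarrow> complex) \<Rightarrow> 'a \<Rightarrow> 'a set \<Rightarrow> bool" where
  "has_weak_derivative w g b A \<longleftrightarrow> L2_on A w \<and> L2_on A g \<and>
     (\<forall>\<phi>. test_function A \<phi> \<longrightarrow>
        (LINT x:A|lebesgue. frechet_derivative \<phi> (at x) b *\<^sub>R w x) =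
        - (LINT x:A|lebesgue. \<phi> x *\<^sub>R g x))"

text \<open>Determined up to equality almost everywhere on \<open>A\<close>.\<close>

definition weak_derivative ::
    "'a::euclidean_space set \<Rightarrow> 'a \<Rightarrow> ('a \<Rightarrow> complex) \<Rightarrow> 'a \<Rightarrow> complex" where
  "weak_derivative A b w = (SOME g. has_weak_derivative w g b A)"

text \<open>\<open>H\<^sup>1(-H, H)\<close>. Each class is represented by its continuous representative on \<open>[-H, H]\<close>,
  so that traces at \<open>\<plusminus>H\<close> are point values.\<close>

definition H1 :: "real \<Rightarrow> (real \<Rightarrow> complex) set" where
  "H1 H = {v. continuous_on {-H..H} v \<and> (\<exists>g. has_weak_derivative v g 1 {-H<..<H})}"

section \<open>Piecewise smooth permittivity\<close>

definition C2_on :: "(real \<times> real) set \<Rightarrow> (real \<times> real \<Rightarrow> complex) \<Rightarrow> bool" where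
  "C2_on U g \<longleftrightarrow>
     (\<exists>(g' :: real \<times> real \<Rightarrow> (real \<times> real) \<Rightarrow>\<^sub>L complex)
       (g'' :: real \<times> real \<Rightarrow> (real \<times> real) \<Rightarrow>\<^sub>L ((real \<times> real) \<Rightarrow>\<^sub>L complex)).
        (\<forall>x\<in>U. (g has_derivative blinfun_apply (g' x)) (at x) \<and>
               (g' has_derivative blinfun_apply (g'' x)) (at x)) \<and>
        continuous_on U g'')"

text \<open>\<open>C\<^sup>2\<close> up to the boundary in each of finitely many subregions. The subregions partition
  \<open>A\<close>, so a point of an interface belongs to one of the adjacent subregions and carries the
  corresponding one-sided value; this matters when a horizontal interface lies on the line on
  which the permittivity of a slice is sampled. For bounded \<open>A\<close>, positivity of a real such
  function including its one-sided limits on the interfaces is the same as being bounded below by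
  a positive constant.\<close>

definition piecewise_C2_on :: "(real \<times> real) set \<Rightarrow> (real \<times> real \<Rightarrow> complex) \<Rightarrow> bool" where
  "piecewise_C2_on A f \<longleftrightarrow>
     (\<exists>\<D>. finite \<D> \<and> disjoint \<D> \<and> \<Union>\<D> = A \<and>
        (\<forall>D\<in>\<D>. D \<in> sets borel \<and> D \<subseteq> closure (interior D) \<and>
           (\<exists>U g. open U \<and> closure D \<subseteq> U \<and> C2_on U g \<and> (\<forall>x\<in>D. f x = g x))))"

section \<open>Geometry, slicing and Fourier modes\<close>

definition \<Omega> :: "real \<Rightarrow> real \<Rightarrow> (real \<times> real) set" where
  "\<Omega> L H = {0<..<L} \<times> {-H<..<H}"

definition is_mesh :: "real \<Rightarrow> nat \<Rightarrow> (nat \<Rightarrow> real) \<Rightarrow> bool" where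
  "is_mesh H S h \<longleftrightarrow> h 0 = - H \<and> h S = H \<and> (\<forall>j<S. h j < h (Suc j))"

text \<open>On the (null) line \<open>x\<^sub>2 = h j\<close> between two slices the value from the slice below is used.\<close>

definition sliced ::
    "(nat \<Rightarrow> real) \<Rightarrow> (real \<times> real \<Rightarrow> complex) \<Rightarrow> real \<times> real \<Rightarrow> complex" where
  "sliced h \<epsilon> x = (let j = (LEAST j. snd x \<le> h j) in \<epsilon> (fst x, (h (j - 1) + h j) / 2))"

definition alpha :: "real \<Rightarrow> real \<Rightarrow> real \<Rightarrow> real \<Rightarrow> int \<Rightarrow> real" where
  "alpha L \<kappa> \<epsilon>p \<theta> n = \<kappa> * sqrt \<epsilon>p * sin \<theta> + 2 * pi * of_int n / L"

definition mode :: "(int \<Rightarrow> real) \<Rightarrow> int \<Rightarrow> real \<Rightarrow> complex" where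
  "mode \<alpha> n s = exp (\<i> * of_real (\<alpha> n * s))"

definition fourier_coeff :: "real \<Rightarrow> (int \<Rightarrow> real) \<Rightarrow> (real \<Rightarrow> complex) \<Rightarrow> int \<Rightarrow> complex" where
  "fourier_coeff L \<alpha> \<phi> n = (LINT s:{0<..<L}|lebesgue. \<phi> s * cnj (mode \<alpha> n s)) / of_real L"

text \<open>Fourier coefficients of the \<open>L\<close>-periodic function \<open>1 / \<epsilon>\<^sub>h(\<cdot>, t)\<close>; the \<open>(n, m)\<close> entry of
  the Toeplitz matrix is the one with index \<open>n - m\<close>.\<close>

definition inv_eps_coeff ::
    "real \<Rightarrow> (real \<times> real \<Rightarrow> complex) \<Rightarrow> real \<Rightarrow> int \<Rightarrow> complex" where
  "inv_eps_coeff L \<epsilon>h t k = fourier_coeff L (\<lambda>k. 2 * pi * of_int k / L) (\<lambda>s. 1 / \<epsilon>h (s, t)) k"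

definition V_space :: "real \<Rightarrow> real \<Rightarrow> (int \<Rightarrow> real) \<Rightarrow> nat \<Rightarrow> (real \<times> real \<Rightarrow> complex) set" where
  "V_space L H \<alpha> M =
     {v. \<exists>c. (\<forall>n\<in>{-int M..int M}. c n \<in> H1 H) \<and>
             (\<forall>x\<in>{0..L} \<times> {-H..H}. v x = (\<Sum>n=-int M..int M. c n (snd x) * mode \<alpha> n (fst x)))}"

section \<open>Dirichlet-to-Neumann operators and the sesquilinear form\<close>

text \<open>In the operators below \<open>\<epsilon>b\<close> is the constant background permittivity of the adjacent
  half-plane.\<close>

definition beta :: "real \<Rightarrow> (int \<Rightarrow> real) \<Rightarrow> real \<Rightarrow> int \<Rightarrow> complex" where
  "beta \<kappa> \<alpha> \<epsilon>b n =
     (if (\<alpha> n)\<^sup>2 < \<kappa>\<^sup>2 * \<epsilon>b then of_real (sqrt (\<kappa>\<^sup>2 * \<epsilon>b - (\<alpha> n)\<^sup>2))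
      else \<i> * of_real (sqrt ((\<alpha> n)\<^sup>2 - \<kappa>\<^sup>2 * \<epsilon>b)))"

text \<open>The series is summed pointwise; for traces of functions in \<open>V_space\<close> it has only finitely
  many nonzero terms.\<close>

definition DtN ::
    "real \<Rightarrow> real \<Rightarrow> (int \<Rightarrow> real) \<Rightarrow> real \<Rightarrow> (real \<Rightarrow> complex) \<Rightarrow> real \<Rightarrow> complex" where
  "DtN L \<kappa> \<alpha> \<epsilon>b \<phi> s =
     \<i> / of_real \<epsilon>b * (\<Sum>\<^sub>\<infinity>n\<in>UNIV. beta \<kappa> \<alpha> \<epsilon>b n * fourier_coeff L \<alpha> \<phi> n * mode \<alpha> n s)"

text \<open>Meaningful for \<open>w\<close>, \<open>v\<close> that have weak gradients in \<open>\<Omega>\<close> and are continuous up to the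
  boundary, the traces on \<open>x\<^sub>2 = \<plusminus>H\<close> being point values.\<close>

definition B_form ::
    "real \<Rightarrow> real \<Rightarrow> real \<Rightarrow> (int \<Rightarrow> real) \<Rightarrow> real \<Rightarrow> real \<Rightarrow> (real \<times> real \<Rightarrow> complex) \<Rightarrow>
     (real \<times> real \<Rightarrow> complex) \<Rightarrow> (real \<times> real \<Rightarrow> complex) \<Rightarrow> complex" where
  "B_form L H \<kappa> \<alpha> \<epsilon>p \<epsilon>m \<epsilon>h w v =
     (LINT x:\<Omega> L H|lebesgue.
        1 / \<epsilon>h x *
          (weak_derivative (\<Omega> L H) (1, 0) w x * cnj (weak_derivative (\<Omega> L H) (1, 0) v x) +
           weak_derivative (\<Omega> L H) (0, 1) w x * cnj (weak_derivative (\<Omega> L H) (0, 1) v x))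
        - (of_real \<kappa>)\<^sup>2 * w x * cnj (v x))
     - (LINT s:{0<..<L}|lebesgue. cnj (v (s, -H)) * DtN L \<kappa> \<alpha> \<epsilon>m (\<lambda>s. w (s, -H)) s)
     - (LINT s:{0<..<L}|lebesgue. cnj (v (s, H)) * DtN L \<kappa> \<alpha> \<epsilon>p (\<lambda>s. w (s, H)) s)"

section \<open>Incident field and source term\<close>

definition pd1 :: "(real \<times> real \<Rightarrow> complex) \<Rightarrow> real \<times> real \<Rightarrow> complex" where
  "pd1 g x = vector_derivative (\<lambda>s. g (s, snd x)) (at (fst x))"

definition pd2 :: "(real \<times> real \<Rightarrow> complex) \<Rightarrow> real \<times> real \<Rightarrow> complex" where
  "pd2 g x = vector_derivative (\<lambda>t. g (fst x, t)) (at (snd x))"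

definition u_inc :: "real \<Rightarrow> real \<Rightarrow> real \<Rightarrow> real \<times> real \<Rightarrow> complex" where
  "u_inc \<kappa> \<epsilon>p \<theta> x =
     exp (\<i> * of_real (\<kappa> * sqrt \<epsilon>p * (fst x * sin \<theta> - snd x * cos \<theta>)))"

text \<open>Components of \<open>(1/\<epsilon>\<^sub>+ - 1/\<epsilon>\<^sub>h) \<nabla>u\<^sup>i\<^sup>n\<^sup>c\<close>.\<close>

definition src1 ::
    "real \<Rightarrow> real \<Rightarrow> real \<Rightarrow> (real \<times> real \<Rightarrow> complex) \<Rightarrow> real \<times> real \<Rightarrow> complex" where
  "src1 \<kappa> \<epsilon>p \<theta> \<epsilon>h x = (1 / of_real \<epsilon>p - 1 / \<epsilon>h x) * pd1 (u_inc \<kappa> \<epsilon>p \<theta>) x"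

definition src2 ::
    "real \<Rightarrow> real \<Rightarrow> real \<Rightarrow> (real \<times> real \<Rightarrow> complex) \<Rightarrow> real \<times> real \<Rightarrow> complex" where
  "src2 \<kappa> \<epsilon>p \<theta> \<epsilon>h x = (1 / of_real \<epsilon>p - 1 / \<epsilon>h x) * pd2 (u_inc \<kappa> \<epsilon>p \<theta>) x"

text \<open>The field \<open>F = (src1, src2)\<close> jumps in \<open>x\<^sub>1\<close> wherever the permittivity does, so
  \<open>\<nabla>\<cdot>F\<close> is in general a distribution in \<open>x\<^sub>1\<close>. It is paired with \<open>\<phi>\<close> (quasi-periodic in \<open>x\<^sub>1\<close>
  with the same phase as \<open>F\<close>) by moving \<open>\<partial>\<^sub>1\<close> to \<open>\<phi>\<close>:
  \[ \int_0^L (\nabla\cdot F)\, \overline\phi \, dx_1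
       = \int_0^L \big( \partial_2 F_2\, \overline\phi - F_1\, \overline{\partial_1\phi} \big)\, dx_1, \]
  which is the ordinary integral if \<open>F\<close> is smooth across the whole period.
  The derivative \<open>\<partial>\<^sub>2\<close> is the classical one inside each slice, where \<open>\<epsilon>\<^sub>h\<close> does not depend on \<open>x\<^sub>2\<close>;
  no contribution arises on the lines separating slices.\<close>

definition div_src_pairing ::
    "real \<Rightarrow> real \<Rightarrow> real \<Rightarrow> (real \<times> real \<Rightarrow> complex) \<Rightarrow> (real \<times> real \<Rightarrow> complex) \<Rightarrow>
     real \<times> real \<Rightarrow> complex" where
  "div_src_pairing \<kappa> \<epsilon>p \<theta> \<epsilon>h \<phi> x =
     pd2 (src2 \<kappa> \<epsilon>p \<theta> \<epsilon>h) x * cnj (\<phi> x) - src1 \<kappa> \<epsilon>p \<theta> \<epsilon>h x * cnj (pd1 \<phi> x)"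

text \<open>\<open>n\<close>-th Fourier coefficient of \<open>\<nabla>\<cdot>F\<close> at height \<open>t\<close>.\<close>

definition src_coeff ::
    "real \<Rightarrow> real \<Rightarrow> (int \<Rightarrow> real) \<Rightarrow> real \<Rightarrow> real \<Rightarrow> (real \<times> real \<Rightarrow> complex) \<Rightarrow>
     int \<Rightarrow> real \<Rightarrow> complex" where
  "src_coeff L \<kappa> \<alpha> \<epsilon>p \<theta> \<epsilon>h n t =
     (LINT s:{0<..<L}|lebesgue.
        div_src_pairing \<kappa> \<epsilon>p \<theta> \<epsilon>h (\<lambda>x. mode \<alpha> n (fst x)) (s, t)) / of_real L"

definition f_functional ::
    "real \<Rightarrow> real \<Rightarrow> real \<Rightarrow> real \<Rightarrow> real \<Rightarrow> (real \<times> real \<Rightarrow> complex) \<Rightarrow>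
     (real \<times> real \<Rightarrow> complex) \<Rightarrow> complex" where
  "f_functional L H \<kappa> \<epsilon>p \<theta> \<epsilon>h v =
     - (LINT x:\<Omega> L H|lebesgue. div_src_pairing \<kappa> \<epsilon>p \<theta> \<epsilon>h v x)"

section \<open>RCWA solution\<close>

definition mode_sum :: "(int \<Rightarrow> real) \<Rightarrow> nat \<Rightarrow> (int \<Rightarrow> real \<Rightarrow> complex) \<Rightarrow> real \<times> real \<Rightarrow> complex" where
  "mode_sum \<alpha> M U x = (\<Sum>n=-int M..int M. U n (snd x) * mode \<alpha> n (fst x))"

text \<open>\<open>Q n\<close> is the \<open>n\<close>-th flux \<open>\<Sum>\<^sub>m \<epsilon>\<^sup>-\<^sup>1\<^sub>h\<^sub>,\<^sub>n\<^sub>-\<^sub>m \<partial>\<^sub>2U\<^sub>m\<close>; it is given by this formula inside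
  the slices, and its continuity on \<open>[-H, H]\<close> is the flux matching between slices.
  The boundary conditions on \<open>x\<^sub>2 = \<plusminus>H\<close> involve the coefficients \<open>1/\<epsilon>\<^sub>\<plusminus>\<close> of the half-planes,
  so the normal derivatives \<open>dp\<close>, \<open>dm\<close> in them are those from the half-plane side, where the
  Toeplitz matrix is \<open>1/\<epsilon>\<^sub>\<plusminus>\<close> times the identity; they are tied to the solution in \<open>\<Omega>\<close> by flux
  matching. If \<open>\<epsilon>\<^sub>h\<close> equals \<open>\<epsilon>\<^sub>\<plusminus>\<close> in the outermost slices, they coincide with the derivatives from
  inside.\<close>

definition rcwa_solution ::
    "real \<Rightarrow> real \<Rightarrow> real \<Rightarrow> (int \<Rightarrow> real) \<Rightarrow> real \<Rightarrow> real \<Rightarrow> real \<Rightarrow> nat \<Rightarrow> (nat \<Rightarrow> real) \<Rightarrow>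
     (real \<times> real \<Rightarrow> complex) \<Rightarrow> nat \<Rightarrow> (int \<Rightarrow> real \<Rightarrow> complex) \<Rightarrow> bool" where
  "rcwa_solution L H \<kappa> \<alpha> \<epsilon>p \<epsilon>m \<theta> S h \<epsilon>h M U \<longleftrightarrow>
     (\<forall>n\<in>{-int M..int M}. continuous_on {-H..H} (U n)) \<and>
     (\<exists>dU ddU Q dp dm.
        (\<forall>j\<in>{1..S}. \<forall>t\<in>{h (j - 1)<..<h j}. \<forall>n\<in>{-int M..int M}.
           (U n has_vector_derivative dU n t) (at t) \<and>
           (dU n has_vector_derivative ddU n t) (at t) \<and>
           (\<Sum>m=-int M..int M. inv_eps_coeff L \<epsilon>h t (n - m) * ddU m t) =
             of_real (\<alpha> n) *
               (\<Sum>m=-int M..int M. inv_eps_coeff L \<epsilon>h t (n - m) * of_real (\<alpha> m) * U m t)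
             - (of_real \<kappa>)\<^sup>2 * U n t + src_coeff L \<kappa> \<alpha> \<epsilon>p \<theta> \<epsilon>h n t \<and>
           Q n t = (\<Sum>m=-int M..int M. inv_eps_coeff L \<epsilon>h t (n - m) * dU m t)) \<and>
        (\<forall>n\<in>{-int M..int M}.
           continuous_on {-H..H} (Q n) \<and>
           (U n has_vector_derivative dp n) (at H within {H..}) \<and>
           (U n has_vector_derivative dm n) (at (-H) within {..-H}) \<and>
           Q n H = dp n / of_real \<epsilon>p \<and>
           Q n (-H) = dm n / of_real \<epsilon>m) \<and>
        (\<forall>s\<in>{0<..<L}.
           1 / of_real \<epsilon>p * (\<Sum>n=-int M..int M. dp n * mode \<alpha> n s) =
             DtN L \<kappa> \<alpha> \<epsilon>p (\<lambda>s. mode_sum \<alpha> M U (s, H)) s \<and>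
           1 / of_real \<epsilon>m * (\<Sum>n=-int M..int M. dm n * mode \<alpha> n s) =
             - DtN L \<kappa> \<alpha> \<epsilon>m (\<lambda>s. mode_sum \<alpha> M U (s, -H)) s))"

end

theory Submission
  imports Defs
begin

text \<open>For \<open>u = \<Sum>\<^sub>m U\<^sub>m(x\<^sub>2) e\<^sub>m(x\<^sub>1)\<close> and \<open>v = \<Sum>\<^sub>n c\<^sub>n(x\<^sub>2) e\<^sub>n(x\<^sub>1)\<close>, integrating first over \<open>x\<^sub>1\<close> turns the volume part of
  the form into \<open>L\<close> times the integral over \<open>(-H, H)\<close> of \<open>\<Sum>\<^sub>n (Q\<^sub>n' - f\<^sub>n) cnj c\<^sub>n + Q\<^sub>n cnj c\<^sub>n'\<close>, where the
  \<open>Q\<^sub>n\<close> are the fluxes and the differential equations have been inserted. Since the fluxes are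
  continuous across the slices, integration by parts leaves only values at \<open>\<plusminus>H\<close>, and these cancel
  against the boundary terms by the Dirichlet-to-Neumann conditions.

  Two points need care. The weak derivatives in the form are arbitrary choices, so the fundamental
  lemma of the calculus of variations is needed to identify them almost everywhere. And for \<open>u\<close> to
  have weak derivatives at all, the \<open>\<partial>\<^sub>2U\<^sub>m\<close> must stay bounded up to the slice boundaries: the real part
  of \<open>1/\<epsilon>\<^sub>h\<close> is bounded below, so the Toeplitz matrices are coercive and the bounded fluxes
  control the derivatives.\<close>

section \<open>Test functions\<close>

text \<open>Members of H^1 and their weak derivatives are only Lebesgue measurable, whereas iterated
  integration needs Borel functions, whose sections are measurable at every height. This shapes the
  measure theory: integrands are split into sums of products of a bounded Borel kernel on the
  rectangle, which carries 1/\<epsilon>_h and the modes, and a Lebesgue function of x_2 alone, and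
  the latter is exchanged for a Borel representative when the order of integration matters. The
  integration by parts is just as asymmetric: a flux has a classical derivative except at the mesh
  heights, a coefficient of v only a weak one. A product rule is avoided by writing the coefficient
  as a constant plus a primitive of its weak derivative (du Bois-Reymond) and exchanging integrals
  over a triangle. The coercivity constant comes from Re(1/z) = Re z / |z|^2. Both alternatives for
  the permittivity bound Re \<epsilon> from below; the bound of |\<epsilon>| from above comes from
  smoothness up to the boundary of each of the finitely many subregions.\<close>

definition C1_fun :: "('a::real_normed_vector \<Rightarrow> real) \<Rightarrow> bool" where
  "C1_fun \<phi> \<longleftrightarrow>
     (\<exists>\<phi>' :: 'a \<Rightarrow> 'a \<Rightarrow>\<^sub>L real.
        (\<forall>x. (\<phi> has_derivative blinfun_apply (\<phi>' x)) (at x)) \<and> continuous_on UNIV \<phi>')"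

lemma test_function_iff:
  "test_function A \<phi> \<longleftrightarrow> C1_fun \<phi> \<and> (\<exists>K. compact K \<and> K \<subseteq> A \<and> (\<forall>x. x \<notin> K \<longrightarrow> \<phi> x = 0))"
  by (simp add: test_function_def C1_fun_def)

lemma C1_fun_continuous: "C1_fun \<phi> \<Longrightarrow> continuous_on UNIV \<phi>"
  unfolding C1_fun_def
  by (metis differentiable_def differentiable_imp_continuous_on differentiable_on_def)

lemma C1_fun_const: "C1_fun (\<lambda>_. c)"
  unfolding C1_fun_def by (rule exI[of _ "\<lambda>_. 0"]) (auto intro!: continuous_intros simp: zero_blinfun.rep_eq)

lemma C1_fun_mult:
  assumes "C1_fun f" "C1_fun g"
  shows "C1_fun (\<lambda>x. f x * g x)"
proof -
  obtain f' where f: "\<And>x. (f has_derivative blinfun_apply (f' x)) (at x)" "continuous_on UNIV f'"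
    using assms(1) unfolding C1_fun_def by blast
  obtain g' where g: "\<And>x. (g has_derivative blinfun_apply (g' x)) (at x)" "continuous_on UNIV g'"
    using assms(2) unfolding C1_fun_def by blast
  show ?thesis
    unfolding C1_fun_def
    by (rule exI[of _ "\<lambda>x. f x *\<^sub>R g' x + g x *\<^sub>R f' x"])
       (auto intro!: derivative_eq_intros f g continuous_intros
          C1_fun_continuous assms simp: blinfun.bilinear_simps)
qed

lemma C1_fun_prod:
  assumes "\<And>i. i \<in> I \<Longrightarrow> C1_fun (f i)"
  shows "C1_fun (\<lambda>x. \<Prod>i\<in>I. f i x)"
  using assms
proof (induction I rule: infinite_finite_induct)
  case (insert i I)
  then show ?case by (simp add: C1_fun_mult)
qed (simp_all add: C1_fun_const)

text \<open>Lifts a one-dimensional profile to a function of one coordinate; cutoffs on boxes are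
  products of such factors.\<close>

lemma C1_fun_compose_inner:
  fixes i :: "'a::real_inner"
  assumes "\<And>t. (\<rho> has_real_derivative \<rho>' t) (at t)" and cont: "continuous_on UNIV \<rho>'"
  shows "C1_fun (\<lambda>x. \<rho> (x \<bullet> i))"
  unfolding C1_fun_def
proof (intro exI[of _ "\<lambda>x. \<rho>' (x \<bullet> i) *\<^sub>R blinfun_inner_left i"] conjI allI)
  show "continuous_on UNIV (\<lambda>x. \<rho>' (x \<bullet> i) *\<^sub>R blinfun_inner_left i)"
    by (intro continuous_intros continuous_on_compose2[OF cont]) auto
  show "((\<lambda>x. \<rho> (x \<bullet> i)) has_derivative blinfun_apply (\<rho>' (x \<bullet> i) *\<^sub>R blinfun_inner_left i)) (at x)"
    for x
  proof -
    have "(\<rho> has_derivative (\<lambda>y. \<rho>' (x \<bullet> i) * y)) (at (x \<bullet> i))"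
      using assms(1) by (simp add: has_field_derivative_def)
    from has_derivative_compose[where f = "\<lambda>x. x \<bullet> i" and f' = "\<lambda>h. h \<bullet> i" and s = UNIV, OF _ this]
    show ?thesis
      by (simp add: blinfun.scaleR_left[abs_def] has_derivative_inner_left inner_commute)
  qed
qed

lemma C1_funI_real:
  assumes "\<And>t. (\<rho> has_real_derivative \<rho>' t) (at t)" "continuous_on UNIV \<rho>'"
  shows "C1_fun \<rho>"
  using C1_fun_compose_inner[where i = "1::real" and \<rho> = \<rho>, OF assms] by simp

lemma C1_fun_realD:
  fixes \<phi> :: "real \<Rightarrow> real"
  assumes "C1_fun \<phi>"
  obtains \<phi>' where "\<And>t. (\<phi> has_real_derivative \<phi>' t) (at t)" "continuous_on UNIV \<phi>'"
proof -
  obtain p where p: "\<And>x. (\<phi> has_derivative blinfun_apply (p x)) (at x)" "continuous_on UNIV p"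
    using assms unfolding C1_fun_def by blast
  have eq: "blinfun_apply (p x) = (\<lambda>h. p x 1 * h)" for x
  proof
    fix h
    have "p x (h *\<^sub>R 1) = h *\<^sub>R p x 1" by (rule blinfun.scaleR_right)
    then show "p x h = p x 1 * h" by (simp add: mult.commute)
  qed
  show thesis
  proof (rule that[of "\<lambda>t. p t 1"])
    show "(\<phi> has_real_derivative p t 1) (at t)" for t
      using p(1)[of t] by (subst (asm) eq) (simp add: has_field_derivative_def)
    show "continuous_on UNIV (\<lambda>t. p t 1)"
      by (intro continuous_intros p)
  qed
qed

text \<open>For a < b the product (t - a)(b - t) is positive exactly between a and b. Subtracting
  1/(n+1) moves the support into a compact subset, squaring the positive part makes the function
  C^1, and x/(1 + x) with the growing weight n+1 keeps the values in [0, 1] while pushing them to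
  1.\<close>

definition bump :: "nat \<Rightarrow> real \<Rightarrow> real \<Rightarrow> real \<Rightarrow> real" where
  "bump n a b t =
     (let m = max 0 ((t - a) * (b - t) - 1 / Suc n) in Suc n * m\<^sup>2 / (1 + Suc n * m\<^sup>2))"

lemma has_derivative_max0_square:
  "((\<lambda>y::real. (max 0 y)\<^sup>2) has_real_derivative 2 * max 0 y) (at y)"
proof (cases y "0::real" rule: linorder_cases)
  case less
  have "((\<lambda>y. 0) has_real_derivative 2 * max 0 y) (at y)" using less by simp
  then show ?thesis
    by (rule has_field_derivative_transform_within_open[of _ _ _ "{..<0}"]) (use less in auto)
next
  case greater
  have "((\<lambda>y. y\<^sup>2) has_real_derivative 2 * max 0 y) (at y)"
    using greater by (auto intro!: derivative_eq_intros)
  then show ?thesis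
    by (rule has_field_derivative_transform_within_open[of _ _ _ "{0<..}"]) (use greater in auto)
next
  \<comment> \<open>At 0 the difference quotient is bounded by |h|, so the two one-sided formulas
    meet with derivative 0.\<close>
  case equal
  have "((\<lambda>h. ((max 0 h)\<^sup>2) / h) \<longlongrightarrow> 0) (at (0::real))"
  proof (rule Lim_null_comparison)
    show "\<forall>\<^sub>F h in at 0. norm ((max 0 h)\<^sup>2 / h) \<le> \<bar>h::real\<bar>"
      by (rule always_eventually) (auto simp: power2_eq_square max_def)
    show "((\<lambda>h. \<bar>h::real\<bar>) \<longlongrightarrow> 0) (at 0)"
      by (rule tendsto_rabs_zero) simp
  qed
  then show ?thesis using equal by (simp add: DERIV_def)
qed

lemma bump_deriv:
  obtains \<rho>' where "\<And>t. (bump n a b has_real_derivative \<rho>' t) (at t)" "continuous_on UNIV \<rho>'"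
proof -
  define q where "q t = (t - a) * (b - t) - 1 / Suc n" for t
  define r where "r t = 2 * max 0 (q t) * (a + b - 2 * t)" for t
  have q: "(q has_real_derivative (a + b - 2 * t)) (at t)" for t
    unfolding q_def by (auto intro!: derivative_eq_intros)
  have contq: "continuous_on UNIV q"
    unfolding q_def by (intro continuous_intros)
  have r: "((\<lambda>t. (max 0 (q t))\<^sup>2) has_real_derivative r t) (at t)" for t
    using DERIV_chain2[OF has_derivative_max0_square q, of t] unfolding r_def by simp
  have pos: "1 + Suc n * (max 0 (q t))\<^sup>2 \<noteq> 0" for t
    by (metis add_pos_nonneg less_irrefl mult_nonneg_nonneg of_nat_0_le_iff zero_le_power2 zero_less_one)
  have bump: "bump n a b = (\<lambda>t. Suc n * (max 0 (q t))\<^sup>2 / (1 + Suc n * (max 0 (q t))\<^sup>2))"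
    by (simp add: bump_def[abs_def] Let_def q_def)
  define \<rho>' where "\<rho>' t = ((Suc n * r t) * (1 + Suc n * (max 0 (q t))\<^sup>2)
      - (Suc n * (max 0 (q t))\<^sup>2) * (Suc n * r t)) / (1 + Suc n * (max 0 (q t))\<^sup>2)\<^sup>2" for t
  show thesis
  proof (rule that[of \<rho>'])
    show "(bump n a b has_real_derivative \<rho>' t) (at t)" for t
      unfolding bump \<rho>'_def power2_eq_square[of "1 + _"]
      by (intro DERIV_divide pos DERIV_cmult r) (use DERIV_add[OF DERIV_const DERIV_cmult[OF r]] in simp)
    show "continuous_on UNIV \<rho>'"
      unfolding \<rho>'_def r_def using pos
      by (intro continuous_intros contq ballI) auto
  qed
qed

lemma bump_bounds: "0 \<le> bump n a b t" "bump n a b t \<le> 1"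
proof -
  have "0 \<le> x / (1 + x) \<and> x / (1 + x) \<le> 1" if "x \<ge> 0" for x :: real
    using that by (auto simp: divide_simps)
  from this[of "real (Suc n) * (max 0 ((t - a) * (b - t) - 1 / Suc n))\<^sup>2"]
  show "0 \<le> bump n a b t" "bump n a b t \<le> 1"
    by (simp_all add: bump_def Let_def)
qed

lemma bump_nonzero:
  assumes "bump n a b t \<noteq> 0"
  shows "(t - a) * (b - t) \<ge> 1 / Suc n"
  using assms by (auto simp: bump_def Let_def max_def split: if_splits)

lemma bump_nonzero_bounds:
  assumes "(t - a) * (b - t) \<ge> 1 / Suc n" "a < b"
  shows "a < t" "t < b"
proof -
  have "(t - a) * (b - t) > 0" using assms(1) by (meson less_le_trans of_nat_0_less_iff zero_less_Suc zero_less_divide_1_iff)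
  then show "a < t" "t < b" using assms(2) by (auto simp: zero_less_mult_iff)
qed

text \<open>Between a and b the squared excess tends to a positive limit, so its product with n+1
  tends to infinity and x/(1 + x) = 1 - 1/(1 + x) to 1; elsewhere every bump vanishes.\<close>

lemma bump_tendsto:
  assumes "a < b"
  shows "(\<lambda>n. bump n a b t) \<longlonglongrightarrow> indicator {a<..<b} t"
proof (cases "a < t \<and> t < b")
  case False
  then have "bump n a b t = 0" for n
    using bump_nonzero[of n a b t] bump_nonzero_bounds[of n t a b] assms by auto
  then show ?thesis using False by auto
next
  case True
  define d where "d = (t - a) * (b - t)"
  have d: "d > 0" using True by (simp add: d_def)
  have inv: "(\<lambda>n. 1 / real (Suc n)) \<longlonglongrightarrow> 0"
    using LIMSEQ_inverse_real_of_nat by (simp add: inverse_eq_divide)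
  have m: "(\<lambda>n. (max 0 (d - 1 / real (Suc n)))\<^sup>2) \<longlonglongrightarrow> (max 0 (d - 0))\<^sup>2"
    by (intro tendsto_intros inv)
  have "filterlim (\<lambda>n. real (Suc n)) at_top sequentially"
    by (intro filterlim_compose[OF filterlim_real_sequentially] filterlim_Suc)
  from filterlim_at_top_mult_tendsto_pos[OF m _ this]
  have "filterlim (\<lambda>n. real (Suc n) * (max 0 (d - 1 / real (Suc n)))\<^sup>2) at_top sequentially"
    using d by simp
  then have "filterlim (\<lambda>n. 1 + real (Suc n) * (max 0 (d - 1 / real (Suc n)))\<^sup>2) at_top sequentially"
    by (rule filterlim_tendsto_add_at_top[OF tendsto_const])
  then have "(\<lambda>n. 1 - inverse (1 + real (Suc n) * (max 0 (d - 1 / real (Suc n)))\<^sup>2)) \<longlonglongrightarrow> 1 - 0"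
    by (intro tendsto_intros tendsto_inverse_0_at_top)
  moreover have "1 - inverse (1 + x) = x / (1 + x)" if "x \<ge> 0" for x :: real
    using that by (auto simp: field_simps)
  ultimately show ?thesis
    using True by (simp add: bump_def Let_def d_def)
qed

definition box_bump :: "nat \<Rightarrow> 'a::euclidean_space \<Rightarrow> 'a \<Rightarrow> 'a \<Rightarrow> real" where
  "box_bump n a b x = (\<Prod>i\<in>Basis. bump n (a \<bullet> i) (b \<bullet> i) (x \<bullet> i))"

lemma box_bump_bounds: "0 \<le> box_bump n a b x" "box_bump n a b x \<le> 1"
  unfolding box_bump_def by (auto intro!: prod_nonneg prod_le_1 bump_bounds)

lemma box_bump_test_function:
  assumes ne: "\<And>i. i \<in> Basis \<Longrightarrow> a \<bullet> i < b \<bullet> i" and sub: "box a b \<subseteq> A"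
  shows "test_function A (box_bump n a b)"
  unfolding test_function_iff
proof
  show "C1_fun (box_bump n a b)"
    unfolding box_bump_def[abs_def]
  proof (rule C1_fun_prod)
    fix i :: 'a
    obtain \<rho>' where "\<And>t. (bump n (a \<bullet> i) (b \<bullet> i) has_real_derivative \<rho>' t) (at t)"
      "continuous_on UNIV \<rho>'"
      using bump_deriv by blast
    then show "C1_fun (\<lambda>x. bump n (a \<bullet> i) (b \<bullet> i) (x \<bullet> i))"
      by (rule C1_fun_compose_inner)
  qed
  \<comment> \<open>The conditions are closed and force every coordinate strictly between its
    bounds, so \<open>?K\<close> is a compact subset of the open box; outside it some factor is
    zero.\<close>
  let ?K = "\<Inter>i\<in>Basis. {x. (x \<bullet> i - a \<bullet> i) * (b \<bullet> i - x \<bullet> i) \<ge> 1 / Suc n}"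
  have sub': "?K \<subseteq> box a b"
  proof
    fix x assume x: "x \<in> ?K"
    have "a \<bullet> i < x \<bullet> i \<and> x \<bullet> i < b \<bullet> i" if i: "i \<in> Basis" for i
      using bump_nonzero_bounds[OF _ ne[OF i], of n "x \<bullet> i"] x i by auto
    then show "x \<in> box a b" by (simp add: mem_box)
  qed
  moreover have "closed ?K"
    by (intro closed_INT ballI closed_Collect_le continuous_intros)
  moreover have "bounded ?K"
    using sub' bounded_box bounded_subset by blast
  moreover have "\<forall>x. x \<notin> ?K \<longrightarrow> box_bump n a b x = 0"
    using bump_nonzero by (fastforce simp: box_bump_def)
  ultimately show "\<exists>K. compact K \<and> K \<subseteq> A \<and> (\<forall>x. x \<notin> K \<longrightarrow> box_bump n a b x = 0)"
    using sub by (intro exI[of _ ?K]) (auto simp: compact_eq_bounded_closed)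
qed

lemma box_bump_tendsto:
  assumes ne: "\<And>i. i \<in> Basis \<Longrightarrow> a \<bullet> i < b \<bullet> i"
  shows "(\<lambda>n. box_bump n a b x) \<longlonglongrightarrow> indicator (box a b) x"
proof -
  have "(\<lambda>n. box_bump n a b x) \<longlonglongrightarrow> (\<Prod>i\<in>Basis. indicator {a \<bullet> i<..<b \<bullet> i} (x \<bullet> i))"
    unfolding box_bump_def by (intro tendsto_prod bump_tendsto ne)
  also have "(\<Prod>i\<in>Basis. indicator {a \<bullet> i<..<b \<bullet> i} (x \<bullet> i)) = (indicator (box a b) x :: real)"
    by (auto simp: indicator_def mem_box prod_zero_iff)
  finally show ?thesis .
qed

section \<open>The fundamental lemma of the calculus of variations\<close>

text \<open>Dynkin argument: open boxes are stable under intersection and generate the Borel sets,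
  and the sets on which f integrates to zero are closed under complements and countable disjoint
  unions.\<close>

lemma AE_zero_if_box_integrals_zero:
  fixes f :: "'a::euclidean_space \<Rightarrow> complex"
  assumes int: "integrable lborel f"
    and zero: "\<And>a b. (LINT x:box a b|lborel. f x) = 0"
  shows "AE x in lborel. f x = 0"
proof (rule sigma_finite_measure.density_zero[OF lborel.sigma_finite_measure_axioms int])
  let ?E = "range (\<lambda>(a, b). box a b::'a set)"
  have sint: "set_integrable lborel A f" if "A \<in> sets borel" for A
    using integrable_mult_indicator[of A lborel f] int that by (simp add: set_integrable_def)
  \<comment> \<open>Complements can be handled only once the whole space is known to integrate to
    zero; an increasing sequence of boxes exhausts it.\<close>
  have univ: "(LINT x:UNIV|lborel. f x) = 0"
  proof -
    let ?A = "\<lambda>n::nat. box (- (real n *\<^sub>R One)) (real n *\<^sub>R One) :: 'a set"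
    have "incseq ?A"
      by (auto simp: incseq_def mem_box inner_Basis le_less_trans less_le_trans)
        (meson le_less_trans less_le_trans neg_le_iff_le of_nat_le_iff)+
    from set_integral_cont_up[OF _ this, of lborel f]
    have "(\<lambda>i. LINT x:?A i|lborel. f x) \<longlonglongrightarrow> (LINT x:UNIV|lborel. f x)"
      using sint[of UNIV] by (simp add: UN_box_eq_UNIV)
    then show ?thesis by (simp add: zero LIMSEQ_const_iff)
  qed
  fix A :: "'a set" assume "A \<in> sets lborel"
  then have "A \<in> sigma_sets UNIV ?E" by (simp add: borel_eq_box)
  then show "(LINT x:A|lborel. f x) = 0"
  proof (rule sigma_sets_induct_disjoint[where P = "\<lambda>A. (LINT x:A|lborel. f x) = 0", rotated 2])
    show "Int_stable ?E" by (auto simp: Int_stable_def box_Int_box)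
    show "(LINT x:A|lborel. f x) = 0" if "A \<in> ?E" for A
      using that zero by auto
    show "(LINT x:{}|lborel. f x) = 0" by (simp add: set_lebesgue_integral_def)
    show "(LINT x:UNIV - A|lborel. f x) = 0"
      if "A \<in> sigma_sets UNIV ?E" "(LINT x:A|lborel. f x) = 0" for A
    proof -
      have A: "A \<in> sets borel" using that by (simp add: borel_eq_box)
      have "(LINT x:A \<union> (UNIV - A)|lborel. f x) = (LINT x:A|lborel. f x) + (LINT x:UNIV - A|lborel. f x)"
        using A by (intro set_integral_Un sint) auto
      then show ?thesis using univ that(2) by simp
    qed
    show "(LINT x:(\<Union>i. A i)|lborel. f x) = 0"
      if "disjoint_family A" "range A \<subseteq> sigma_sets UNIV ?E" "\<And>i. (LINT x:A i|lborel. f x) = 0"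
      for A :: "nat \<Rightarrow> 'a set"
    proof -
      have A: "\<And>i. A i \<in> sets borel" using that(2) by (auto simp: borel_eq_box)
      have "(LINT x:(\<Union>i. A i)|lborel. f x) = (\<Sum>i. (LINT x:(A i)|lborel. f x))"
        using A that(1) by (intro lebesgue_integral_countable_add sint) (auto simp: disjoint_family_on_def)
      then show ?thesis using that(3) by simp
    qed
  qed auto
qed

text \<open>Bridge from the completed measure to \<open>lborel\<close>, where the product measure
  theorems apply.\<close>

lemma borel_representative:
  fixes f :: "'a::euclidean_space \<Rightarrow> complex"
  assumes "f \<in> borel_measurable lebesgue"
  obtains f' where "f' \<in> borel_measurable borel" "AE x in lborel. f x = f' x"
proof -
  have "(\<lambda>x. Re (f x)) \<in> borel_measurable lebesgue" "(\<lambda>x. Im (f x)) \<in> borel_measurable lebesgue"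
    using assms by simp_all
  from this[THEN completion_ex_borel_measurable_real] obtain r i
    where "r \<in> borel_measurable lborel" "AE x in lborel. Re (f x) = r x"
      "i \<in> borel_measurable lborel" "AE x in lborel. Im (f x) = i x"
    by blast
  then show thesis
    by (intro that[of "\<lambda>x. Complex (r x) (i x)"]) (auto simp: borel_measurable_complex_iff complex_eq_iff)
qed

text \<open>Equality almost everywhere with a Borel function already makes f Lebesgue measurable,
  because the measure is complete; hence f itself carries no measurability assumption.\<close>

lemma integral_lebesgue_representative:
  fixes f :: "'a::euclidean_space \<Rightarrow> complex"
  assumes f': "f' \<in> borel_measurable borel" and ae: "AE x in lborel. f x = f' x"
  shows "integrable lebesgue f \<longleftrightarrow> integrable lborel f'"
    and "integral\<^sup>L lebesgue f = integral\<^sup>L lborel f'"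
proof -
  have f'm: "f' \<in> borel_measurable lebesgue" using f' by (simp add: measurable_completion)
  have ae': "AE x in lebesgue. f x = f' x" using ae by (rule AE_completion)
  have fm: "f \<in> borel_measurable lebesgue"
    by (rule borel_measurable_AE[OF f'm]) (use ae' in auto)
  show "integrable lebesgue f \<longleftrightarrow> integrable lborel f'"
    using integrable_cong_AE[OF fm f'm ae'] f' by (simp add: integrable_completion)
  show "integral\<^sup>L lebesgue f = integral\<^sup>L lborel f'"
    using integral_cong_AE[OF fm f'm ae'] f' by (simp add: integral_completion)
qed

text \<open>Fundamental lemma. After extension by zero, the integral over any box is a limit of
  integrals against bumps, with |F| as dominating function; so all box integrals vanish.\<close>

lemma AE_zero_if_test_integrals_zero:
  fixes f :: "'a::euclidean_space \<Rightarrow> complex"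
  assumes int: "set_integrable lebesgue (box p q) f"
    and zero: "\<And>\<phi>. test_function (box p q) \<phi> \<Longrightarrow> (LINT x:box p q|lebesgue. \<phi> x *\<^sub>R f x) = 0"
  shows "AE x in lebesgue. x \<in> box p q \<longrightarrow> f x = 0"
proof -
  let ?A = "box p q"
  define F where "F x = indicator ?A x *\<^sub>R f x" for x
  have F: "integrable lebesgue F" using int by (simp add: set_integrable_def F_def[abs_def])
  obtain F' where F': "F' \<in> borel_measurable borel" "AE x in lborel. F x = F' x"
    using borel_representative[OF borel_measurable_integrable[OF F]] by blast
  have intF': "integrable lborel F'"
    using integral_lebesgue_representative(1)[OF F'] F by simp
  have boxes: "(LINT x:box a b|lborel. F' x) = 0" for a b :: 'a
  proof -
    \<comment> \<open>Corners of the intersection of the two boxes; bumps on it are test functions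
      for the given domain.\<close>
    define a' where "a' = (\<Sum>i\<in>Basis. max (a \<bullet> i) (p \<bullet> i) *\<^sub>R i)"
    define b' where "b' = (\<Sum>i\<in>Basis. min (b \<bullet> i) (q \<bullet> i) *\<^sub>R i)"
    have box': "box a b \<inter> ?A = box a' b'"
      unfolding a'_def b'_def by (rule box_Int_box)
    have "(LINT x:box a b|lborel. F' x) = (LINT x|lebesgue. indicator (box a b) x *\<^sub>R F x)"
      unfolding set_lebesgue_integral_def
      by (rule integral_lebesgue_representative(2)[symmetric]) (use F' in auto)
    also have "(\<lambda>x. indicator (box a b) x *\<^sub>R F x) = (\<lambda>x. indicator (box a' b') x *\<^sub>R F x)"
      unfolding F_def box'[symmetric] by (auto simp: indicator_def)
    also have "(LINT x|lebesgue. indicator (box a' b') x *\<^sub>R F x) = 0"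
    \<comment> \<open>The bumps require \<open>a'\<close> to lie strictly below \<open>b'\<close> in
      every coordinate, which is nonemptiness of the intersection.\<close>
    proof (cases "box a' b' = {}")
      case False
      then have ne: "\<And>i. i \<in> Basis \<Longrightarrow> a' \<bullet> i < b' \<bullet> i" by (simp add: box_ne_empty)
      have meas: "box_bump n a' b' \<in> borel_measurable lebesgue" for n
      proof -
        have "continuous_on UNIV (box_bump n a' b')"
          using box_bump_test_function[OF ne order_refl] by (auto simp: test_function_iff C1_fun_continuous)
        then show ?thesis by (simp add: borel_measurable_continuous_onI measurable_completion)
      qed
      have "(\<lambda>n. LINT x|lebesgue. box_bump n a' b' x *\<^sub>R F x) \<longlonglongrightarrow> (LINT x|lebesgue. indicator (box a' b') x *\<^sub>R F x)"
      proof (rule integral_dominated_convergence[where w = "\<lambda>x. norm (F x)"])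
        show "AE x in lebesgue. (\<lambda>n. box_bump n a' b' x *\<^sub>R F x) \<longlonglongrightarrow> indicator (box a' b') x *\<^sub>R F x"
          using box_bump_tendsto[OF ne] by (auto intro!: tendsto_intros)
        show "AE x in lebesgue. norm (box_bump n a' b' x *\<^sub>R F x) \<le> norm (F x)" for n
          using box_bump_bounds[of n a' b'] by (auto simp: mult_left_le_one_le abs_le_iff)
      qed (use F meas in \<open>auto intro!: borel_measurable_scaleR borel_measurable_integrable integrable_mult_indicator\<close>)
      moreover have "(LINT x|lebesgue. box_bump n a' b' x *\<^sub>R F x) = 0" for n
      proof -
        have "(LINT x:?A|lebesgue. box_bump n a' b' x *\<^sub>R f x) = 0"
          using box' by (intro zero box_bump_test_function ne) auto
        then show ?thesis
          by (simp add: set_lebesgue_integral_def F_def mult.commute)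
      qed
      ultimately show ?thesis by (simp add: LIMSEQ_const_iff)
    qed simp
    finally show ?thesis .
  qed
  have "AE x in lborel. F' x = 0"
    by (rule AE_zero_if_box_integrals_zero[OF intF' boxes])
  with F'(2) have "AE x in lborel. F x = 0" by eventually_elim simp
  then have "AE x in lebesgue. F x = 0" by (rule AE_completion)
  then show ?thesis
    by eventually_elim (simp add: F_def split: split_indicator_asm)
qed

section \<open>Square integrable functions and weak derivatives\<close>

lemma emeasure_box_less_top: "emeasure lborel (box p q) < top"
  using emeasure_lborel_box_finite by simp

lemma emeasure_Ioo_less_top: "emeasure lborel {a<..<b::real} < top"
  using emeasure_box_less_top[of a b] by simp

lemma set_integrable_bounded_mult:
  fixes f k :: "'a::euclidean_space \<Rightarrow> complex"
  assumes f: "set_integrable lebesgue A f" and k: "set_borel_measurable lebesgue A k"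
    and bound: "\<And>x. x \<in> A \<Longrightarrow> cmod (k x) \<le> C"
  shows "set_integrable lebesgue A (\<lambda>x. k x * f x)"
proof -
  have "integrable lebesgue (\<lambda>x. indicator A x *\<^sub>R (k x * f x))"
  proof (rule Bochner_Integration.integrable_bound)
    show "integrable lebesgue (\<lambda>x. C *\<^sub>R (indicator A x *\<^sub>R f x))"
      using f unfolding set_integrable_def by (rule integrable_scaleR_right)
    have "(\<lambda>x. (indicator A x *\<^sub>R k x) * (indicator A x *\<^sub>R f x)) \<in> borel_measurable lebesgue"
      using k f unfolding set_borel_measurable_def set_integrable_def
      by (intro borel_measurable_times) auto
    then show "(\<lambda>x. indicator A x *\<^sub>R (k x * f x)) \<in> borel_measurable lebesgue"
      by (rule measurable_cong[THEN iffD1, rotated]) (auto simp: indicator_def)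
    show "AE x in lebesgue. cmod (indicator A x *\<^sub>R (k x * f x)) \<le> cmod (C *\<^sub>R (indicator A x *\<^sub>R f x))"
      using bound
      by (intro always_eventually allI)
         (auto simp: norm_mult indicator_def intro!: mult_right_mono order_trans[OF bound abs_ge_self])
  qed
  then show ?thesis by (simp add: set_integrable_def)
qed

lemma set_borel_measurable_lebesgue_continuous:
  fixes k :: "'a::euclidean_space \<Rightarrow> 'b::{real_normed_vector, second_countable_topology}"
  assumes "continuous_on A k" "A \<in> sets borel"
  shows "set_borel_measurable lebesgue A k"
proof -
  have "set_borel_measurable borel A k"
    using assms by (intro set_measurable_continuous_on) auto
  then show ?thesis
    unfolding set_borel_measurable_def by (simp add: measurable_completion)
qed

lemma set_integrable_continuous_mult_box:
  fixes f k :: "'a::euclidean_space \<Rightarrow> complex"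
  assumes f: "set_integrable lebesgue (box p q) f" and k: "continuous_on (cbox p q) k"
  shows "set_integrable lebesgue (box p q) (\<lambda>x. k x * f x)"
proof -
  have "compact (k ` cbox p q)" by (intro compact_continuous_image k compact_cbox)
  then obtain C where "\<And>x. x \<in> cbox p q \<Longrightarrow> cmod (k x) \<le> C"
    by (meson bounded_iff compact_imp_bounded imageI)
  then show ?thesis
    using box_subset_cbox[of p q]
    by (intro set_integrable_bounded_mult[OF f, where C = C] set_borel_measurable_lebesgue_continuous
          continuous_on_subset[OF k]) auto
qed

lemma L2_on_cong: "(\<And>x. x \<in> A \<Longrightarrow> f x = g x) \<Longrightarrow> L2_on A f \<longleftrightarrow> L2_on A g"
  unfolding L2_on_def set_borel_measurable_def set_integrable_def
  by (intro arg_cong2[where f = "(\<and>)"] measurable_cong Bochner_Integration.integrable_cong)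
     (auto simp: indicator_def)

lemma L2_on_add:
  assumes f: "L2_on A f" and g: "L2_on A g"
  shows "L2_on A (\<lambda>x. f x + g x)"
  unfolding L2_on_def
proof
  have "(\<lambda>x. indicator A x *\<^sub>R f x + indicator A x *\<^sub>R g x) \<in> borel_measurable lebesgue"
    using f g unfolding L2_on_def set_borel_measurable_def by (intro borel_measurable_add) auto
  then show m: "set_borel_measurable lebesgue A (\<lambda>x. f x + g x)"
    unfolding set_borel_measurable_def by (simp add: scaleR_add_right)
  have "integrable lebesgue (\<lambda>x. 2 * (indicator A x *\<^sub>R (cmod (f x))\<^sup>2) + 2 * (indicator A x *\<^sub>R (cmod (g x))\<^sup>2))"
    using f g unfolding L2_on_def set_integrable_def
    by (intro Bochner_Integration.integrable_add integrable_mult_right) auto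
  then have "integrable lebesgue (\<lambda>x. indicator A x *\<^sub>R (cmod (f x + g x))\<^sup>2)"
  proof (rule Bochner_Integration.integrable_bound)
    have "(\<lambda>x. (cmod (indicator A x *\<^sub>R (f x + g x)))\<^sup>2) \<in> borel_measurable lebesgue"
      using m unfolding set_borel_measurable_def
      by (intro borel_measurable_power measurable_compose[OF _ borel_measurable_norm])
    then show "(\<lambda>x. indicator A x *\<^sub>R (cmod (f x + g x))\<^sup>2) \<in> borel_measurable lebesgue"
      by (rule measurable_cong[THEN iffD1, rotated]) (auto simp: indicator_def)
    have "(cmod (f x + g x))\<^sup>2 \<le> 2 * (cmod (f x))\<^sup>2 + 2 * (cmod (g x))\<^sup>2" for x
    proof -
      have "(cmod (f x + g x))\<^sup>2 \<le> (cmod (f x) + cmod (g x))\<^sup>2"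
        by (intro power_mono norm_triangle_ineq) auto
      also have "\<dots> \<le> 2 * (cmod (f x))\<^sup>2 + 2 * (cmod (g x))\<^sup>2"
        using zero_le_power2[of "cmod (f x) - cmod (g x)"] by (simp add: power2_eq_square algebra_simps)
      finally show ?thesis .
    qed
    then show "AE x in lebesgue. norm (indicator A x *\<^sub>R (cmod (f x + g x))\<^sup>2)
        \<le> norm (2 * (indicator A x *\<^sub>R (cmod (f x))\<^sup>2) + 2 * (indicator A x *\<^sub>R (cmod (g x))\<^sup>2))"
      by (intro always_eventually allI) (auto simp: indicator_def)
  qed
  then show "set_integrable lebesgue A (\<lambda>x. (cmod (f x + g x))\<^sup>2)"
    by (simp add: set_integrable_def)
qed

lemma L2_on_zero: "L2_on A (\<lambda>_. 0)"
  by (simp add: L2_on_def set_borel_measurable_def set_integrable_def)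

text \<open>The box has finite measure, so 1 + |f|^2 is an integrable bound for |f|.\<close>

lemma L2_on_imp_set_integrable:
  assumes f: "L2_on (box p q) f"
  shows "set_integrable lebesgue (box p q) f"
proof -
  have "integrable lebesgue (\<lambda>x. indicator (box p q) x *\<^sub>R (1::real) + indicator (box p q) x *\<^sub>R (cmod (f x))\<^sup>2)"
    using f unfolding L2_on_def set_integrable_def
    by (intro Bochner_Integration.integrable_add) (auto simp: integrable_indicator_iff emeasure_box_less_top)
  then have "integrable lebesgue (\<lambda>x. indicator (box p q) x *\<^sub>R f x)"
  proof (rule Bochner_Integration.integrable_bound)
    show "(\<lambda>x. indicator (box p q) x *\<^sub>R f x) \<in> borel_measurable lebesgue"
      using f by (simp add: L2_on_def set_borel_measurable_def)
    have "y \<le> 1 + y\<^sup>2" for y :: real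
      using zero_le_power2[of "y - 1/2"] by (simp add: power2_eq_square algebra_simps)
    then show "AE x in lebesgue. norm (indicator (box p q) x *\<^sub>R f x)
        \<le> norm (indicator (box p q) x *\<^sub>R 1 + indicator (box p q) x *\<^sub>R (cmod (f x))\<^sup>2)"
      by (intro always_eventually allI) (auto simp: indicator_def abs_of_nonneg)
  qed
  then show ?thesis by (simp add: set_integrable_def)
qed

lemma L2_on_bounded_measurable:
  assumes m: "set_borel_measurable lebesgue (box p q) f" and b: "\<And>x. x \<in> box p q \<Longrightarrow> cmod (f x) \<le> C"
  shows "L2_on (box p q) f"
  unfolding L2_on_def
proof
  have "integrable lebesgue (\<lambda>x. indicator (box p q) x * C\<^sup>2)"
    by (auto simp: integrable_indicator_iff emeasure_box_less_top)
  then have "integrable lebesgue (\<lambda>x. indicator (box p q) x *\<^sub>R (cmod (f x))\<^sup>2)"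
  proof (rule Bochner_Integration.integrable_bound)
    have "(\<lambda>x. (cmod (indicator (box p q) x *\<^sub>R (f x)))\<^sup>2) \<in> borel_measurable lebesgue"
      using m unfolding set_borel_measurable_def
      by (intro borel_measurable_power measurable_compose[OF _ borel_measurable_norm])
    then show "(\<lambda>x. indicator (box p q) x *\<^sub>R (cmod (f x))\<^sup>2) \<in> borel_measurable lebesgue"
      by (rule measurable_cong[THEN iffD1, rotated]) (auto simp: indicator_def)
    show "AE x in lebesgue. norm (indicator (box p q) x *\<^sub>R (cmod (f x))\<^sup>2) \<le> norm (indicator (box p q) x * C\<^sup>2)"
      using b by (intro always_eventually allI) (auto simp: indicator_def power_mono)
  qed
  then show "set_integrable lebesgue (box p q) (\<lambda>x. (cmod (f x))\<^sup>2)"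
    by (simp add: set_integrable_def)
qed (rule m)

lemma test_function_continuous: "test_function A \<phi> \<Longrightarrow> continuous_on S \<phi>"
  unfolding test_function_iff using C1_fun_continuous continuous_on_subset by blast

lemma test_function_derivative:
  assumes "test_function A \<phi>"
  shows "(\<phi> has_derivative frechet_derivative \<phi> (at x)) (at x)"
    and "continuous_on S (\<lambda>x. frechet_derivative \<phi> (at x) b)"
proof -
  obtain \<phi>' :: "'a \<Rightarrow> 'a \<Rightarrow>\<^sub>L real" where
    d: "\<And>x. (\<phi> has_derivative blinfun_apply (\<phi>' x)) (at x)" and c: "continuous_on UNIV \<phi>'"
    using assms unfolding test_function_def by blast
  have eq: "frechet_derivative \<phi> (at x) = blinfun_apply (\<phi>' x)" for x
    using frechet_derivative_at[OF d] by simp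
  show "(\<phi> has_derivative frechet_derivative \<phi> (at x)) (at x)" using d eq by simp
  show "continuous_on S (\<lambda>x. frechet_derivative \<phi> (at x) b)"
    unfolding eq by (intro continuous_intros continuous_on_subset[OF c]) auto
qed

lemma set_integrable_test_function:
  assumes "test_function A \<phi>" "L2_on (box p q) w"
  shows "set_integrable lebesgue (box p q) (\<lambda>x. \<phi> x *\<^sub>R w x)"
    and "set_integrable lebesgue (box p q) (\<lambda>x. frechet_derivative \<phi> (at x) b *\<^sub>R w x)"
  unfolding scaleR_conv_of_real
  by (intro set_integrable_continuous_mult_box L2_on_imp_set_integrable assms continuous_intros
        test_function_continuous[OF assms(1)] test_function_derivative[OF assms(1)])+

section \<open>Calculus of weak derivatives on boxes\<close>

lemma has_weak_derivative_cong:
  assumes "\<And>x. x \<in> A \<Longrightarrow> w x = w' x" "\<And>x. x \<in> A \<Longrightarrow> g x = g' x"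
  shows "has_weak_derivative w g b A \<longleftrightarrow> has_weak_derivative w' g' b A"
proof -
  have "(LINT x:A|lebesgue. frechet_derivative \<phi> (at x) b *\<^sub>R w x)
      = (LINT x:A|lebesgue. frechet_derivative \<phi> (at x) b *\<^sub>R w' x)"
    "(LINT x:A|lebesgue. \<phi> x *\<^sub>R g x) = (LINT x:A|lebesgue. \<phi> x *\<^sub>R g' x)" for \<phi>
    unfolding set_lebesgue_integral_def
    by (auto intro!: Bochner_Integration.integral_cong simp: indicator_def assms)
  then show ?thesis
    unfolding has_weak_derivative_def using L2_on_cong[of A w w'] L2_on_cong[of A g g'] assms by simp
qed

lemma has_weak_derivative_zero: "has_weak_derivative (\<lambda>_. 0) (\<lambda>_. 0) b A"
  by (simp add: has_weak_derivative_def L2_on_zero)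

text \<open>Integrals against a test function may be split only when both parts are integrable; on a
  box this follows from square integrability.\<close>

lemma has_weak_derivative_add:
  assumes "has_weak_derivative w g b (box p q)" "has_weak_derivative w' g' b (box p q)"
  shows "has_weak_derivative (\<lambda>x. w x + w' x) (\<lambda>x. g x + g' x) b (box p q)"
  using assms unfolding has_weak_derivative_def
  by (auto simp: L2_on_add scaleR_add_right set_integral_add(2) set_integrable_test_function)

lemma has_weak_derivative_sum:
  assumes "\<And>i. i \<in> I \<Longrightarrow> has_weak_derivative (w i) (g i) b (box p q)"
  shows "has_weak_derivative (\<lambda>x. \<Sum>i\<in>I. w i x) (\<lambda>x. \<Sum>i\<in>I. g i x) b (box p q)"
  using assms
  by (induction I rule: infinite_finite_induct)
     (auto intro: has_weak_derivative_zero has_weak_derivative_add)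

lemma has_weak_derivative_unique:
  assumes "has_weak_derivative w g b (box p q)" "has_weak_derivative w g' b (box p q)"
  shows "AE x in lebesgue. x \<in> box p q \<longrightarrow> g x = g' x"
proof -
  have L2: "L2_on (box p q) g" "L2_on (box p q) g'"
    using assms by (auto simp: has_weak_derivative_def)
  have "AE x in lebesgue. x \<in> box p q \<longrightarrow> g x - g' x = 0"
  proof (rule AE_zero_if_test_integrals_zero)
    show "set_integrable lebesgue (box p q) (\<lambda>x. g x - g' x)"
      using L2 by (intro set_integral_diff L2_on_imp_set_integrable)
    fix \<phi> :: "'a \<Rightarrow> real" assume t: "test_function (box p q) \<phi>"
    have "(LINT x:box p q|lebesgue. \<phi> x *\<^sub>R g x) = (LINT x:box p q|lebesgue. \<phi> x *\<^sub>R g' x)"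
      using assms t unfolding has_weak_derivative_def by (metis neg_equal_iff_equal)
    then show "(LINT x:box p q|lebesgue. \<phi> x *\<^sub>R (g x - g' x)) = 0"
      using set_integrable_test_function(1)[OF t] L2
      by (simp add: scaleR_diff_right set_integral_diff(2))
  qed
  then show ?thesis by eventually_elim simp
qed

text \<open>The choice behind \<open>weak_derivative\<close> is meaningful once some weak derivative
  is exhibited; uniqueness then ties the chosen one to the explicit one.\<close>

lemma weak_derivative_AE:
  assumes "has_weak_derivative w g b (box p q)"
  shows "AE x in lebesgue. x \<in> box p q \<longrightarrow> weak_derivative (box p q) b w x = g x"
proof (rule has_weak_derivative_unique)
  show "has_weak_derivative w (weak_derivative (box p q) b w) b (box p q)"
    unfolding weak_derivative_def
    by (rule someI[where P = "\<lambda>g. has_weak_derivative w g b (box p q)"]) (rule assms)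
qed (rule assms)

section \<open>Iterated integrals on rectangles\<close>

text \<open>Exceptional heights become a null set in the plane. This serves both the exchange of a
  function of x_2 for its Borel representative and the removal of the lines between slices.\<close>

lemma AE_lborel_snd:
  assumes "AE t in lborel. P (t :: real)"
  shows "AE x in lborel. P (snd (x :: real \<times> real))"
proof -
  obtain N where N: "N \<in> null_sets lborel" "{t. \<not> P t} \<subseteq> N"
    using assms by (auto simp: eventually_ae_filter)
  have "AE x in lborel \<Otimes>\<^sub>M lborel. snd (x :: real \<times> real) \<notin> N"
  proof (rule lborel_pair.AE_pair_measure)
    have "(\<lambda>x::real \<times> real. snd x) -` (- N) \<inter> space (lborel \<Otimes>\<^sub>M lborel) \<in> sets (lborel \<Otimes>\<^sub>M lborel)"
      using N by (intro measurable_sets[OF measurable_snd]) (auto simp: null_sets_def)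
    then show "{x \<in> space (lborel \<Otimes>\<^sub>M lborel). snd (x :: real \<times> real) \<notin> N} \<in> sets (lborel \<Otimes>\<^sub>M lborel)"
      by (simp add: vimage_def space_pair_measure)
    show "AE s in lborel. AE t in lborel. snd (s :: real, t) \<notin> N"
      using AE_not_in[OF N(1)] by simp
  qed
  then have "AE x in lborel. snd (x :: real \<times> real) \<notin> N" by (simp only: lborel_prod)
  then show ?thesis by eventually_elim (use N(2) in auto)
qed

lemma integrable_lborel_fst_snd:
  fixes f g :: "real \<Rightarrow> real"
  assumes f: "integrable lborel f" and g: "integrable lborel g"
  shows "integrable lborel (\<lambda>x. f (fst x) * g (snd x))"
proof -
  have "integrable (lborel \<Otimes>\<^sub>M lborel) (\<lambda>x. f (fst x) * g (snd x))"
  proof (rule lborel_pair.Fubini_integrable)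
    show "(\<lambda>x. f (fst x) * g (snd x)) \<in> borel_measurable (lborel \<Otimes>\<^sub>M lborel)"
      using f g by (intro borel_measurable_times measurable_compose[OF measurable_fst]
          measurable_compose[OF measurable_snd] borel_measurable_integrable)
    show "integrable lborel (\<lambda>s. LINT t|lborel. norm (f (fst (s, t)) * g (snd (s, t))))"
      using f by (simp add: abs_mult)
    show "AE s in lborel. integrable lborel (\<lambda>t. f (fst (s, t)) * g (snd (s, t)))"
      using g by simp
  qed
  then show ?thesis by (simp add: lborel_prod)
qed

text \<open>Fubini for integrands that need not be Borel: K is Borel and bounded, so all its
  sections are measurable, while p is only Lebesgue integrable and is replaced by a Borel
  representative \<open>P'\<close>. The product \<open>G\<close> is dominated by a constant times
  |\<open>P'\<close>| on a strip of finite width.\<close>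

lemma tensor_Fubini:
  fixes K :: "real \<times> real \<Rightarrow> complex" and p :: "real \<Rightarrow> complex" and a b c d :: real
  defines "R \<equiv> {a<..<b} \<times> {c<..<d} :: (real \<times> real) set"
  assumes K: "set_borel_measurable borel R K" and bound: "\<And>x. x \<in> R \<Longrightarrow> cmod (K x) \<le> C"
    and p: "set_integrable lebesgue {c<..<d} p"
  shows "set_integrable lebesgue R (\<lambda>x. K x * p (snd x))"
    and "set_integrable lebesgue {c<..<d} (\<lambda>t. (LINT s:{a<..<b}|lebesgue. K (s, t)) * p t)"
    and "(LINT x:R|lebesgue. K x * p (snd x))
           = (LINT t:{c<..<d}|lebesgue. (LINT s:{a<..<b}|lebesgue. K (s, t)) * p t)"
    and "(LINT x:R|lebesgue. K x * p (snd x))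
           = (LINT s:{a<..<b}|lebesgue. (LINT t:{c<..<d}|lebesgue. K (s, t) * p t))"
proof -
  define Kb where "Kb x = indicator R x *\<^sub>R K x" for x
  have Kb [measurable]: "Kb \<in> borel_measurable borel"
    using K by (simp add: set_borel_measurable_def Kb_def[abs_def])
  have Kb1 [measurable]: "(\<lambda>s. Kb (s, t)) \<in> borel_measurable borel" for t
    by (rule measurable_compose[OF _ Kb]) (auto simp: borel_prod[symmetric])
  have Kb2 [measurable]: "(\<lambda>t. Kb (s, t)) \<in> borel_measurable borel" for s
    by (rule measurable_compose[OF _ Kb]) (auto simp: borel_prod[symmetric])
  define P where "P t = indicator {c<..<d} t *\<^sub>R p t" for t
  have P: "integrable lebesgue P" using p by (simp add: set_integrable_def P_def[abs_def])
  obtain P' where P' [measurable]: "P' \<in> borel_measurable borel" and PP': "AE t in lborel. P t = P' t"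
    using borel_representative[OF borel_measurable_integrable[OF P]] by blast
  have intP': "integrable lborel P'"
    using integral_lebesgue_representative(1)[OF P' PP'] P by simp
  define G where "G x = Kb x * P' (snd x)" for x
  have snd_m: "(snd :: real \<times> real \<Rightarrow> real) \<in> borel \<rightarrow>\<^sub>M borel"
    by (intro borel_measurable_continuous_onI continuous_intros)
  have G [measurable]: "G \<in> borel_measurable borel"
    unfolding G_def[abs_def] by (intro borel_measurable_times Kb measurable_compose[OF snd_m P'])
  have intG: "integrable lborel G"
  proof (rule Bochner_Integration.integrable_bound)
    show "integrable lborel (\<lambda>x. (indicator {a<..<b} (fst x) * C) * cmod (P' (snd x)))"
      using intP' by (intro integrable_lborel_fst_snd integrable_norm)
        (auto simp: integrable_indicator_iff emeasure_Ioo_less_top)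
    show "AE x in lborel. cmod (G x) \<le> norm ((indicator {a<..<b} (fst x) * C) * cmod (P' (snd x)))"
    proof (intro always_eventually allI)
      fix x
      have "cmod (Kb x) \<le> \<bar>indicator {a<..<b} (fst x) * C\<bar>"
        using order_trans[OF bound abs_ge_self, of x] by (auto simp: Kb_def R_def indicator_def)
      then show "cmod (G x) \<le> norm ((indicator {a<..<b} (fst x) * C) * cmod (P' (snd x)))"
        by (auto simp: G_def norm_mult abs_mult intro!: mult_right_mono)
    qed
  qed auto
  have intG2: "integrable (lborel \<Otimes>\<^sub>M lborel) (\<lambda>(s, t). G (s, t))"
    using intG by (simp add: lborel_prod)
  have GE: "indicator R x *\<^sub>R (K x * p (snd x)) = Kb x * P (snd x)" for x
    by (auto simp: Kb_def P_def R_def indicator_def)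
  have aeG: "AE x in lborel. indicator R x *\<^sub>R (K x * p (snd x)) = G x"
    using AE_lborel_snd[OF PP'] by eventually_elim (simp add: GE G_def)
  show "set_integrable lebesgue R (\<lambda>x. K x * p (snd x))"
    unfolding set_integrable_def using integral_lebesgue_representative(1)[OF G aeG] intG by simp
  have LG: "(LINT x:R|lebesgue. K x * p (snd x)) = integral\<^sup>L lborel G"
    unfolding set_lebesgue_integral_def by (rule integral_lebesgue_representative(2)[OF G aeG])
  have inner1: "(LINT s:{a<..<b}|lebesgue. K (s, t)) = (LINT s|lborel. Kb (s, t))" if "t \<in> {c<..<d}" for t
  proof -
    have "(LINT s:{a<..<b}|lebesgue. K (s, t)) = (LINT s|lebesgue. Kb (s, t))"
      unfolding set_lebesgue_integral_def
      using that by (intro Bochner_Integration.integral_cong) (auto simp: Kb_def R_def indicator_def)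
    also have "\<dots> = (LINT s|lborel. Kb (s, t))" by (simp add: integral_completion)
    finally show ?thesis .
  qed
  have ae1: "AE t in lborel. indicator {c<..<d} t *\<^sub>R ((LINT s:{a<..<b}|lebesgue. K (s, t)) * p t)
      = (LINT s|lborel. G (s, t))"
    using PP'
  proof eventually_elim
    case (elim t)
    have "indicator {c<..<d} t *\<^sub>R ((LINT s:{a<..<b}|lebesgue. K (s, t)) * p t) = (LINT s|lborel. Kb (s, t)) * P t"
      using inner1[of t] by (auto simp: P_def indicator_def)
    then show ?case by (simp add: elim G_def)
  qed
  have m1: "(\<lambda>t. LINT s|lborel. G (s, t)) \<in> borel_measurable borel"
    using lborel_pair.integrable_snd[OF intG2] borel_measurable_integrable by force
  show "set_integrable lebesgue {c<..<d} (\<lambda>t. (LINT s:{a<..<b}|lebesgue. K (s, t)) * p t)"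
    unfolding set_integrable_def
    using integral_lebesgue_representative(1)[OF m1 ae1] lborel_pair.integrable_snd[OF intG2] by simp
  show "(LINT x:R|lebesgue. K x * p (snd x))
           = (LINT t:{c<..<d}|lebesgue. (LINT s:{a<..<b}|lebesgue. K (s, t)) * p t)"
    using integral_lebesgue_representative(2)[OF m1 ae1] lborel_pair.integral_snd[OF intG2]
    by (simp add: set_lebesgue_integral_def[of lebesgue "{c<..<d}"] LG lborel_prod)
  \<comment> \<open>This holds for every s and not just almost every s, since the heights at which
    \<open>P\<close> and \<open>P'\<close> differ form a null set independent of s.\<close>
  have ae2: "indicator {a<..<b} s *\<^sub>R (LINT t:{c<..<d}|lebesgue. K (s, t) * p t) = (LINT t|lborel. G (s, t))" for s
  proof -
    have "indicator {a<..<b} s *\<^sub>R (LINT t:{c<..<d}|lebesgue. K (s, t) * p t) = (LINT t|lebesgue. Kb (s, t) * P t)"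
      unfolding set_lebesgue_integral_def integral_scaleR_right[symmetric]
      by (intro Bochner_Integration.integral_cong) (auto simp: Kb_def R_def P_def indicator_def)
    also have "\<dots> = (LINT t|lborel. G (s, t))"
    proof (rule integral_lebesgue_representative(2))
      show "AE t in lborel. Kb (s, t) * P t = G (s, t)"
        using PP' by eventually_elim (simp add: G_def)
    qed (simp add: G_def)
    finally show ?thesis .
  qed
  have m2: "(\<lambda>s. LINT t|lborel. G (s, t)) \<in> borel_measurable borel"
    using lborel_pair.integrable_fst[OF intG2] borel_measurable_integrable by force
  have "(LINT s:{a<..<b}|lebesgue. (LINT t:{c<..<d}|lebesgue. K (s, t) * p t)) = (LINT s|lborel. LINT t|lborel. G (s, t))"
    using m2 by (subst set_lebesgue_integral_def) (simp add: ae2 integral_completion)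
  then show "(LINT x:R|lebesgue. K x * p (snd x))
           = (LINT s:{a<..<b}|lebesgue. (LINT t:{c<..<d}|lebesgue. K (s, t) * p t))"
    using lborel_pair.integral_fst[OF intG2] by (simp add: LG lborel_prod)
qed

section \<open>Absolutely continuous functions of one variable\<close>

text \<open>The gauge integral yields the formula across finitely many exceptional points;
  integrability of q makes that integral a Lebesgue integral. The exceptional points will be the
  mesh heights.\<close>

lemma fundamental_theorem_lebesgue:
  fixes Q :: "real \<Rightarrow> complex"
  assumes "a \<le> b" "finite S" and cont: "continuous_on {a..b} Q"
    and deriv: "\<And>t. t \<in> {a<..<b} - S \<Longrightarrow> (Q has_vector_derivative q t) (at t)"
    and int: "set_integrable lebesgue {a<..<b} q"
  shows "(LINT t:{a<..<b}|lebesgue. q t) = Q b - Q a"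
proof -
  have "(q has_integral Q b - Q a) {a..b}"
    using assms by (intro fundamental_theorem_of_calculus_interior_strong)
  then have "integral {a<..<b} q = Q b - Q a"
    by (simp add: has_integral_Icc_iff_Ioo integral_unique)
  then show ?thesis using set_lebesgue_integral_eq_integral(2)[OF int] by simp
qed

lemma set_integrable_Ioo_subset:
  fixes f :: "real \<Rightarrow> complex"
  assumes "set_integrable lebesgue {a<..<b} f" "a \<le> c" "d \<le> b"
  shows "set_integrable lebesgue {c<..<d} f"
  by (rule set_integrable_subset[OF assms(1)]) (use assms in auto)

text \<open>Fubini on the triangle a < r < t < b, carried out with Borel representatives of the zero
  extensions of q and g. Those extensions confine \<open>J\<close> to the triangle up to null
  sets.\<close>

lemma integral_primitive_swap:
  fixes q g :: "real \<Rightarrow> complex"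
  assumes q: "set_integrable lebesgue {a<..<b} q" and g: "set_integrable lebesgue {a<..<b} g"
  shows "(LINT t:{a<..<b}|lebesgue. q t * (LINT r:{a<..<t}|lebesgue. g r))
       = (LINT r:{a<..<b}|lebesgue. (LINT t:{r<..<b}|lebesgue. q t) * g r)"
proof -
  define q0 where "q0 t = indicator {a<..<b} t *\<^sub>R q t" for t
  define g0 where "g0 t = indicator {a<..<b} t *\<^sub>R g t" for t
  have q0: "integrable lebesgue q0" and g0: "integrable lebesgue g0"
    using q g by (simp_all add: set_integrable_def q0_def[abs_def] g0_def[abs_def])
  obtain q' where q' [measurable]: "q' \<in> borel_measurable borel" and qq': "AE t in lborel. q0 t = q' t"
    using borel_representative[OF borel_measurable_integrable[OF q0]] by blast
  obtain g' where g' [measurable]: "g' \<in> borel_measurable borel" and gg': "AE t in lborel. g0 t = g' t"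
    using borel_representative[OF borel_measurable_integrable[OF g0]] by blast
  have intq': "integrable lborel q'" using integral_lebesgue_representative(1)[OF q' qq'] q0 by simp
  have intg': "integrable lborel g'" using integral_lebesgue_representative(1)[OF g' gg'] g0 by simp
  define J where "J t r = (if r < t then q' t * g' r else 0)" for t r :: real
  have J1 [measurable]: "J t \<in> borel_measurable borel" for t
    unfolding J_def[abs_def] by measurable
  have J2 [measurable]: "(\<lambda>t. J t r) \<in> borel_measurable borel" for r
    unfolding J_def[abs_def] by measurable
  have Jint: "integrable (lborel \<Otimes>\<^sub>M lborel) (\<lambda>(t, r). J t r)"
  proof (rule Bochner_Integration.integrable_bound)
    show "integrable (lborel \<Otimes>\<^sub>M lborel) (\<lambda>x. cmod (q' (fst x)) * cmod (g' (snd x)))"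
      using integrable_lborel_fst_snd[OF integrable_norm[OF intq'] integrable_norm[OF intg']]
      by (simp add: lborel_prod)
    show "(\<lambda>(t, r). J t r) \<in> borel_measurable (lborel \<Otimes>\<^sub>M lborel)"
      unfolding J_def by measurable
    show "AE x in lborel \<Otimes>\<^sub>M lborel. cmod (case x of (t, r) \<Rightarrow> J t r)
        \<le> norm (cmod (q' (fst x)) * cmod (g' (snd x)))"
      by (intro always_eventually allI) (auto simp: J_def norm_mult split: prod.splits)
  qed
  \<comment> \<open>The bound t < b keeps {a<..<t} inside the interval on which \<open>g0\<close>
    agrees with \<open>g\<close>.\<close>
  have L: "(LINT r:{a<..<t}|lebesgue. g r) = (LINT r|lborel. (if r < t then g' r else 0))" if "t < b" for t
    unfolding set_lebesgue_integral_def
  proof (rule integral_lebesgue_representative(2))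
    show "AE r in lborel. indicator {a<..<t} r *\<^sub>R g r = (if r < t then g' r else 0)"
      using gg'
    proof eventually_elim
      case (elim r)
      then show ?case using that by (auto simp: g0_def indicator_def split: if_splits)
    qed
  qed measurable
  have R: "(LINT t:{r<..<b}|lebesgue. q t) = (LINT t|lborel. (if r < t then q' t else 0))" if "a < r" for r
    unfolding set_lebesgue_integral_def
  proof (rule integral_lebesgue_representative(2))
    show "AE t in lborel. indicator {r<..<b} t *\<^sub>R q t = (if r < t then q' t else 0)"
      using qq'
    proof eventually_elim
      case (elim t)
      then show ?case using that by (auto simp: q0_def indicator_def split: if_splits)
    qed
  qed measurable
  have "(LINT t:{a<..<b}|lebesgue. q t * (LINT r:{a<..<t}|lebesgue. g r))
      = (LINT t|lborel. LINT r|lborel. J t r)"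
    unfolding set_lebesgue_integral_def[of lebesgue "{a<..<b}"]
  proof (rule integral_lebesgue_representative(2))
    show "(\<lambda>t. LINT r|lborel. J t r) \<in> borel_measurable borel"
      using borel_measurable_integrable[OF lborel_pair.integrable_fst[OF Jint]] by simp
    show "AE t in lborel. indicator {a<..<b} t *\<^sub>R (q t * (LINT r:{a<..<t}|lebesgue. g r)) = (LINT r|lborel. J t r)"
      using qq'
    proof eventually_elim
      case (elim t)
      have "indicator {a<..<b} t *\<^sub>R (q t * (LINT r:{a<..<t}|lebesgue. g r))
          = q0 t * (LINT r|lborel. (if r < t then g' r else 0))"
        using L[of t] by (auto simp: q0_def indicator_def)
      also have "\<dots> = (LINT r|lborel. q' t * (if r < t then g' r else 0))"
        by (simp add: elim)
      also have "\<dots> = (LINT r|lborel. J t r)"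
        by (intro Bochner_Integration.integral_cong) (auto simp: J_def)
      finally show ?case .
    qed
  qed
  also have "\<dots> = (LINT r|lborel. LINT t|lborel. J t r)"
    by (rule lborel_pair.Fubini_integral[OF Jint, symmetric])
  also have "\<dots> = (LINT r:{a<..<b}|lebesgue. (LINT t:{r<..<b}|lebesgue. q t) * g r)"
    unfolding set_lebesgue_integral_def[of lebesgue "{a<..<b}"]
  proof (rule integral_lebesgue_representative(2)[symmetric])
    show "(\<lambda>r. LINT t|lborel. J t r) \<in> borel_measurable borel"
      using borel_measurable_integrable[OF lborel_pair.integrable_snd[OF Jint]] by simp
    show "AE r in lborel. indicator {a<..<b} r *\<^sub>R ((LINT t:{r<..<b}|lebesgue. q t) * g r) = (LINT t|lborel. J t r)"
      using gg'
    proof eventually_elim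
      case (elim r)
      have "indicator {a<..<b} r *\<^sub>R ((LINT t:{r<..<b}|lebesgue. q t) * g r)
          = (LINT t|lborel. (if r < t then q' t else 0)) * g0 r"
        using R[of r] by (auto simp: g0_def indicator_def)
      also have "\<dots> = (LINT t|lborel. (if r < t then q' t else 0) * g' r)"
        by (simp add: elim)
      also have "\<dots> = (LINT t|lborel. J t r)"
        by (intro Bochner_Integration.integral_cong) (auto simp: J_def)
      finally show ?case .
    qed
  qed
  finally show ?thesis .
qed

lemma primitive_continuous:
  fixes g :: "real \<Rightarrow> complex"
  assumes g: "set_integrable lebesgue {a<..<b} g"
  shows "continuous_on {a..b} (\<lambda>t. LINT r:{a<..<t}|lebesgue. g r)"
proof -
  have "g integrable_on {a..b}"
    using set_lebesgue_integral_eq_integral(1)[OF g] by (simp add: integrable_on_Icc_iff_Ioo)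
  then have "continuous_on {a..b} (\<lambda>t. integral {a..t} g)"
    by (rule indefinite_integral_continuous_1)
  moreover have "(LINT r:{a<..<t}|lebesgue. g r) = integral {a..t} g" if "t \<in> {a..b}" for t
    using set_lebesgue_integral_eq_integral(2)[OF set_integrable_Ioo_subset[OF g, of a t]] that
    by (simp add: integral_open_interval_real)
  ultimately show ?thesis by (simp cong: continuous_on_cong_simp)
qed

text \<open>Once the integrals are exchanged, the inner one is Q b - Q r by the fundamental theorem
  for Q. Differentiating the primitive of g, which would be possible only almost everywhere, is thus
  avoided.\<close>

lemma integration_by_parts_primitive:
  fixes Q g :: "real \<Rightarrow> complex"
  assumes "a \<le> b" "finite S" and cont: "continuous_on {a..b} Q"
    and deriv: "\<And>t. t \<in> {a<..<b} - S \<Longrightarrow> (Q has_vector_derivative q t) (at t)"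
    and q: "set_integrable lebesgue {a<..<b} q" and g: "set_integrable lebesgue {a<..<b} g"
  shows "(LINT t:{a<..<b}|lebesgue. q t * (LINT r:{a<..<t}|lebesgue. g r))
       = Q b * (LINT t:{a<..<b}|lebesgue. g t) - (LINT t:{a<..<b}|lebesgue. Q t * g t)"
proof -
  have Qg: "set_integrable lebesgue {a<..<b} (\<lambda>t. Q t * g t)"
    using set_integrable_continuous_mult_box[of a b g Q] g cont by simp
  have "(LINT t:{a<..<b}|lebesgue. q t * (LINT r:{a<..<t}|lebesgue. g r))
      = (LINT r:{a<..<b}|lebesgue. (LINT t:{r<..<b}|lebesgue. q t) * g r)"
    by (rule integral_primitive_swap[OF q g])
  also have "\<dots> = (LINT r:{a<..<b}|lebesgue. Q b * g r - Q r * g r)"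
  proof (rule set_lebesgue_integral_cong)
    show "\<forall>r. r \<in> {a<..<b} \<longrightarrow> (LINT t:{r<..<b}|lebesgue. q t) * g r = Q b * g r - Q r * g r"
    proof (intro allI impI)
      fix r assume r: "r \<in> {a<..<b}"
      have "(LINT t:{r<..<b}|lebesgue. q t) = Q b - Q r"
        using r by (intro fundamental_theorem_lebesgue[OF _ \<open>finite S\<close>] deriv
            continuous_on_subset[OF cont] set_integrable_Ioo_subset[OF q]) auto
      then show "(LINT t:{r<..<b}|lebesgue. q t) * g r = Q b * g r - Q r * g r"
        by (simp add: left_diff_distrib)
    qed
  qed simp
  also have "\<dots> = Q b * (LINT t:{a<..<b}|lebesgue. g t) - (LINT t:{a<..<b}|lebesgue. Q t * g t)"
    using g Qg by (subst set_integral_diff(2)) auto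
  finally show ?thesis .
qed

section \<open>Test functions of one variable and the du Bois-Reymond lemma\<close>

lemma frechet_derivative_real:
  assumes "(\<phi> has_real_derivative D) (at t)"
  shows "frechet_derivative \<phi> (at t) 1 = D"
proof -
  have "(\<phi> has_derivative (\<lambda>h. D * h)) (at t)"
    using assms by (simp add: has_field_derivative_def)
  from frechet_derivative_at[OF this] show ?thesis by (metis mult.right_neutral)
qed

lemma test_function_real:
  fixes \<phi> :: "real \<Rightarrow> real"
  assumes "test_function A \<phi>"
  shows "(\<phi> has_real_derivative frechet_derivative \<phi> (at t) 1) (at t)"
  using assms C1_fun_realD[of \<phi>] frechet_derivative_real[of \<phi>] unfolding test_function_iff by metis

lemma test_function_zero: "test_function A \<phi> \<Longrightarrow> x \<notin> A \<Longrightarrow> \<phi> x = 0"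
  unfolding test_function_def by blast

text \<open>The zero mean makes the primitive vanish again to the right of the support of \<psi>, so
  that its own support is compact in the interval.\<close>

lemma test_function_antiderivative:
  fixes \<psi> :: "real \<Rightarrow> real"
  assumes cont: "continuous_on UNIV \<psi>" and K: "compact K" "K \<subseteq> {a<..<b}" "\<And>t. t \<notin> K \<Longrightarrow> \<psi> t = 0"
    and zero: "integral {a..b} \<psi> = 0"
  obtains \<phi> where "test_function {a<..<b} \<phi>" "\<And>t. (\<phi> has_real_derivative \<psi> t) (at t)"
proof (cases "K = {}")
  case True
  show ?thesis
  proof (rule that[of "\<lambda>_. 0"])
    show "test_function {a<..<b} (\<lambda>_. 0)"
      unfolding test_function_iff by (auto intro!: C1_fun_const exI[of _ "{}"])
    show "((\<lambda>_. 0) has_real_derivative \<psi> t) (at t)" for t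
      using K(3) True by simp
  qed
next
  case False
  obtain a' where a': "a' \<in> K" "\<And>t. t \<in> K \<Longrightarrow> a' \<le> t"
    using compact_attains_inf[OF K(1) False] by blast
  obtain b' where b': "b' \<in> K" "\<And>t. t \<in> K \<Longrightarrow> t \<le> b'"
    using compact_attains_sup[OF K(1) False] by blast
  have ord: "a < a'" "b' < b" "a' \<le> b'" using a' b' K(2) by auto
  have \<psi>0: "\<psi> t = 0" if "t < a' \<or> b' < t" for t
    using a'(2) b'(2) K(3) that by (meson not_less)
  have int: "\<psi> integrable_on {c..d}" for c d
    by (intro integrable_continuous_real continuous_on_subset[OF cont]) auto
  define \<phi> where "\<phi> t = integral {a..t} \<psi>" for t
  have left: "\<phi> t = 0" if "t < a'" for t
  proof -
    have "\<phi> t = integral {a..t} (\<lambda>_. 0)"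
      unfolding \<phi>_def using that \<psi>0 by (intro integral_cong) auto
    then show ?thesis by simp
  qed
  have right: "\<phi> t = 0" if "t > b'" for t
  proof (cases "t \<le> b")
    case True
    have "integral {t..b} \<psi> = integral {t..b} (\<lambda>_. 0)"
      using that \<psi>0 by (intro integral_cong) auto
    then show ?thesis
      using Henstock_Kurzweil_Integration.integral_combine[OF _ True int, of a] zero ord that
      by (simp add: \<phi>_def)
  next
    case False
    have "integral {b..t} \<psi> = integral {b..t} (\<lambda>_. 0)"
      using ord \<psi>0 by (intro integral_cong) auto
    then show ?thesis
      using Henstock_Kurzweil_Integration.integral_combine[of a b t, OF _ _ int] zero ord False
      by (simp add: \<phi>_def)
  qed
  have deriv: "(\<phi> has_real_derivative \<psi> t) (at t)" for t
  proof -
    \<comment> \<open>These open cases overlap, so no one-sided derivatives have to be matched at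
      \<open>a'\<close> and \<open>b'\<close>.\<close>
    consider "t < a'" | "t > b'" | "t \<in> {a<..<b}" using ord by fastforce
    then show ?thesis
    proof cases
      case 1
      have "((\<lambda>_. 0) has_real_derivative \<psi> t) (at t)" using \<psi>0 1 by simp
      then show ?thesis
        by (rule has_field_derivative_transform_within_open[of _ _ _ "{..<a'}"]) (use 1 left in auto)
    next
      case 2
      have "((\<lambda>_. 0) has_real_derivative \<psi> t) (at t)" using \<psi>0 2 by simp
      then show ?thesis
        by (rule has_field_derivative_transform_within_open[of _ _ _ "{b'<..}"]) (use 2 right in auto)
    next
      case 3
      have "(\<phi> has_real_derivative \<psi> t) (at t within {a..b})"
        unfolding \<phi>_def[abs_def]
        by (rule integral_has_real_derivative) (use 3 in \<open>auto intro: continuous_on_subset[OF cont]\<close>)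
      then show ?thesis using 3 by (simp add: at_within_Icc_at)
    qed
  qed
  show ?thesis
  proof (rule that[of \<phi>])
    show "test_function {a<..<b} \<phi>"
      unfolding test_function_iff
    proof (intro conjI exI[of _ "{a'..b'}"])
      show "C1_fun \<phi>" using deriv cont by (rule C1_funI_real)
      show "\<forall>x. x \<notin> {a'..b'} \<longrightarrow> \<phi> x = 0" using left right by auto
    qed (use ord in auto)
  qed (rule deriv)
qed

lemma test_function_lebesgue_integral:
  fixes \<psi> :: "real \<Rightarrow> real"
  assumes "continuous_on {a..b} \<psi>"
  shows "set_integrable lebesgue {a<..<b} \<psi>"
    and "(LINT t:{a<..<b}|lebesgue. \<psi> t) = integral {a..b} \<psi>"
proof -
  have "set_integrable lebesgue {a..b} \<psi>" by (rule absolutely_integrable_continuous_real[OF assms])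
  then show i: "set_integrable lebesgue {a<..<b} \<psi>" by (rule set_integrable_subset) auto
  show "(LINT t:{a<..<b}|lebesgue. \<psi> t) = integral {a..b} \<psi>"
    using set_lebesgue_integral_eq_integral(2)[OF i] by (simp add: integral_open_interval_real)
qed

lemma set_integral_scaleR_const:
  fixes c :: "'b::{banach, second_countable_topology}"
  assumes "set_integrable M A f"
  shows "(LINT t:A|M. f t *\<^sub>R c) = (LINT t:A|M. f t) *\<^sub>R c"
proof -
  have "(LINT t|M. (indicator A t *\<^sub>R f t) *\<^sub>R c) = (LINT t|M. indicator A t *\<^sub>R f t) *\<^sub>R c"
    using assms unfolding set_integrable_def by (intro integral_scaleR_left) auto
  then show ?thesis by (simp add: set_lebesgue_integral_def)
qed

text \<open>Du Bois-Reymond: any test function minus its mean times a fixed one of mean 1 is the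
  derivative of a test function. Hence C minus a constant is orthogonal to all test
  functions.\<close>

lemma constant_if_weak_derivative_zero:
  fixes C :: "real \<Rightarrow> complex"
  assumes ab: "a < b" and C: "continuous_on {a..b} C"
    and weak: "\<And>\<phi>. test_function {a<..<b} \<phi> \<Longrightarrow>
      (LINT t:{a<..<b}|lebesgue. frechet_derivative \<phi> (at t) 1 *\<^sub>R C t) = 0"
  shows "\<exists>k. \<forall>t\<in>{a..b}. C t = k"
proof -
  have intC: "set_integrable lebesgue {a<..<b} C"
    by (rule set_integrable_subset[OF absolutely_integrable_continuous_real[OF C]]) auto
  have int1: "set_integrable lebesgue {a<..<b} (\<lambda>t. k)" for k :: complex
    by (rule set_integrable_subset[OF absolutely_integrable_continuous_real[of a b]]) auto
  have mult: "set_integrable lebesgue {a<..<b} (\<lambda>t. \<eta> t *\<^sub>R f t)"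
    if "continuous_on UNIV \<eta>" "set_integrable lebesgue {a<..<b} f" for \<eta> and f :: "real \<Rightarrow> complex"
    using set_integrable_continuous_mult_box[of a b f "\<lambda>t. of_real (\<eta> t)"] that
    by (auto simp: scaleR_conv_of_real intro: continuous_intros continuous_on_subset)
  \<comment> \<open>If all test functions had mean zero, the fundamental lemma would give 1 = 0
    almost everywhere on a nonempty interval.\<close>
  obtain \<eta>1 where \<eta>1: "test_function {a<..<b} \<eta>1" "integral {a..b} \<eta>1 \<noteq> 0"
  proof -
    have False if *: "\<And>\<eta>. test_function {a<..<b} \<eta> \<Longrightarrow> integral {a..b} \<eta> = 0"
    proof -
      have "AE x in lebesgue. x \<in> box a b \<longrightarrow> (1::complex) = 0"
      proof (rule AE_zero_if_test_integrals_zero)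
        show "set_integrable lebesgue (box a b) (\<lambda>x. 1 :: complex)" using int1 by simp
        fix \<eta> :: "real \<Rightarrow> real" assume t: "test_function (box a b) \<eta>"
        have c: "continuous_on {a..b} \<eta>" using t by (rule test_function_continuous)
        have "(LINT x:box a b|lebesgue. \<eta> x *\<^sub>R (1::complex)) = (LINT x:{a<..<b}|lebesgue. \<eta> x) *\<^sub>R 1"
          using test_function_lebesgue_integral(1)[OF c]
          unfolding box_real by (rule set_integral_scaleR_const)
        then show "(LINT x:box a b|lebesgue. \<eta> x *\<^sub>R (1::complex)) = 0"
          using *[of \<eta>] t test_function_lebesgue_integral(2)[OF c] by simp
      qed
      then have "AE x in lborel. x \<notin> {a<..<b}" by (simp add: AE_completion_iff)
      then have "emeasure lborel {a<..<b} = 0"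
        by (subst (asm) AE_iff_measurable[where N = "{a<..<b}"]) auto
      then show False using ab by simp
    qed
    then show thesis using that by blast
  qed
  define \<eta>0 where "\<eta>0 t = \<eta>1 t / integral {a..b} \<eta>1" for t
  have \<eta>0c: "continuous_on A \<eta>0" for A
    unfolding \<eta>0_def using \<eta>1 by (intro continuous_intros test_function_continuous) auto
  have \<eta>0i: "integral {a..b} \<eta>0 = 1"
    using \<eta>1(2) by (simp add: \<eta>0_def[abs_def])
  \<comment> \<open>The only possible value: a constant C equals its mean against
    \<open>\<eta>0\<close>, which has integral 1.\<close>
  define k where "k = (LINT t:{a<..<b}|lebesgue. \<eta>0 t *\<^sub>R C t)"
  have "AE x in lebesgue. x \<in> box a b \<longrightarrow> C x - k = 0"
  proof (rule AE_zero_if_test_integrals_zero)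
    show "set_integrable lebesgue (box a b) (\<lambda>x. C x - k)"
      using intC int1 by (simp add: set_integral_diff)
    fix \<eta> :: "real \<Rightarrow> real" assume t: "test_function (box a b) \<eta>"
    have c: "continuous_on A \<eta>" for A using t by (rule test_function_continuous)
    define m where "m = integral {a..b} \<eta>"
    \<comment> \<open>Removing the mean makes \<open>\<psi>\<close> the derivative of a test
      function, to which \<open>weak\<close> applies.\<close>
    define \<psi> where "\<psi> t = \<eta> t - m * \<eta>0 t" for t
    have \<psi>c: "continuous_on A \<psi>" for A
      unfolding \<psi>_def by (intro continuous_intros c \<eta>0c)
    obtain K1 where K1: "compact K1" "K1 \<subseteq> {a<..<b}" "\<And>t. t \<notin> K1 \<Longrightarrow> \<eta> t = 0"
      using t unfolding test_function_iff by auto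
    obtain K2 where K2: "compact K2" "K2 \<subseteq> {a<..<b}" "\<And>t. t \<notin> K2 \<Longrightarrow> \<eta>1 t = 0"
      using \<eta>1(1) unfolding test_function_iff by auto
    have "integral {a..b} \<psi> = m - m * 1"
      unfolding \<psi>_def m_def \<eta>0i[symmetric]
      by (subst Henstock_Kurzweil_Integration.integral_diff)
         (auto intro!: integrable_continuous_real continuous_intros c \<eta>0c)
    then have \<psi>0: "integral {a..b} \<psi> = 0" by simp
    have K: "compact (K1 \<union> K2)" "K1 \<union> K2 \<subseteq> {a<..<b}" "\<And>t. t \<notin> K1 \<union> K2 \<Longrightarrow> \<psi> t = 0"
      using K1 K2 by (auto simp: \<psi>_def \<eta>0_def)
    obtain \<phi> where \<phi>: "test_function {a<..<b} \<phi>" "\<And>t. (\<phi> has_real_derivative \<psi> t) (at t)"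
      using test_function_antiderivative[OF \<psi>c K \<psi>0] by blast
    have "0 = (LINT t:{a<..<b}|lebesgue. \<psi> t *\<^sub>R C t)"
      using weak[OF \<phi>(1)] frechet_derivative_real[OF \<phi>(2)] by simp
    also have "\<dots> = (LINT t:{a<..<b}|lebesgue. \<eta> t *\<^sub>R C t - m *\<^sub>R (\<eta>0 t *\<^sub>R C t))"
      by (simp add: \<psi>_def scaleR_diff_left)
    also have "\<dots> = (LINT t:{a<..<b}|lebesgue. \<eta> t *\<^sub>R C t) - m *\<^sub>R k"
      unfolding k_def set_integral_scaleR_right[symmetric]
      using mult[OF c intC] mult[OF \<eta>0c intC]
      by (intro set_integral_diff(2) set_integrable_scaleR_right)
    also have "m *\<^sub>R k = (LINT t:{a<..<b}|lebesgue. \<eta> t *\<^sub>R k)"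
      using test_function_lebesgue_integral[OF c]
      by (subst set_integral_scaleR_const) (auto simp: m_def)
    also have "(LINT t:{a<..<b}|lebesgue. \<eta> t *\<^sub>R C t) - (LINT t:{a<..<b}|lebesgue. \<eta> t *\<^sub>R k)
        = (LINT t:{a<..<b}|lebesgue. \<eta> t *\<^sub>R (C t - k))"
      using mult[OF c intC] mult[OF c int1]
      by (simp add: scaleR_diff_right set_integral_diff(2))
    finally show "(LINT x:box a b|lebesgue. \<eta> x *\<^sub>R (C x - k)) = 0" by simp
  qed
  then have ae: "AE x in lebesgue. x \<in> {a<..<b} \<longrightarrow> C x - k = 0" by simp
  \<comment> \<open>By continuity the exceptional set is open, and an open null set is empty; this
    upgrades the equality from almost everywhere to everywhere.\<close>
  let ?N = "{t \<in> {a<..<b}. C t - k \<noteq> 0}"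
  have "open ?N"
  proof -
    have "continuous_on {a<..<b} (\<lambda>t. C t - k)"
      by (intro continuous_intros continuous_on_subset[OF C]) auto
    then have "open ({a<..<b} \<inter> (\<lambda>t. C t - k) -` (- {0}))"
      by (intro continuous_open_preimage) auto
    moreover have "{a<..<b} \<inter> (\<lambda>t. C t - k) -` (- {0}) = ?N" by auto
    ultimately show ?thesis by simp
  qed
  moreover have "negligible ?N"
  proof -
    obtain N where "N \<in> null_sets lebesgue" "{x. \<not> (x \<in> {a<..<b} \<longrightarrow> C x - k = 0)} \<subseteq> N"
      using ae unfolding eventually_ae_filter by auto
    then have "negligible N" "?N \<subseteq> N" by (auto simp: negligible_iff_null_sets)
    then show ?thesis by (rule negligible_subset)
  qed
  ultimately have "?N = {}" using open_not_negligible by blast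
  then have open_eq: "C t = k" if "t \<in> {a<..<b}" for t using that by auto
  have "C t = k" if "t \<in> {a..b}" for t
  proof (rule continuous_constant_on_closure[of "{a<..<b}" C k])
    show "continuous_on (closure {a<..<b}) C" using C ab by simp
  qed (use that open_eq ab in auto)
  then show ?thesis by blast
qed

text \<open>A continuous representative of an H^1 function is absolutely continuous: the primitive
  of g has weak derivative g too, so its difference from c has weak derivative zero.\<close>

lemma weak_derivative_primitive:
  fixes c g :: "real \<Rightarrow> complex"
  assumes ab: "a < b" and c: "continuous_on {a..b} c" and g: "has_weak_derivative c g 1 {a<..<b}"
  shows "\<exists>k. \<forall>t\<in>{a..b}. c t = k + (LINT r:{a<..<t}|lebesgue. g r)"
proof -
  have intg: "set_integrable lebesgue {a<..<b} g"
    using g L2_on_imp_set_integrable[of a b g] by (simp add: has_weak_derivative_def)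
  define G where "G t = (LINT r:{a<..<t}|lebesgue. g r)" for t
  have G: "continuous_on {a..b} G" unfolding G_def by (rule primitive_continuous[OF intg])
  have "\<exists>k. \<forall>t\<in>{a..b}. c t - G t = k"
  proof (rule constant_if_weak_derivative_zero[OF ab])
    show "continuous_on {a..b} (\<lambda>t. c t - G t)" by (intro continuous_intros c G)
    fix \<phi> assume t: "test_function {a<..<b} \<phi>"
    let ?d = "\<lambda>t. frechet_derivative \<phi> (at t) 1"
    have dc: "continuous_on {a..b} ?d" by (rule test_function_derivative(2)[OF t])
    have i: "set_integrable lebesgue {a<..<b} (\<lambda>t. ?d t *\<^sub>R f t)" if "continuous_on {a..b} f" for f :: "real \<Rightarrow> complex"
      by (rule set_integrable_subset[OF absolutely_integrable_continuous_real[of a b]])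
         (auto intro!: continuous_intros dc that)
    have "(LINT t:{a<..<b}|lebesgue. ?d t *\<^sub>R G t) = (LINT t:{a<..<b}|lebesgue. of_real (?d t) * (LINT r:{a<..<t}|lebesgue. g r))"
      by (simp add: G_def scaleR_conv_of_real)
    \<comment> \<open>Here the test function plays the smooth factor, and its value at b
      vanishes.\<close>
    also have "\<dots> = of_real (\<phi> b) * (LINT t:{a<..<b}|lebesgue. g t) - (LINT t:{a<..<b}|lebesgue. of_real (\<phi> t) * g t)"
    proof (rule integration_by_parts_primitive[of _ _ "{}"])
      show "continuous_on {a..b} (\<lambda>t. of_real (\<phi> t) :: complex)"
        by (intro continuous_intros test_function_continuous[OF t])
      show "((\<lambda>t. of_real (\<phi> t) :: complex) has_vector_derivative of_real (?d t)) (at t)" for t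
        using test_function_real[OF t] by (intro has_vector_derivative_of_real) (simp add: has_real_derivative_iff_has_vector_derivative)
      show "set_integrable lebesgue {a<..<b} (\<lambda>t. of_real (?d t) :: complex)"
        using i[of "\<lambda>_. 1"] by (simp add: scaleR_conv_of_real)
    qed (use ab intg in auto)
    also have "\<phi> b = 0" using test_function_zero[OF t] by simp
    finally have "(LINT t:{a<..<b}|lebesgue. ?d t *\<^sub>R G t) = - (LINT t:{a<..<b}|lebesgue. \<phi> t *\<^sub>R g t)"
      by (simp add: scaleR_conv_of_real)
    moreover have "(LINT t:{a<..<b}|lebesgue. ?d t *\<^sub>R c t) = - (LINT t:{a<..<b}|lebesgue. \<phi> t *\<^sub>R g t)"
      using g t by (simp add: has_weak_derivative_def)
    ultimately show "(LINT t:{a<..<b}|lebesgue. ?d t *\<^sub>R (c t - G t)) = 0"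
      using i[OF c] i[OF G] by (simp add: scaleR_diff_right set_integral_diff(2))
  qed
  then show ?thesis unfolding G_def by (metis diff_eq_eq)
qed

text \<open>Q will be a flux and c the conjugate of a coefficient of the test function v. Writing c
  as a constant plus a primitive leaves the fundamental theorem for the constant part and
  \<open>integration_by_parts_primitive\<close> for the rest.\<close>

lemma integration_by_parts_weak:
  fixes Q c g :: "real \<Rightarrow> complex"
  assumes ab: "a < b" and S: "finite S" and cont: "continuous_on {a..b} Q"
    and deriv: "\<And>t. t \<in> {a<..<b} - S \<Longrightarrow> (Q has_vector_derivative q t) (at t)"
    and q: "set_integrable lebesgue {a<..<b} q"
    and c: "continuous_on {a..b} c" and g: "has_weak_derivative c g 1 {a<..<b}"
  shows "(LINT t:{a<..<b}|lebesgue. q t * c t) + (LINT t:{a<..<b}|lebesgue. Q t * g t) = Q b * c b - Q a * c a"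
proof -
  have intg: "set_integrable lebesgue {a<..<b} g"
    using g L2_on_imp_set_integrable[of a b g] by (simp add: has_weak_derivative_def)
  define G where "G t = (LINT r:{a<..<t}|lebesgue. g r)" for t
  have G: "continuous_on {a..b} G" unfolding G_def by (rule primitive_continuous[OF intg])
  obtain k where k: "\<And>t. t \<in> {a..b} \<Longrightarrow> c t = k + G t"
    using weak_derivative_primitive[OF ab c g] unfolding G_def by blast
  have qG: "set_integrable lebesgue {a<..<b} (\<lambda>t. G t * q t)"
    using set_integrable_continuous_mult_box[of a b q G] q G by simp
  have "(LINT t:{a<..<b}|lebesgue. q t * c t) = (LINT t:{a<..<b}|lebesgue. k * q t + q t * G t)"
    by (intro set_lebesgue_integral_cong) (auto simp: k algebra_simps)
  also have "\<dots> = k * (LINT t:{a<..<b}|lebesgue. q t) + (LINT t:{a<..<b}|lebesgue. q t * G t)"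
    using q qG by (subst set_integral_add(2)) (auto simp: mult.commute)
  also have "(LINT t:{a<..<b}|lebesgue. q t) = Q b - Q a"
    using ab S by (intro fundamental_theorem_lebesgue[OF _ S cont deriv q]) auto
  also have "(LINT t:{a<..<b}|lebesgue. q t * G t) = Q b * G b - (LINT t:{a<..<b}|lebesgue. Q t * g t)"
    using ab unfolding G_def by (intro integration_by_parts_primitive[OF _ S cont deriv q intg]) auto
  also have "G b = c b - k" using k[of b] ab by simp
  also have "k = c a" using k[of a] ab by (simp add: G_def set_lebesgue_integral_def)
  finally show ?thesis by (simp add: algebra_simps)
qed

lemma has_weak_derivative_cnj:
  assumes "has_weak_derivative w g b A"
  shows "has_weak_derivative (\<lambda>x. cnj (w x)) (\<lambda>x. cnj (g x)) b A"
proof -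
  have L2: "L2_on A (\<lambda>x. cnj (f x))" if f: "L2_on A f" for f
  proof -
    have "(\<lambda>x. cnj (indicator A x *\<^sub>R f x)) \<in> borel_measurable lebesgue"
      using f unfolding L2_on_def set_borel_measurable_def
      by (intro measurable_compose[OF _ borel_measurable_continuous_onI[of cnj]] continuous_intros) auto
    then show ?thesis using f by (simp add: L2_on_def set_borel_measurable_def)
  qed
  have "(LINT x:A|lebesgue. k x *\<^sub>R cnj (f x)) = cnj (LINT x:A|lebesgue. k x *\<^sub>R f x)" for k f
    unfolding set_lebesgue_integral_def Bochner_Integration.integral_cnj[symmetric] by simp
  then show ?thesis using assms L2 unfolding has_weak_derivative_def by simp
qed

text \<open>Continuity across the exceptional points is what excludes jump terms. Square
  integrability of the pointwise derivative has to be supplied; for the RCWA modes it comes from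
  coercivity.\<close>

lemma has_weak_derivative_piecewise:
  fixes U :: "real \<Rightarrow> complex"
  assumes ab: "a < b" and S: "finite S" and cont: "continuous_on {a..b} U"
    and deriv: "\<And>t. t \<in> {a<..<b} - S \<Longrightarrow> (U has_vector_derivative D t) (at t)"
    and D: "L2_on {a<..<b} D"
  shows "has_weak_derivative U D 1 {a<..<b}"
proof -
  have m: "set_borel_measurable lebesgue {a<..<b} U"
    by (intro set_borel_measurable_lebesgue_continuous continuous_on_subset[OF cont]) auto
  have "compact (U ` {a..b})" by (intro compact_continuous_image cont) auto
  then obtain C where "\<And>x. x \<in> {a..b} \<Longrightarrow> cmod (U x) \<le> C"
    by (meson bounded_iff compact_imp_bounded imageI)
  then have U: "L2_on {a<..<b} U"
    using L2_on_bounded_measurable[of a b U C] m by auto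
  show ?thesis
    unfolding has_weak_derivative_def
  proof (intro conjI allI impI U D)
    fix \<phi> assume t: "test_function {a<..<b} \<phi>"
    let ?d = "\<lambda>t. frechet_derivative \<phi> (at t) 1"
    have i: "set_integrable lebesgue {a<..<b} (\<lambda>t. ?d t *\<^sub>R U t)" "set_integrable lebesgue {a<..<b} (\<lambda>t. \<phi> t *\<^sub>R D t)"
      using set_integrable_test_function[OF t, of a b] U D by auto
    have "(LINT t:{a<..<b}|lebesgue. ?d t *\<^sub>R U t + \<phi> t *\<^sub>R D t) = \<phi> b *\<^sub>R U b - \<phi> a *\<^sub>R U a"
    proof (rule fundamental_theorem_lebesgue[OF _ S])
      show "continuous_on {a..b} (\<lambda>t. \<phi> t *\<^sub>R U t)"
        by (intro continuous_intros cont test_function_continuous[OF t])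
      show "((\<lambda>t. \<phi> t *\<^sub>R U t) has_vector_derivative ?d s *\<^sub>R U s + \<phi> s *\<^sub>R D s) (at s)"
        if "s \<in> {a<..<b} - S" for s
        using has_vector_derivative_scaleR[OF test_function_real[OF t] deriv[OF that]]
        by (simp add: add.commute)
    qed (use ab i in \<open>auto intro: set_integral_add\<close>)
    then show "(LINT t:{a<..<b}|lebesgue. ?d t *\<^sub>R U t) = - (LINT t:{a<..<b}|lebesgue. \<phi> t *\<^sub>R D t)"
      using i test_function_zero[OF t] by (simp add: set_integral_add(2) eq_neg_iff_add_eq_0)
  qed
qed

section \<open>Weak derivatives of separated functions on the rectangle\<close>

lemma \<Omega>_eq_box: "\<Omega> L H = box (0, -H) (L, H)"
  by (auto simp: \<Omega>_def mem_box Basis_prod_def)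

lemma \<Omega>_subset: "\<Omega> L H \<subseteq> cbox (0, -H) (L, H)"
  unfolding \<Omega>_eq_box by (rule box_subset_cbox)

lemma \<Omega>_borel [measurable]: "\<Omega> L H \<in> sets borel"
  by (simp add: \<Omega>_eq_box)

lemma continuous_bounded_\<Omega>:
  fixes k :: "real \<times> real \<Rightarrow> complex"
  assumes "continuous_on UNIV k"
  obtains C where "\<And>x. x \<in> \<Omega> L H \<Longrightarrow> cmod (k x) \<le> C"
proof -
  have "compact (k ` cbox (0, -H) (L, H))"
    by (intro compact_continuous_image compact_cbox continuous_on_subset[OF assms]) auto
  then obtain C where "\<And>x. x \<in> cbox (0, -H) (L, H) \<Longrightarrow> cmod (k x) \<le> C"
    by (meson bounded_iff compact_imp_bounded imageI)
  then show thesis using \<Omega>_subset that by blast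
qed

lemma set_borel_measurable_continuous:
  fixes k :: "'a::euclidean_space \<Rightarrow> complex"
  assumes "continuous_on UNIV k" "A \<in> sets borel"
  shows "set_borel_measurable borel A k"
  using assms by (intro set_measurable_continuous_on) (auto intro: continuous_on_subset)

lemma tensor_Fubini_continuous:
  fixes K :: "real \<times> real \<Rightarrow> complex" and p :: "real \<Rightarrow> complex"
  assumes K: "continuous_on UNIV K" and p: "set_integrable lebesgue {-H<..<H} p"
  shows "set_integrable lebesgue (\<Omega> L H) (\<lambda>x. K x * p (snd x))"
    and "(LINT x:\<Omega> L H|lebesgue. K x * p (snd x))
           = (LINT t:{-H<..<H}|lebesgue. (LINT s:{0<..<L}|lebesgue. K (s, t)) * p t)"
    and "(LINT x:\<Omega> L H|lebesgue. K x * p (snd x))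
           = (LINT s:{0<..<L}|lebesgue. (LINT t:{-H<..<H}|lebesgue. K (s, t) * p t))"
proof -
  obtain C where C: "\<And>x. x \<in> \<Omega> L H \<Longrightarrow> cmod (K x) \<le> C"
    using continuous_bounded_\<Omega>[OF K] by blast
  note F = tensor_Fubini[of 0 L "-H" H K C p, folded \<Omega>_def,
      OF set_borel_measurable_continuous[OF K \<Omega>_borel] C p]
  show "set_integrable lebesgue (\<Omega> L H) (\<lambda>x. K x * p (snd x))" by (rule F)
  show "(LINT x:\<Omega> L H|lebesgue. K x * p (snd x))
      = (LINT t:{-H<..<H}|lebesgue. (LINT s:{0<..<L}|lebesgue. K (s, t)) * p t)" by (rule F)
  show "(LINT x:\<Omega> L H|lebesgue. K x * p (snd x))
      = (LINT s:{0<..<L}|lebesgue. (LINT t:{-H<..<H}|lebesgue. K (s, t) * p t))" by (rule F)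
qed

text \<open>Measurability and square integrability both come from the product theorem, applied to e
  and p and then to their squared moduli.\<close>

lemma L2_on_separated:
  fixes e p :: "real \<Rightarrow> complex"
  assumes e: "continuous_on UNIV e" and p: "L2_on {-H<..<H} p"
  shows "L2_on (\<Omega> L H) (\<lambda>x. p (snd x) * e (fst x))"
proof -
  have pi: "set_integrable lebesgue {-H<..<H} p"
    using L2_on_imp_set_integrable[of "-H" H p] p by simp
  have ec: "continuous_on UNIV (\<lambda>x::real \<times> real. e (fst x))"
    by (rule continuous_on_compose2[OF e continuous_on_fst]) (auto intro: continuous_intros)
  have m: "set_borel_measurable lebesgue (\<Omega> L H) (\<lambda>x. p (snd x) * e (fst x))"
    using tensor_Fubini_continuous(1)[OF ec pi, of L]
    by (auto simp: set_borel_measurable_def set_integrable_def mult.commute)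
  have p2: "set_integrable lebesgue {-H<..<H} (\<lambda>t. complex_of_real ((cmod (p t))\<^sup>2))"
    using p unfolding L2_on_def set_integrable_def
    by (simp only: of_real_mult[symmetric] scaleR_conv_of_real of_real_eq_id complex_of_real_integrable_eq id_apply real_scaleR_def)
  have "set_integrable lebesgue (\<Omega> L H)
      (\<lambda>x. complex_of_real ((cmod (e (fst x)))\<^sup>2) * complex_of_real ((cmod (p (snd x)))\<^sup>2))"
    by (rule tensor_Fubini_continuous(1)[OF _ p2]) (intro continuous_intros ec)
  then have "integrable lebesgue (\<lambda>x. complex_of_real (indicator (\<Omega> L H) x * (cmod (p (snd x) * e (fst x)))\<^sup>2))"
    by (simp add: set_integrable_def norm_mult power_mult_distrib mult.commute scaleR_conv_of_real)
  then have "integrable lebesgue (\<lambda>x. indicator (\<Omega> L H) x * (cmod (p (snd x) * e (fst x)))\<^sup>2)"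
    by (simp only: complex_of_real_integrable_eq)
  then show ?thesis using m by (simp add: L2_on_def set_integrable_def)
qed

text \<open>Supplies what slicing a two-dimensional test function requires: partial derivatives as
  values of the Frechet derivative, and vertical sections supported in the projection of the compact
  support.\<close>

lemma test_function_section:
  fixes \<phi> :: "real \<times> real \<Rightarrow> real"
  assumes t: "test_function (\<Omega> L H) \<phi>"
  shows "((\<lambda>s. \<phi> (s, t)) has_real_derivative frechet_derivative \<phi> (at (s, t)) (1, 0)) (at s)"
    and "((\<lambda>t. \<phi> (s, t)) has_real_derivative frechet_derivative \<phi> (at (s, t)) (0, 1)) (at t)"
    and "test_function {-H<..<H} (\<lambda>t. \<phi> (s, t))"
proof -
  let ?D = "\<lambda>s t. frechet_derivative \<phi> (at (s, t))"
  have D: "(\<phi> has_derivative ?D s t) (at (s, t))" for s t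
    by (rule test_function_derivative(1)[OF t])
  have lin: "?D s t (h *\<^sub>R b) = h *\<^sub>R ?D s t b" for s t h b
    by (rule linear_scale[OF has_derivative_linear[OF D]])
  have lin1: "(\<lambda>h. ?D s t (h, 0)) = (*) (?D s t (1, 0))" for s t
  proof
    show "?D s t (h, 0) = ?D s t (1, 0) * h" for h using lin[of s t h "(1, 0)"] by (simp add: mult.commute)
  qed
  have lin2: "(\<lambda>h. ?D s t (0, h)) = (*) (?D s t (0, 1))" for s t
  proof
    show "?D s t (0, h) = ?D s t (0, 1) * h" for h using lin[of s t h "(0, 1)"] by (simp add: mult.commute)
  qed
  have d1: "((\<lambda>s. \<phi> (s, t)) has_derivative (\<lambda>h. ?D s t (h, 0))) (at s)" for s t
    by (rule has_derivative_compose[where f = "\<lambda>s. (s, t)" and f' = "\<lambda>h. (h, 0)", OF _ D])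
       (auto intro!: derivative_eq_intros)
  have d2: "((\<lambda>t. \<phi> (s, t)) has_derivative (\<lambda>h. ?D s t (0, h))) (at t)" for s t
    by (rule has_derivative_compose[where f = "\<lambda>t. (s, t)" and f' = "\<lambda>h. (0, h)", OF _ D])
       (auto intro!: derivative_eq_intros)
  show "((\<lambda>s. \<phi> (s, t)) has_real_derivative ?D s t (1, 0)) (at s)"
    using d1[of t s] by (simp only: has_field_derivative_def lin1)
  show d2': "((\<lambda>t. \<phi> (s, t)) has_real_derivative ?D s t (0, 1)) (at t)" for t
    using d2[of s t] by (simp only: has_field_derivative_def lin2)
  obtain K where K: "compact K" "K \<subseteq> \<Omega> L H" "\<And>x. x \<notin> K \<Longrightarrow> \<phi> x = 0"
    using t unfolding test_function_iff by blast
  show "test_function {-H<..<H} (\<lambda>t. \<phi> (s, t))"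
    unfolding test_function_iff
  proof (intro conjI exI[of _ "snd ` K"])
    have "continuous_on UNIV (\<lambda>t. ?D s t (0, 1))"
      by (rule continuous_on_compose2[OF test_function_derivative(2)[OF t, of UNIV]])
         (auto intro!: continuous_intros)
    then show "C1_fun (\<lambda>t. \<phi> (s, t))" using d2' by (intro C1_funI_real)
    show "compact (snd ` K)" by (intro compact_continuous_image continuous_intros K)
    show "snd ` K \<subseteq> {-H<..<H}" using K(2) by (auto simp: \<Omega>_def)
    show "\<forall>t. t \<notin> snd ` K \<longrightarrow> \<phi> (s, t) = 0" using K(3) by (force simp: image_iff)
  qed
qed

lemma test_function_complex_continuous:
  fixes \<phi> :: "real \<times> real \<Rightarrow> real"
  assumes t: "test_function A \<phi>" and e: "continuous_on UNIV e"
  shows "continuous_on UNIV (\<lambda>x. complex_of_real (\<phi> x) * e (fst x))"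
    and "continuous_on UNIV (\<lambda>x. complex_of_real (frechet_derivative \<phi> (at x) b) * e (fst x))"
  by (intro continuous_intros test_function_continuous[OF t] test_function_derivative(2)[OF t]
        continuous_on_compose2[OF e continuous_on_fst]; auto intro: continuous_intros)+

text \<open>The height is integrated first: for fixed s the factor e s is a constant, and the
  vertical section of the test function can be tested against c.\<close>

lemma has_weak_derivative_separated_snd:
  fixes e c g :: "real \<Rightarrow> complex"
  assumes e: "continuous_on UNIV e" and c: "has_weak_derivative c g 1 {-H<..<H}"
  shows "has_weak_derivative (\<lambda>x. c (snd x) * e (fst x)) (\<lambda>x. g (snd x) * e (fst x)) (0, 1) (\<Omega> L H)"
  unfolding has_weak_derivative_def
proof (intro conjI allI impI)
  have L2: "L2_on {-H<..<H} c" "L2_on {-H<..<H} g"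
    using c by (auto simp: has_weak_derivative_def)
  then show "L2_on (\<Omega> L H) (\<lambda>x. c (snd x) * e (fst x))" "L2_on (\<Omega> L H) (\<lambda>x. g (snd x) * e (fst x))"
    by (auto intro: L2_on_separated[OF e])
  have i: "set_integrable lebesgue {-H<..<H} c" "set_integrable lebesgue {-H<..<H} g"
    using L2_on_imp_set_integrable[of "-H" H] L2 by auto
  fix \<phi> :: "real \<times> real \<Rightarrow> real" assume t: "test_function (\<Omega> L H) \<phi>"
  let ?D = "\<lambda>s t. frechet_derivative \<phi> (at (s, t)) (0, 1)"
  note sec = test_function_section[OF t]
  note cc = test_function_complex_continuous[OF t e]
  have "(LINT x:\<Omega> L H|lebesgue. frechet_derivative \<phi> (at x) (0, 1) *\<^sub>R (c (snd x) * e (fst x)))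
      = (LINT x:\<Omega> L H|lebesgue. (of_real (frechet_derivative \<phi> (at x) (0, 1)) * e (fst x)) * c (snd x))"
    by (simp add: scaleR_conv_of_real algebra_simps)
  also have "\<dots> = (LINT s:{0<..<L}|lebesgue. (LINT t:{-H<..<H}|lebesgue. (of_real (?D s t) * e s) * c t))"
    by (subst tensor_Fubini_continuous(3)[OF cc(2) i(1)]) simp
  also have "\<dots> = (LINT s:{0<..<L}|lebesgue. - (LINT t:{-H<..<H}|lebesgue. (of_real (\<phi> (s, t)) * e s) * g t))"
  proof (rule set_lebesgue_integral_cong; (intro allI impI)?)
    fix s
    have "(LINT t:{-H<..<H}|lebesgue. (of_real (?D s t) * e s) * c t)
        = e s * (LINT t:{-H<..<H}|lebesgue. frechet_derivative (\<lambda>t. \<phi> (s, t)) (at t) 1 *\<^sub>R c t)"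
      using frechet_derivative_real[OF sec(2)]
      by (simp add: scaleR_conv_of_real algebra_simps flip: set_integral_mult_right)
    also have "\<dots> = e s * - (LINT t:{-H<..<H}|lebesgue. \<phi> (s, t) *\<^sub>R g t)"
      using c sec(3)[of s] by (simp add: has_weak_derivative_def)
    also have "\<dots> = - (LINT t:{-H<..<H}|lebesgue. (of_real (\<phi> (s, t)) * e s) * g t)"
      by (simp add: scaleR_conv_of_real algebra_simps flip: set_integral_mult_right)
    finally show "(LINT t:{-H<..<H}|lebesgue. (of_real (?D s t) * e s) * c t)
        = - (LINT t:{-H<..<H}|lebesgue. (of_real (\<phi> (s, t)) * e s) * g t)" .
  qed simp
  also have "\<dots> = - (LINT s:{0<..<L}|lebesgue. (LINT t:{-H<..<H}|lebesgue. (of_real (\<phi> (s, t)) * e s) * g t))"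
    by (simp add: set_lebesgue_integral_def)
  also have "\<dots> = - (LINT x:\<Omega> L H|lebesgue. (of_real (\<phi> x) * e (fst x)) * g (snd x))"
    by (subst tensor_Fubini_continuous(3)[OF cc(1) i(2)]) simp
  also have "\<dots> = - (LINT x:\<Omega> L H|lebesgue. \<phi> x *\<^sub>R (g (snd x) * e (fst x)))"
    by (simp add: scaleR_conv_of_real algebra_simps)
  finally show "(LINT x:\<Omega> L H|lebesgue. frechet_derivative \<phi> (at x) (0, 1) *\<^sub>R (c (snd x) * e (fst x)))
      = - (LINT x:\<Omega> L H|lebesgue. \<phi> x *\<^sub>R (g (snd x) * e (fst x)))" .
qed

text \<open>Here x_1 is integrated first, since e is C^1 while c is merely square integrable. The
  values at 0 and L drop out because the test function vanishes off the rectangle.\<close>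

lemma has_weak_derivative_separated_fst:
  fixes e e' c :: "real \<Rightarrow> complex"
  assumes L: "0 < L" and e: "\<And>s. (e has_vector_derivative e' s) (at s)" and e': "continuous_on UNIV e'"
    and c: "L2_on {-H<..<H} c"
  shows "has_weak_derivative (\<lambda>x. c (snd x) * e (fst x)) (\<lambda>x. c (snd x) * e' (fst x)) (1, 0) (\<Omega> L H)"
  unfolding has_weak_derivative_def
proof (intro conjI allI impI)
  have ec: "continuous_on A e" for A
    by (rule continuous_on_vector_derivative) (use e in \<open>auto intro: has_vector_derivative_at_within\<close>)
  show "L2_on (\<Omega> L H) (\<lambda>x. c (snd x) * e (fst x))" "L2_on (\<Omega> L H) (\<lambda>x. c (snd x) * e' (fst x))"
    by (intro L2_on_separated ec e' c)+
  have i: "set_integrable lebesgue {-H<..<H} c"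
    using L2_on_imp_set_integrable[of "-H" H c] c by auto
  fix \<phi> :: "real \<times> real \<Rightarrow> real" assume t: "test_function (\<Omega> L H) \<phi>"
  let ?D = "\<lambda>s t. frechet_derivative \<phi> (at (s, t)) (1, 0)"
  note sec = test_function_section[OF t]
  have "(LINT x:\<Omega> L H|lebesgue. frechet_derivative \<phi> (at x) (1, 0) *\<^sub>R (c (snd x) * e (fst x)))
      = (LINT x:\<Omega> L H|lebesgue. (of_real (frechet_derivative \<phi> (at x) (1, 0)) * e (fst x)) * c (snd x))"
    by (simp add: scaleR_conv_of_real algebra_simps)
  also have "\<dots> = (LINT t:{-H<..<H}|lebesgue. (LINT s:{0<..<L}|lebesgue. of_real (?D s t) * e s) * c t)"
    by (subst tensor_Fubini_continuous(2)[OF test_function_complex_continuous(2)[OF t ec] i]) simp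
  also have "\<dots> = (LINT t:{-H<..<H}|lebesgue. - ((LINT s:{0<..<L}|lebesgue. of_real (\<phi> (s, t)) * e' s) * c t))"
  proof (rule set_lebesgue_integral_cong; (intro allI impI)?)
    fix t' assume "t' \<in> {-H<..<H}"
    have Dc: "continuous_on A (\<lambda>s. ?D s t')" for A
      by (rule continuous_on_compose2[OF test_function_derivative(2)[OF t, of UNIV]])
         (auto intro!: continuous_intros)
    have \<phi>c: "continuous_on A (\<lambda>s. \<phi> (s, t'))" for A
      by (rule continuous_on_compose2[OF test_function_continuous[OF t, of UNIV]])
         (auto intro!: continuous_intros)
    have int: "set_integrable lebesgue {0<..<L} f" if "continuous_on {0..L} f" for f :: "real \<Rightarrow> complex"
      by (rule set_integrable_subset[OF absolutely_integrable_continuous_real[OF that]]) auto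
    have i1: "set_integrable lebesgue {0<..<L} (\<lambda>s. of_real (?D s t') * e s)"
      by (intro int continuous_intros ec Dc)
    have i2: "set_integrable lebesgue {0<..<L} (\<lambda>s. of_real (\<phi> (s, t')) * e' s)"
      by (intro int continuous_intros continuous_on_subset[OF e'] \<phi>c) auto
    have "(LINT s:{0<..<L}|lebesgue. of_real (?D s t') * e s + of_real (\<phi> (s, t')) * e' s)
        = of_real (\<phi> (L, t')) * e L - of_real (\<phi> (0, t')) * e 0"
    proof (rule fundamental_theorem_lebesgue[of _ _ "{}"])
      show "continuous_on {0..L} (\<lambda>s. of_real (\<phi> (s, t')) * e s)"
        by (intro continuous_intros ec \<phi>c)
      show "((\<lambda>s. of_real (\<phi> (s, t')) * e s) has_vector_derivative
          of_real (?D s t') * e s + of_real (\<phi> (s, t')) * e' s) (at s)" for s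
        using has_vector_derivative_scaleR[OF sec(1) e]
        by (simp add: scaleR_conv_of_real add.commute)
    qed (use L i1 i2 in \<open>auto intro: set_integral_add\<close>)
    also have "\<dots> = 0" using test_function_zero[OF t] by (simp add: \<Omega>_def)
    finally show "(LINT s:{0<..<L}|lebesgue. of_real (?D s t') * e s) * c t'
        = - ((LINT s:{0<..<L}|lebesgue. of_real (\<phi> (s, t')) * e' s) * c t')"
      using i1 i2 by (simp add: set_integral_add(2) eq_neg_iff_add_eq_0 flip: distrib_right)
  qed simp
  also have "\<dots> = - (LINT t:{-H<..<H}|lebesgue. (LINT s:{0<..<L}|lebesgue. of_real (\<phi> (s, t)) * e' s) * c t)"
    by (simp add: set_lebesgue_integral_def)
  also have "\<dots> = - (LINT x:\<Omega> L H|lebesgue. (of_real (\<phi> x) * e' (fst x)) * c (snd x))"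
    by (subst tensor_Fubini_continuous(2)[OF test_function_complex_continuous(1)[OF t e'] i]) simp
  also have "\<dots> = - (LINT x:\<Omega> L H|lebesgue. \<phi> x *\<^sub>R (c (snd x) * e' (fst x)))"
    by (simp add: scaleR_conv_of_real algebra_simps)
  finally show "(LINT x:\<Omega> L H|lebesgue. frechet_derivative \<phi> (at x) (1, 0) *\<^sub>R (c (snd x) * e (fst x)))
      = - (LINT x:\<Omega> L H|lebesgue. \<phi> x *\<^sub>R (c (snd x) * e' (fst x)))" .
qed

section \<open>Fourier modes\<close>

lemma mode_has_vector_derivative:
  "(mode \<alpha> n has_vector_derivative (\<i> * of_real (\<alpha> n)) * mode \<alpha> n s) (at s within A)"
  unfolding mode_def[abs_def]
  by (auto intro!: derivative_eq_intros has_vector_derivative_real_field simp: scaleR_conv_of_real)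

lemma continuous_on_mode [continuous_intros]:
  "continuous_on A f \<Longrightarrow> continuous_on A (\<lambda>x. mode \<alpha> n (f x))"
  unfolding mode_def by (intro continuous_intros)

lemma norm_mode [simp]: "cmod (mode \<alpha> n s) = 1"
  unfolding mode_def by (simp add: norm_exp_eq_Re)

text \<open>The quasi-periodic phase cancels in the product, leaving the L-periodic exponentials
  that define the Toeplitz coefficients.\<close>

lemma mode_mult_cnj:
  assumes "\<And>n m. \<alpha> n - \<alpha> m = 2 * pi * of_int (n - m) / L"
  shows "mode \<alpha> m s * cnj (mode \<alpha> n s) = cnj (mode (\<lambda>k. 2 * pi * of_int k / L) (n - m) s)"
proof -
  have "mode \<alpha> m s * cnj (mode \<alpha> n s) = exp (- (\<i> * of_real ((\<alpha> n - \<alpha> m) * s)))"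
    unfolding mode_def by (simp add: exp_cnj algebra_simps flip: exp_add)
  then show ?thesis using assms[of n m] by (simp add: mode_def exp_cnj)
qed

lemma set_integrable_continuous_Ioo:
  fixes f :: "real \<Rightarrow> complex"
  assumes "continuous_on {a..b} f"
  shows "set_integrable lebesgue {a<..<b} f"
  by (rule set_integrable_subset[OF absolutely_integrable_continuous_real[OF assms]]) auto

text \<open>Off the diagonal the product is an exponential of nonzero frequency whose primitive
  takes equal values at 0 and L.\<close>

lemma mode_orthogonal:
  assumes L: "0 < L" and \<alpha>: "\<And>n m. \<alpha> n - \<alpha> m = 2 * pi * of_int (n - m) / L"
  shows "(LINT s:{0<..<L}|lebesgue. mode \<alpha> m s * cnj (mode \<alpha> n s)) = (if m = n then of_real L else 0)"
proof (cases "m = n")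
  case True
  have "mode \<alpha> n s * cnj (mode \<alpha> n s) = 1" for s
    by (simp add: complex_norm_square[symmetric])
  moreover have "(LINT s:{0<..<L}|lebesgue. (1::complex)) = of_real L"
    using L by (simp add: set_lebesgue_integral_def scaleR_conv_of_real measure_def)
  ultimately show ?thesis using True by simp
next
  case False
  define \<omega> where "\<omega> = (\<lambda>k. 2 * pi * of_int k / L)"
  define e where "e = mode \<omega> (m - n)"
  define d where "d = \<i> * complex_of_real (\<omega> (m - n))"
  have d: "d \<noteq> 0" using False L by (simp add: d_def \<omega>_def)
  have eq: "mode \<alpha> m s * cnj (mode \<alpha> n s) = e s" for s
    unfolding mode_mult_cnj[OF \<alpha>] e_def \<omega>_def by (simp add: mode_def exp_cnj algebra_simps)
  have "(LINT s:{0<..<L}|lebesgue. e s) = e L / d - e 0 / d"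
  proof (rule fundamental_theorem_lebesgue[of _ _ "{}"])
    show "((\<lambda>s. e s / d) has_vector_derivative e s) (at s)" for s
      using has_vector_derivative_divide[OF mode_has_vector_derivative[of \<omega> "m - n" s], of d] d
      by (simp add: e_def d_def)
    show "continuous_on {0..L} (\<lambda>s. e s / d)" "set_integrable lebesgue {0<..<L} e"
      using d by (auto intro!: continuous_intros set_integrable_continuous_Ioo simp: e_def)
  qed (use L in auto)
  moreover have "e L = 1"
  proof -
    have "\<omega> (m - n) * L = 2 * of_int (m - n) * pi" using L by (simp add: \<omega>_def)
    then have "e L = exp (of_real (2 * of_int (m - n) * pi) * \<i>)"
      by (simp only: e_def mode_def mult.commute)
    then show ?thesis by (simp only: exp_integer_2pi Ints_of_int)
  qed
  moreover have "e 0 = 1" by (simp add: e_def mode_def)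
  ultimately show ?thesis using False by (simp add: eq)
qed

text \<open>Parseval for trigonometric polynomials; used for the boundary terms and for the lower
  bound in the coercivity estimate.\<close>

lemma mode_sum_pairing:
  assumes L: "0 < L" and \<alpha>: "\<And>n m. \<alpha> n - \<alpha> m = 2 * pi * of_int (n - m) / L" and N: "finite N"
  shows "(LINT s:{0<..<L}|lebesgue. (\<Sum>m\<in>N. x m * mode \<alpha> m s) * cnj (\<Sum>n\<in>N. y n * mode \<alpha> n s))
       = of_real L * (\<Sum>n\<in>N. x n * cnj (y n))"
proof -
  have i: "set_integrable lebesgue {0<..<L} (\<lambda>s. mode \<alpha> m s * cnj (mode \<alpha> n s))" for m n
    by (intro set_integrable_continuous_Ioo continuous_intros)
  have "(LINT s:{0<..<L}|lebesgue. (\<Sum>m\<in>N. x m * mode \<alpha> m s) * cnj (\<Sum>n\<in>N. y n * mode \<alpha> n s))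
      = (LINT s:{0<..<L}|lebesgue. \<Sum>n\<in>N. \<Sum>m\<in>N. (x m * cnj (y n)) * (mode \<alpha> m s * cnj (mode \<alpha> n s)))"
    by (simp add: sum_distrib_left sum_distrib_right algebra_simps)
  also have "\<dots> = (\<Sum>n\<in>N. \<Sum>m\<in>N. (x m * cnj (y n)) * (LINT s:{0<..<L}|lebesgue. mode \<alpha> m s * cnj (mode \<alpha> n s)))"
    using i unfolding set_lebesgue_integral_def set_integrable_def scaleR_sum_right
    by (subst Bochner_Integration.integral_sum; (intro Bochner_Integration.integrable_sum)?)
       (auto simp: mult.left_commute[of "of_real _"] scaleR_conv_of_real Bochner_Integration.integral_sum)
  also have "\<dots> = (\<Sum>n\<in>N. of_real L * (x n * cnj (y n)))"
    using N by (simp add: mode_orthogonal[OF L \<alpha>] if_distrib[of "(*) _"] sum.delta mult.commute cong: if_cong)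
  finally show ?thesis by (simp add: sum_distrib_left)
qed

section \<open>The permittivity\<close>

lemma C2_on_continuous: "C2_on U g \<Longrightarrow> continuous_on U g"
  unfolding C2_on_def
  by (metis continuous_at_imp_continuous_on has_derivative_continuous)

text \<open>Borel and not just Lebesgue measurability matters: slicing restricts the permittivity to
  single horizontal lines, which are null sets.\<close>

lemma piecewise_C2_on_measurable:
  assumes "piecewise_C2_on A f"
  shows "set_borel_measurable borel A f"
proof -
  obtain \<D> where D: "finite \<D>" "disjoint \<D>" "\<Union>\<D> = A"
    and smooth: "\<forall>D\<in>\<D>. D \<in> sets borel \<and> D \<subseteq> closure (interior D) \<and>
       (\<exists>U g. open U \<and> closure D \<subseteq> U \<and> C2_on U g \<and> (\<forall>x\<in>D. f x = g x))"
    using assms unfolding piecewise_C2_on_def by blast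
  have "(\<lambda>x. \<Sum>D\<in>\<D>. indicator D x *\<^sub>R f x) \<in> borel_measurable borel"
  proof (rule borel_measurable_sum)
    fix D assume D: "D \<in> \<D>"
    obtain U g where g: "D \<in> sets borel" "closure D \<subseteq> U" "C2_on U g" "\<forall>x\<in>D. f x = g x"
      using bspec[OF smooth D] by (elim conjE exE)
    have "continuous_on D g"
      using C2_on_continuous[OF g(3)] g(2) closure_subset by (meson continuous_on_subset order_trans)
    then have "(\<lambda>x. indicator D x *\<^sub>R g x) \<in> borel_measurable borel"
      using set_measurable_continuous_on[OF g(1)] by (simp add: set_borel_measurable_def)
    then show "(\<lambda>x. indicator D x *\<^sub>R f x) \<in> borel_measurable borel"
      by (rule measurable_cong[THEN iffD1, rotated]) (use g(4) in \<open>auto simp: indicator_def\<close>)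
  qed
  moreover have "(\<Sum>D\<in>\<D>. indicator D x *\<^sub>R f x) = indicator A x *\<^sub>R f x" for x
  proof (cases "x \<in> A")
    case True
    then obtain D0 where D0: "D0 \<in> \<D>" "x \<in> D0" using D(3) by blast
    have "x \<notin> E" if "E \<in> \<D>" "E \<noteq> D0" for E
      using D(2) D0 that by (auto simp: pairwise_def disjnt_def)
    then have "(\<Sum>D\<in>\<D>. indicator D x *\<^sub>R f x) = (\<Sum>D\<in>{D0}. indicator D x *\<^sub>R f x)"
      using D0(1) D(1) by (intro sum.mono_neutral_right) auto
    then show ?thesis using True D0 by simp
  next
    case False
    then show ?thesis using D(3) by (intro trans[OF sum.neutral]) auto
  qed
  ultimately show ?thesis by (simp add: set_borel_measurable_def)
qed

text \<open>Each smooth piece extends continuously to the closure of its subregion, which is compact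
  when A is bounded.\<close>

lemma piecewise_C2_on_bounded:
  assumes "piecewise_C2_on A f" "bounded A"
  obtains B where "\<And>x. x \<in> A \<Longrightarrow> cmod (f x) \<le> B"
proof -
  obtain \<D> where D: "finite \<D>" "\<Union>\<D> = A"
    and smooth: "\<forall>D\<in>\<D>. D \<in> sets borel \<and> D \<subseteq> closure (interior D) \<and>
       (\<exists>U g. open U \<and> closure D \<subseteq> U \<and> C2_on U g \<and> (\<forall>x\<in>D. f x = g x))"
    using assms unfolding piecewise_C2_on_def by blast
  have "bounded (f ` D)" if D': "D \<in> \<D>" for D
  proof -
    obtain U g where g: "closure D \<subseteq> U" "C2_on U g" "\<forall>x\<in>D. f x = g x"
      using bspec[OF smooth D'] by (elim conjE exE)
    have "bounded D" using D' D(2) by (intro bounded_subset[OF assms(2)]) auto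
    then have "compact (g ` closure D)"
      using C2_on_continuous[OF g(2)] g(1)
      by (intro compact_continuous_image) (auto intro: continuous_on_subset)
    moreover have "f ` D \<subseteq> g ` closure D" using g(3) closure_subset[of D] by auto
    ultimately show ?thesis by (meson bounded_subset compact_imp_bounded)
  qed
  then have "bounded (\<Union>D\<in>\<D>. f ` D)" using D(1) by (intro bounded_UN) auto
  also have "(\<Union>D\<in>\<D>. f ` D) = f ` A" using D(2) by auto
  finally show thesis using that by (auto simp: bounded_iff)
qed

section \<open>Meshes and the sliced permittivity\<close>

lemma mesh_less:
  assumes "is_mesh H S h" "i < j" "j \<le> S"
  shows "h i < h j"
  using assms(2,3)
proof (induction j)
  case (Suc j)
  then have "h j < h (Suc j)" using assms(1) by (simp add: is_mesh_def)
  then show ?case using Suc by (cases "i = j") auto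
qed simp

lemma mesh_le: "is_mesh H S h \<Longrightarrow> i \<le> j \<Longrightarrow> j \<le> S \<Longrightarrow> h i \<le> h j"
  using mesh_less[of H S h i j] by (cases "i = j") auto

lemma mesh_range: "is_mesh H S h \<Longrightarrow> i \<le> S \<Longrightarrow> h i \<in> {-H..H}"
  using mesh_le[of H S h 0 i] mesh_le[of H S h i S] by (auto simp: is_mesh_def)

text \<open>Every smaller index has its mesh height at most \<open>h (j - 1)\<close>, hence below t;
  values of h at indices above S cannot interfere with the minimum.\<close>

lemma mesh_Least:
  assumes m: "is_mesh H S h" and j: "j \<in> {1..S}" and t: "h (j - 1) < t" "t \<le> h j"
  shows "(LEAST j. t \<le> h j) = j"
proof (rule Least_equality)
  fix i assume "t \<le> h i"
  show "j \<le> i"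
  proof (rule ccontr)
    assume "\<not> j \<le> i"
    then have "h i \<le> h (j - 1)" using j by (intro mesh_le[OF m]) auto
    then show False using \<open>t \<le> h i\<close> t by simp
  qed
qed (rule t)

lemma mesh_slice:
  assumes m: "is_mesh H S h" and t: "t \<in> {-H<..<H}"
  obtains j where "j \<in> {1..S}" "h (j - 1) < t" "t \<le> h j"
proof -
  define j where "j = (LEAST j. t \<le> h j)"
  have "t \<le> h S" using m t by (simp add: is_mesh_def)
  then have j: "t \<le> h j" "j \<le> S" unfolding j_def by (auto intro: LeastI Least_le)
  \<comment> \<open>The height \<open>h 0\<close> is -H and lies below t, so \<open>j - 1\<close> is
    a genuine predecessor and not a truncated one.\<close>
  have "j \<noteq> 0" using j(1) m t by (metis greaterThanLessThan_iff is_mesh_def not_le)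
  then have "h (j - 1) < t" using not_less_Least[of "j - 1" "\<lambda>j. t \<le> h j"] by (simp add: j_def)
  then show thesis using that[of j] j \<open>j \<noteq> 0\<close> by auto
qed

lemma mesh_open_slice:
  assumes m: "is_mesh H S h" and t: "t \<in> {-H<..<H} - h ` {..S}"
  obtains j where "j \<in> {1..S}" "t \<in> {h (j - 1)<..<h j}"
proof -
  obtain j where j: "j \<in> {1..S}" "h (j - 1) < t" "t \<le> h j"
    using mesh_slice[OF m] t by blast
  moreover have "t \<noteq> h j" using j t by auto
  ultimately show thesis using that by auto
qed

lemma mesh_midpoint:
  assumes m: "is_mesh H S h" and j: "j \<in> {1..S}"
  shows "(h (j - 1) + h j) / 2 \<in> {-H<..<H}"
proof -
  have "h (j - 1) < h j" using j by (intro mesh_less[OF m]) auto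
  moreover have "-H \<le> h (j - 1)" "h j \<le> H"
    using j mesh_range[OF m, of "j - 1"] mesh_range[OF m, of j] by auto
  ultimately show ?thesis by auto
qed

lemma sliced_eq:
  assumes "is_mesh H S h" "j \<in> {1..S}" "h (j - 1) < t" "t \<le> h j"
  shows "sliced h \<epsilon> (s, t) = \<epsilon> (s, (h (j - 1) + h j) / 2)"
  using mesh_Least[OF assms] by (simp add: sliced_def Let_def)

text \<open>Midpoints of slices lie inside the rectangle, so pointwise bounds for the permittivity
  pass to the sliced one.\<close>

lemma sliced_sample:
  assumes m: "is_mesh H S h" and x: "x \<in> \<Omega> L H"
  obtains y where "y \<in> \<Omega> L H" "sliced h \<epsilon> x = \<epsilon> y"
proof -
  obtain s t where st: "x = (s, t)" "s \<in> {0<..<L}" "t \<in> {-H<..<H}" using x by (auto simp: \<Omega>_def)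
  obtain j where j: "j \<in> {1..S}" "h (j - 1) < t" "t \<le> h j" using mesh_slice[OF m st(3)] by blast
  show thesis
    using that[of "(s, (h (j - 1) + h j) / 2)"] sliced_eq[OF m j] mesh_midpoint[OF m j(1)] st
    by (auto simp: \<Omega>_def)
qed

text \<open>On each half-open strip the sliced function is a horizontal section of a Borel function,
  extended constantly in the height.\<close>

lemma sliced_measurable:
  assumes m: "is_mesh H S h" and \<epsilon>: "set_borel_measurable borel (\<Omega> L H) \<epsilon>"
  shows "set_borel_measurable borel (\<Omega> L H) (sliced h \<epsilon>)"
proof -
  define \<mu> where "\<mu> j = (h (j - 1) + h j) / 2" for j
  \<comment> \<open>The intersection removes the height H, which the last half-open slice contains
    and the open rectangle does not.\<close>
  define R where "R j = {0<..<L} \<times> ({h (j - 1)<..h j} \<inter> {-H<..<H})" for j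
  have R [measurable]: "R j \<in> sets borel" for j
    unfolding R_def by (simp add: borel_prod[symmetric])
  have "(\<lambda>s. indicator (\<Omega> L H) (s, \<mu> j) *\<^sub>R \<epsilon> (s, \<mu> j)) \<in> borel_measurable borel" for j
    using \<epsilon> unfolding set_borel_measurable_def
    by (rule measurable_compose[rotated]) (intro borel_measurable_continuous_onI continuous_intros)
  then have "(\<lambda>x::real\<times>real. indicator (\<Omega> L H) (fst x, \<mu> j) *\<^sub>R \<epsilon> (fst x, \<mu> j)) \<in> borel_measurable borel" for j
    by (rule measurable_compose[OF borel_measurable_continuous_onI[of fst], rotated])
       (intro continuous_intros)
  then have "(\<lambda>x. \<Sum>j\<in>{1..S}. indicator (R j) x *\<^sub>R (indicator (\<Omega> L H) (fst x, \<mu> j) *\<^sub>R \<epsilon> (fst x, \<mu> j)))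
      \<in> borel_measurable borel"
    by (intro borel_measurable_sum borel_measurable_scaleR[OF borel_measurable_indicator[OF R]])
  moreover have "(\<Sum>j\<in>{1..S}. indicator (R j) x *\<^sub>R (indicator (\<Omega> L H) (fst x, \<mu> j) *\<^sub>R \<epsilon> (fst x, \<mu> j)))
      = indicator (\<Omega> L H) x *\<^sub>R sliced h \<epsilon> x" for x
  proof (cases "x \<in> \<Omega> L H")
    case True
    then obtain s t where st: "x = (s, t)" "s \<in> {0<..<L}" "t \<in> {-H<..<H}" by (auto simp: \<Omega>_def)
    obtain j where j: "j \<in> {1..S}" "h (j - 1) < t" "t \<le> h j" using mesh_slice[OF m st(3)] by blast
    have "x \<notin> R i" if "i \<in> {1..S} - {j}" for i
    proof
      assume "x \<in> R i"
      then have i: "h (i - 1) < t" "t \<le> h i" by (auto simp: R_def st)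
      show False using mesh_Least[OF m _ i] mesh_Least[OF m j] that by auto
    qed
    then have "(\<Sum>j\<in>{1..S}. indicator (R j) x *\<^sub>R (indicator (\<Omega> L H) (fst x, \<mu> j) *\<^sub>R \<epsilon> (fst x, \<mu> j)))
        = (\<Sum>j\<in>{j}. indicator (R j) x *\<^sub>R (indicator (\<Omega> L H) (fst x, \<mu> j) *\<^sub>R \<epsilon> (fst x, \<mu> j)))"
      using j(1) by (intro sum.mono_neutral_right) auto
    then show ?thesis
      using True st j sliced_eq[OF m j] mesh_midpoint[OF m j(1)] by (simp add: R_def \<mu>_def \<Omega>_def)
  next
    case False
    moreover have "R j \<subseteq> \<Omega> L H" for j by (auto simp: R_def \<Omega>_def)
    ultimately have "x \<notin> R j" for j by blast
    then show ?thesis using False by (intro trans[OF sum.neutral]) auto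
  qed
  ultimately show ?thesis by (simp add: set_borel_measurable_def)
qed

section \<open>Coercivity of the Toeplitz matrices\<close>

lemma inv_eps_coeff_eq:
  assumes L: "0 < L" and \<alpha>: "\<And>n m. \<alpha> n - \<alpha> m = 2 * pi * of_int (n - m) / L"
  shows "(LINT s:{0<..<L}|lebesgue. 1 / \<epsilon>h (s, t) * (mode \<alpha> m s * cnj (mode \<alpha> n s)))
       = of_real L * inv_eps_coeff L \<epsilon>h t (n - m)"
  using L unfolding mode_mult_cnj[OF \<alpha>] inv_eps_coeff_def fourier_coeff_def by simp

lemma Re_set_integral:
  assumes "set_integrable M A f"
  shows "Re (LINT s:A|M. f s) = (LINT s:A|M. Re (f s))" "set_integrable M A (\<lambda>s. Re (f s))"
proof -
  have i: "integrable M (\<lambda>s. indicator A s *\<^sub>R f s)" using assms by (simp add: set_integrable_def)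
  show "Re (LINT s:A|M. f s) = (LINT s:A|M. Re (f s))"
    unfolding set_lebesgue_integral_def using integral_Re[OF i] by simp
  show "set_integrable M A (\<lambda>s. Re (f s))"
    unfolding set_integrable_def using integrable_Re[OF i] by simp
qed

text \<open>The quadratic form of the Toeplitz matrix is the integral of the coefficient function against
  the squared modulus of a trigonometric polynomial.\<close>

lemma Toeplitz_coercive:
  fixes x :: "int \<Rightarrow> complex"
  assumes L: "0 < L" and \<alpha>: "\<And>n m. \<alpha> n - \<alpha> m = 2 * pi * of_int (n - m) / L" and N: "finite N"
    and m: "set_borel_measurable lebesgue {0<..<L} (\<lambda>s. 1 / \<epsilon>h (s, t))"
    and C: "\<And>s. s \<in> {0<..<L} \<Longrightarrow> cmod (1 / \<epsilon>h (s, t)) \<le> C"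
    and c: "\<And>s. s \<in> {0<..<L} \<Longrightarrow> c \<le> Re (1 / \<epsilon>h (s, t))"
  shows "c * (\<Sum>n\<in>N. (cmod (x n))\<^sup>2)
    \<le> Re (\<Sum>n\<in>N. (\<Sum>m\<in>N. inv_eps_coeff L \<epsilon>h t (n - m) * x m) * cnj (x n))"
proof -
  define \<rho> where "\<rho> s = 1 / \<epsilon>h (s, t)" for s
  define p where "p s = (\<Sum>m\<in>N. x m * mode \<alpha> m s)" for s
  have pc: "continuous_on A p" for A unfolding p_def by (intro continuous_intros)
  have i: "set_integrable lebesgue {0<..<L} (\<lambda>s. \<rho> s * f s)" if "continuous_on UNIV f" for f
    unfolding \<rho>_def
    by (rule set_integrable_bounded_mult[OF set_integrable_continuous_Ioo m C])
       (use that continuous_on_subset in auto)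
  have pp: "p s * cnj (p s) = of_real ((cmod (p s))\<^sup>2)" for s
    by (simp add: complex_norm_square[symmetric])
  have "of_real L * (\<Sum>n\<in>N. (\<Sum>m\<in>N. inv_eps_coeff L \<epsilon>h t (n - m) * x m) * cnj (x n))
      = (\<Sum>n\<in>N. \<Sum>m\<in>N. (x m * cnj (x n)) * (LINT s:{0<..<L}|lebesgue. \<rho> s * (mode \<alpha> m s * cnj (mode \<alpha> n s))))"
    unfolding \<rho>_def inv_eps_coeff_eq[OF L \<alpha>] by (simp add: sum_distrib_left sum_distrib_right algebra_simps)
  also have "\<dots> = (LINT s:{0<..<L}|lebesgue. \<Sum>n\<in>N. \<Sum>m\<in>N. (x m * cnj (x n)) * (\<rho> s * (mode \<alpha> m s * cnj (mode \<alpha> n s))))"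
  proof -
    have "set_integrable lebesgue {0<..<L} (\<lambda>s. \<rho> s * (mode \<alpha> m s * cnj (mode \<alpha> n s)))" for m n
      by (intro i continuous_intros)
    then show ?thesis
      unfolding set_lebesgue_integral_def set_integrable_def scaleR_sum_right
      by (subst Bochner_Integration.integral_sum; (intro Bochner_Integration.integrable_sum)?)
         (auto simp: mult.left_commute[of "of_real _"] scaleR_conv_of_real Bochner_Integration.integral_sum)
  qed
  also have "\<dots> = (LINT s:{0<..<L}|lebesgue. \<rho> s * (p s * cnj (p s)))"
    unfolding p_def by (simp add: sum_distrib_left sum_distrib_right algebra_simps)
  finally have "Re (of_real L * (\<Sum>n\<in>N. (\<Sum>m\<in>N. inv_eps_coeff L \<epsilon>h t (n - m) * x m) * cnj (x n)))
      = Re (LINT s:{0<..<L}|lebesgue. \<rho> s * (p s * cnj (p s)))"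
    by (rule arg_cong)
  then have "L * Re (\<Sum>n\<in>N. (\<Sum>m\<in>N. inv_eps_coeff L \<epsilon>h t (n - m) * x m) * cnj (x n))
      = Re (LINT s:{0<..<L}|lebesgue. \<rho> s * (p s * cnj (p s)))"
    by (simp only: times_complex.simps(1) Re_complex_of_real Im_complex_of_real mult_zero_left diff_zero)
  also have "\<dots> = (LINT s:{0<..<L}|lebesgue. Re (\<rho> s * (p s * cnj (p s))))"
    by (intro Re_set_integral(1) i continuous_intros pc)
  \<comment> \<open>Since p times its conjugate is real and nonnegative, the lower bound for Re
    \<open>\<rho>\<close> can be used pointwise; Parseval then evaluates the remaining
    integral.\<close>
  also have "\<dots> \<ge> (LINT s:{0<..<L}|lebesgue. Re (of_real c * (p s * cnj (p s))))"
  proof (rule set_integral_mono)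
    show "set_integrable lebesgue {0<..<L} (\<lambda>s. Re (of_real c * (p s * cnj (p s))))"
      "set_integrable lebesgue {0<..<L} (\<lambda>s. Re (\<rho> s * (p s * cnj (p s))))"
      by (intro Re_set_integral i set_integrable_continuous_Ioo continuous_intros pc)+
    show "Re (of_real c * (p s * cnj (p s))) \<le> Re (\<rho> s * (p s * cnj (p s)))" if "s \<in> {0<..<L}" for s
    proof -
      have "c \<le> Re (\<rho> s)" using c[OF that] by (simp only: \<rho>_def)
      moreover have "Re (z * of_real y) = Re z * y" for z y by simp
      ultimately show ?thesis unfolding pp by (simp only: Re_complex_of_real mult_right_mono zero_le_power2)
    qed
  qed
  also have "(LINT s:{0<..<L}|lebesgue. Re (of_real c * (p s * cnj (p s))))
      = Re (LINT s:{0<..<L}|lebesgue. of_real c * (p s * cnj (p s)))"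
    by (intro Re_set_integral(1)[symmetric] set_integrable_continuous_Ioo continuous_intros pc)
  also have "\<dots> = Re (of_real c * (of_real L * (\<Sum>n\<in>N. x n * cnj (x n))))"
    unfolding set_integral_mult_right p_def mode_sum_pairing[OF L \<alpha> N] ..
  also have "\<dots> = L * (c * (\<Sum>n\<in>N. (cmod (x n))\<^sup>2))"
    by (simp add: complex_norm_square[symmetric] flip: of_real_sum of_real_mult)
  finally show ?thesis using L by simp
qed

text \<open>Young's inequality with weights c/2 and 1/(2c) lets half of the coercive term absorb the
  part quadratic in x, which yields the factor 1/c^2.\<close>

lemma Toeplitz_inverse_bound:
  fixes x :: "int \<Rightarrow> complex"
  assumes "0 < c" "finite N"
    and coercive: "c * (\<Sum>n\<in>N. (cmod (x n))\<^sup>2) \<le> Re (\<Sum>n\<in>N. q n * cnj (x n))"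
    and n: "n \<in> N"
  shows "(cmod (x n))\<^sup>2 \<le> (\<Sum>n\<in>N. (cmod (q n))\<^sup>2) / c\<^sup>2"
proof -
  let ?X = "\<Sum>n\<in>N. (cmod (x n))\<^sup>2" and ?Q = "\<Sum>n\<in>N. (cmod (q n))\<^sup>2"
  have "Re (q n * cnj (x n)) \<le> (c / 2) * (cmod (x n))\<^sup>2 + (1 / (2 * c)) * (cmod (q n))\<^sup>2" for n
  proof -
    have "Re (q n * cnj (x n)) \<le> cmod (q n) * cmod (x n)"
      by (metis complex_Re_le_cmod complex_mod_cnj norm_mult)
    also have "a * b \<le> (c / 2) * b\<^sup>2 + (1 / (2 * c)) * a\<^sup>2" for a b
    proof -
      have "0 \<le> (1 / (2 * c)) * (c * b - a)\<^sup>2" using \<open>0 < c\<close> by simp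
      then show ?thesis using \<open>0 < c\<close> by (simp add: power2_eq_square field_simps)
    qed
    finally show ?thesis .
  qed
  then have "Re (\<Sum>n\<in>N. q n * cnj (x n)) \<le> (\<Sum>n\<in>N. (c / 2) * (cmod (x n))\<^sup>2 + (1 / (2 * c)) * (cmod (q n))\<^sup>2)"
    unfolding Re_sum by (rule sum_mono)
  also have "\<dots> = (c / 2) * ?X + (1 / (2 * c)) * ?Q"
    by (simp add: sum.distrib sum_distrib_left sum_divide_distrib)
  finally have "(c / 2) * ?X \<le> (1 / (2 * c)) * ?Q" using coercive by simp
  then have "?X \<le> ?Q / c\<^sup>2" using \<open>0 < c\<close> by (simp add: field_simps power2_eq_square)
  moreover have "(cmod (x n))\<^sup>2 \<le> ?X"
    using n \<open>finite N\<close> by (intro member_le_sum) auto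
  ultimately show ?thesis by simp
qed

section \<open>The source term\<close>

lemma u_inc_has_vector_derivative:
  "((\<lambda>s. u_inc \<kappa> \<epsilon>p \<theta> (s, t)) has_vector_derivative
      \<i> * of_real (\<kappa> * sqrt \<epsilon>p * sin \<theta>) * u_inc \<kappa> \<epsilon>p \<theta> (s, t)) (at s)"
  "((\<lambda>t. u_inc \<kappa> \<epsilon>p \<theta> (s, t)) has_vector_derivative
      - \<i> * of_real (\<kappa> * sqrt \<epsilon>p * cos \<theta>) * u_inc \<kappa> \<epsilon>p \<theta> (s, t)) (at t)"
  unfolding u_inc_def
  by (auto intro!: derivative_eq_intros has_vector_derivative_real_field simp: algebra_simps)

lemma pd_u_inc:
  "pd1 (u_inc \<kappa> \<epsilon>p \<theta>) x = \<i> * of_real (\<kappa> * sqrt \<epsilon>p * sin \<theta>) * u_inc \<kappa> \<epsilon>p \<theta> x"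
  "pd2 (u_inc \<kappa> \<epsilon>p \<theta>) x = - \<i> * of_real (\<kappa> * sqrt \<epsilon>p * cos \<theta>) * u_inc \<kappa> \<epsilon>p \<theta> x"
  using vector_derivative_at[OF u_inc_has_vector_derivative(1)[of \<kappa> \<epsilon>p \<theta> "snd x" "fst x"]]
    vector_derivative_at[OF u_inc_has_vector_derivative(2)[of \<kappa> \<epsilon>p \<theta> "fst x" "snd x"]]
  unfolding pd1_def pd2_def by simp_all

lemma u_inc_continuous: "continuous_on A (u_inc \<kappa> \<epsilon>p \<theta>)"
  unfolding u_inc_def[abs_def] by (intro continuous_intros)

lemma norm_u_inc: "cmod (u_inc \<kappa> \<epsilon>p \<theta> x) = 1"
  unfolding u_inc_def by (simp add: norm_exp_eq_Re)

text \<open>Density of the n-th source coefficient. The cosine square comes from differentiating the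
  incident wave twice in x_2; the term with sine and \<open>\<alpha> n\<close> comes from moving the
  x_1 derivative onto the conjugate mode.\<close>

definition src_kernel ::
    "real \<Rightarrow> real \<Rightarrow> real \<Rightarrow> (real \<times> real \<Rightarrow> complex) \<Rightarrow> (int \<Rightarrow> real) \<Rightarrow> int \<Rightarrow> real \<times> real \<Rightarrow> complex" where
  "src_kernel \<kappa> \<epsilon>p \<theta> \<epsilon>h \<alpha> n x =
     - of_real ((\<kappa> * sqrt \<epsilon>p * cos \<theta>)\<^sup>2 + \<kappa> * sqrt \<epsilon>p * sin \<theta> * \<alpha> n) * u_inc \<kappa> \<epsilon>p \<theta> x * cnj (mode \<alpha> n (fst x))
       * (1 / of_real \<epsilon>p - 1 / \<epsilon>h x)"

text \<open>Inside a slice the coefficient does not depend on the height, so the derivative falls on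
  the incident wave alone.\<close>

lemma pd2_src2:
  assumes t: "t \<in> {a<..<b}" and const: "\<And>t'. t' \<in> {a<..<b} \<Longrightarrow> \<epsilon>h (s, t') = \<epsilon>h (s, t)"
  shows "pd2 (src2 \<kappa> \<epsilon>p \<theta> \<epsilon>h) (s, t) =
    - of_real ((\<kappa> * sqrt \<epsilon>p * cos \<theta>)\<^sup>2) * u_inc \<kappa> \<epsilon>p \<theta> (s, t) * (1 / of_real \<epsilon>p - 1 / \<epsilon>h (s, t))"
proof -
  define k where "k = - \<i> * complex_of_real (\<kappa> * sqrt \<epsilon>p * cos \<theta>)"
  define r where "r = 1 / of_real \<epsilon>p - 1 / \<epsilon>h (s, t)"
  have d: "((\<lambda>t'. r * k * u_inc \<kappa> \<epsilon>p \<theta> (s, t')) has_vector_derivative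
      r * k * (k * u_inc \<kappa> \<epsilon>p \<theta> (s, t))) (at t)"
    unfolding k_def by (intro has_vector_derivative_mult_right u_inc_has_vector_derivative)
  have eq: "r * k * u_inc \<kappa> \<epsilon>p \<theta> (s, t') = src2 \<kappa> \<epsilon>p \<theta> \<epsilon>h (s, t')" if "t' \<in> {a<..<b}" for t'
    unfolding src2_def pd_u_inc const[OF that] r_def k_def by simp
  have "((\<lambda>t'. src2 \<kappa> \<epsilon>p \<theta> \<epsilon>h (s, t')) has_vector_derivative
      r * k * (k * u_inc \<kappa> \<epsilon>p \<theta> (s, t))) (at t)"
    by (rule has_vector_derivative_transform_within_open[OF d open_greaterThanLessThan t eq])
  then have "pd2 (src2 \<kappa> \<epsilon>p \<theta> \<epsilon>h) (s, t) = r * (k * k) * u_inc \<kappa> \<epsilon>p \<theta> (s, t)"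
    unfolding pd2_def by (simp add: vector_derivative_at mult.assoc)
  also have "k * k = - of_real ((\<kappa> * sqrt \<epsilon>p * cos \<theta>)\<^sup>2)"
    unfolding k_def power2_eq_square of_real_mult by (simp add: algebra_simps)
  finally show ?thesis by (simp add: r_def mult.commute mult.left_commute)
qed

text \<open>The pairing is conjugate linear in the value and the x_1 derivative of \<phi> at the
  point. It is applied both to a single mode, for the RCWA coefficients, and to the whole test
  function v.\<close>

lemma div_src_pairing_eq:
  assumes t: "t \<in> {a<..<b}" and const: "\<And>t'. t' \<in> {a<..<b} \<Longrightarrow> \<epsilon>h (s, t') = \<epsilon>h (s, t)"
    and \<phi>: "\<phi> (s, t) = (\<Sum>n\<in>N. c n * mode \<alpha> n s)"
    and d\<phi>: "((\<lambda>s. \<phi> (s, t)) has_vector_derivative (\<Sum>n\<in>N. c n * (\<i> * of_real (\<alpha> n) * mode \<alpha> n s))) (at s)"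
  shows "div_src_pairing \<kappa> \<epsilon>p \<theta> \<epsilon>h \<phi> (s, t) = (\<Sum>n\<in>N. src_kernel \<kappa> \<epsilon>p \<theta> \<epsilon>h \<alpha> n (s, t) * cnj (c n))"
proof -
  have pd1: "pd1 \<phi> (s, t) = (\<Sum>n\<in>N. c n * (\<i> * of_real (\<alpha> n) * mode \<alpha> n s))"
    unfolding pd1_def using vector_derivative_at[OF d\<phi>] by simp
  have pd2: "pd2 (src2 \<kappa> \<epsilon>p \<theta> \<epsilon>h) (s, t) = - of_real ((\<kappa> * sqrt \<epsilon>p * cos \<theta>)\<^sup>2) *
      u_inc \<kappa> \<epsilon>p \<theta> (s, t) * (1 / of_real \<epsilon>p - 1 / \<epsilon>h (s, t))"
    using t const by (rule pd2_src2)
  show ?thesis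
    unfolding div_src_pairing_def pd2 src1_def pd_u_inc pd1 \<phi>
      cnj_sum sum_distrib_left sum_subtractf[symmetric]
    by (intro sum.cong refl)
       (simp add: src_kernel_def algebra_simps)
qed

lemma src_coeff_eq:
  assumes t: "t \<in> {a<..<b}" and const: "\<And>s t'. t' \<in> {a<..<b} \<Longrightarrow> \<epsilon>h (s, t') = \<epsilon>h (s, t)"
  shows "src_coeff L \<kappa> \<alpha> \<epsilon>p \<theta> \<epsilon>h n t = (LINT s:{0<..<L}|lebesgue. src_kernel \<kappa> \<epsilon>p \<theta> \<epsilon>h \<alpha> n (s, t)) / of_real L"
proof -
  have "div_src_pairing \<kappa> \<epsilon>p \<theta> \<epsilon>h (\<lambda>x. mode \<alpha> n (fst x)) (s, t) = src_kernel \<kappa> \<epsilon>p \<theta> \<epsilon>h \<alpha> n (s, t)" for s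
    using div_src_pairing_eq[where a=a and b=b and \<epsilon>h = \<epsilon>h and s = s, OF t const, where N = "{n}" and c = "\<lambda>_. 1" and \<phi> = "\<lambda>x. mode \<alpha> n (fst x)" and \<alpha> = \<alpha>]
      mode_has_vector_derivative[of \<alpha> n s UNIV] by simp
  then show ?thesis by (simp add: src_coeff_def)
qed

lemma set_borel_measurable_mult_continuous:
  fixes k f :: "'a::euclidean_space \<Rightarrow> complex"
  assumes "continuous_on UNIV k" "set_borel_measurable borel A f"
  shows "set_borel_measurable borel A (\<lambda>x. k x * f x)"
proof -
  have "(\<lambda>x. k x * (indicator A x *\<^sub>R f x)) \<in> borel_measurable borel"
    using assms unfolding set_borel_measurable_def
    by (intro borel_measurable_times borel_measurable_continuous_onI[of k])
  then show ?thesis by (simp add: set_borel_measurable_def)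
qed

lemma src_kernel_measurable:
  assumes m: "set_borel_measurable borel A (\<lambda>x. 1 / \<epsilon>h x)" and A: "A \<in> sets borel"
  shows "set_borel_measurable borel A (src_kernel \<kappa> \<epsilon>p \<theta> \<epsilon>h \<alpha> n)"
proof -
  have "(\<lambda>x. indicator A x *\<^sub>R (1 / of_real \<epsilon>p :: complex) - indicator A x *\<^sub>R (1 / \<epsilon>h x)) \<in> borel_measurable borel"
    using m A unfolding set_borel_measurable_def by (intro borel_measurable_diff) auto
  then have "set_borel_measurable borel A (\<lambda>x. 1 / of_real \<epsilon>p - 1 / \<epsilon>h x)"
    unfolding set_borel_measurable_def by (simp add: scaleR_diff_right)
  then show ?thesis
    unfolding src_kernel_def[abs_def]
    by (rule set_borel_measurable_mult_continuous[rotated]) (intro continuous_intros u_inc_continuous)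
qed

lemma src_kernel_bound:
  assumes "cmod (1 / \<epsilon>h x) \<le> C"
  shows "cmod (src_kernel \<kappa> \<epsilon>p \<theta> \<epsilon>h \<alpha> n x)
    \<le> \<bar>(\<kappa> * sqrt \<epsilon>p * cos \<theta>)\<^sup>2 + \<kappa> * sqrt \<epsilon>p * sin \<theta> * \<alpha> n\<bar> * (cmod (1 / of_real \<epsilon>p) + C)"
proof -
  have "cmod (1 / of_real \<epsilon>p - 1 / \<epsilon>h x) \<le> cmod (1 / of_real \<epsilon>p) + C"
    using norm_triangle_ineq4[of "1 / of_real \<epsilon>p" "1 / \<epsilon>h x"] assms by linarith
  then show ?thesis
    unfolding src_kernel_def norm_mult norm_minus_cancel norm_of_real norm_u_inc complex_mod_cnj norm_mode
    by (simp add: mult_left_mono)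
qed

section \<open>The variational identity\<close>

lemma set_integral_sum:
  fixes f :: "'i \<Rightarrow> 'a \<Rightarrow> 'b::{banach, second_countable_topology}"
  assumes "\<And>i. i \<in> I \<Longrightarrow> set_integrable M A (f i)"
  shows "set_integrable M A (\<lambda>x. \<Sum>i\<in>I. f i x)"
    and "(LINT x:A|M. \<Sum>i\<in>I. f i x) = (\<Sum>i\<in>I. LINT x:A|M. f i x)"
  using assms unfolding set_integrable_def set_lebesgue_integral_def scaleR_sum_right
  by (auto intro: Bochner_Integration.integrable_sum Bochner_Integration.integral_sum)

text \<open>Completeness supplies the measurability of g. This is what allows unspecified choices of
  weak derivatives in an integrand.\<close>

lemma set_integral_lebesgue_AE_cong:
  fixes f g :: "'a::euclidean_space \<Rightarrow> complex"
  assumes f: "set_integrable lebesgue A f" and ae: "AE x in lebesgue. x \<in> A \<longrightarrow> f x = g x"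
  shows "set_integrable lebesgue A g" and "(LINT x:A|lebesgue. g x) = (LINT x:A|lebesgue. f x)"
proof -
  let ?f = "\<lambda>x. indicator A x *\<^sub>R f x" and ?g = "\<lambda>x. indicator A x *\<^sub>R g x"
  have f': "integrable lebesgue ?f" using f by (simp add: set_integrable_def)
  have ae': "AE x in lebesgue. ?f x = ?g x" using ae by eventually_elim (auto simp: indicator_def)
  have fm: "?f \<in> borel_measurable lebesgue" using f' by (rule borel_measurable_integrable)
  have gm: "?g \<in> borel_measurable lebesgue" by (rule borel_measurable_AE[OF fm ae'])
  show "set_integrable lebesgue A g"
    using integrable_cong_AE[OF fm gm ae'] f' by (simp add: set_integrable_def)
  show "(LINT x:A|lebesgue. g x) = (LINT x:A|lebesgue. f x)"
    using integral_cong_AE[OF fm gm ae'] by (simp add: set_lebesgue_integral_def)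
qed

lemma AE_lebesgue_not_in_finite:
  fixes S :: "'a::euclidean_space set"
  assumes "finite S" shows "AE t in lebesgue. t \<notin> S"
  using assms by (intro AE_not_in) (simp add: negligible_finite flip: negligible_iff_null_sets)

text \<open>The analytic core, with mesh and boundary operators abstracted away. D is tied to the
  fluxes Q through the Toeplitz relation off a finite set of heights, and W is the density of the
  source; the result leaves the fluxes only at the two ends.\<close>

lemma variational_identity:
  fixes U D Q F c g :: "int \<Rightarrow> real \<Rightarrow> complex" and \<epsilon>h :: "real \<times> real \<Rightarrow> complex"
    and W :: "int \<Rightarrow> real \<times> real \<Rightarrow> complex" and N :: "int set" and S :: "real set"
    and L H \<kappa> C C' :: real and \<alpha> :: "int \<Rightarrow> real" and K :: "int \<Rightarrow> real"
  defines "a \<equiv> inv_eps_coeff L \<epsilon>h"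
  assumes L: "0 < L" and H: "0 < H" and N: "finite N" and S: "finite S"
    and \<alpha>: "\<And>n m. \<alpha> n - \<alpha> m = 2 * pi * of_int (n - m) / L"
    and \<rho>: "set_borel_measurable borel (\<Omega> L H) (\<lambda>x. 1 / \<epsilon>h x)" "\<And>x. x \<in> \<Omega> L H \<Longrightarrow> cmod (1 / \<epsilon>h x) \<le> C"
    and U: "\<And>n. n \<in> N \<Longrightarrow> continuous_on {-H..H} (U n)"
    and D: "\<And>n. n \<in> N \<Longrightarrow> set_borel_measurable lebesgue {-H<..<H} (D n)"
      "\<And>n t. n \<in> N \<Longrightarrow> t \<in> {-H<..<H} \<Longrightarrow> cmod (D n t) \<le> C'"
    and Q: "\<And>n. n \<in> N \<Longrightarrow> continuous_on {-H..H} (Q n)"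
      "\<And>n t. n \<in> N \<Longrightarrow> t \<in> {-H<..<H} - S \<Longrightarrow> Q n t = (\<Sum>m\<in>N. a t (n - m) * D m t)"
      "\<And>n t. n \<in> N \<Longrightarrow> t \<in> {-H<..<H} - S \<Longrightarrow>
        (Q n has_vector_derivative
          of_real (\<alpha> n) * (\<Sum>m\<in>N. a t (n - m) * of_real (\<alpha> m) * U m t) - (of_real \<kappa>)\<^sup>2 * U n t
          + (LINT s:{0<..<L}|lebesgue. W n (s, t)) / of_real L) (at t)"
    and W: "\<And>n. n \<in> N \<Longrightarrow> set_borel_measurable borel (\<Omega> L H) (W n)"
      "\<And>n x. n \<in> N \<Longrightarrow> x \<in> \<Omega> L H \<Longrightarrow> cmod (W n x) \<le> K n"
    and c: "\<And>n. n \<in> N \<Longrightarrow> continuous_on {-H..H} (c n)"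
      "\<And>n. n \<in> N \<Longrightarrow> has_weak_derivative (c n) (g n) 1 {-H<..<H}"
  defines "w \<equiv> (\<lambda>d x. \<Sum>m\<in>N. d m (snd x) * mode \<alpha> m (fst x))"
    and "w' \<equiv> (\<lambda>d x. \<Sum>m\<in>N. d m (snd x) * (\<i> * of_real (\<alpha> m) * mode \<alpha> m (fst x)))"
  defines "J \<equiv> (\<lambda>x. 1 / \<epsilon>h x * (w' U x * cnj (w' c x) + w D x * cnj (w g x)) - (of_real \<kappa>)\<^sup>2 * w U x * cnj (w c x))"
    and "P \<equiv> (\<lambda>x. \<Sum>n\<in>N. W n x * cnj (c n (snd x)))"
  shows "set_integrable lebesgue (\<Omega> L H) J" "set_integrable lebesgue (\<Omega> L H) P"
    and "(LINT x:\<Omega> L H|lebesgue. J x) =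
       of_real L * (\<Sum>n\<in>N. Q n H * cnj (c n H) - Q n (-H) * cnj (c n (-H))) - (LINT x:\<Omega> L H|lebesgue. P x)"
proof -
  \<comment> \<open>The integrand is separated for \<open>tensor_Fubini\<close>:
    \<open>\<rho>E\<close> and \<open>E\<close> hold the modes with and without 1/\<epsilon>_h,
    \<open>p\<close> and \<open>r\<close> the factors depending on the height only. The product
    \<alpha>_m \<alpha>_n in \<open>p\<close> arises from i \<alpha>_m times the conjugate of i
    \<alpha>_n.\<close>
  define \<rho>E where "\<rho>E m n x = (mode \<alpha> m (fst x) * cnj (mode \<alpha> n (fst x))) * (1 / \<epsilon>h x)" for m n and x :: "real \<times> real"
  define E where "E m n x = mode \<alpha> m (fst x) * cnj (mode \<alpha> n (fst x))" for m n and x :: "real \<times> real"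
  define p where "p m n t = of_real (\<alpha> m * \<alpha> n) * (U m t * cnj (c n t)) + D m t * cnj (g n t)" for m n t
  define r where "r m n t = (of_real \<kappa>)\<^sup>2 * (U m t * cnj (c n t))" for m n t
  have Ic: "set_integrable lebesgue {-H<..<H} f" if "continuous_on {-H..H} f" for f :: "real \<Rightarrow> complex"
    using that by (rule set_integrable_continuous_Ioo)
  have gi: "set_integrable lebesgue {-H<..<H} (\<lambda>t. cnj (g n t))" if "n \<in> N" for n
    using L2_on_imp_set_integrable[of "-H" H] has_weak_derivative_cnj[OF c(2)[OF that]]
    by (simp add: has_weak_derivative_def)
  have rc: "continuous_on {-H..H} (r m n)" if "m \<in> N" "n \<in> N" for m n
    unfolding r_def[abs_def] by (intro continuous_intros U c that)
  have pi: "set_integrable lebesgue {-H<..<H} (p m n)" if "m \<in> N" "n \<in> N" for m n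
    unfolding p_def[abs_def]
    by (intro set_integral_add Ic continuous_intros U c that set_integrable_bounded_mult[OF gi D(1) D(2)])
  have \<rho>Em: "set_borel_measurable borel (\<Omega> L H) (\<rho>E m n)" for m n
    unfolding \<rho>E_def[abs_def] by (intro set_borel_measurable_mult_continuous \<rho> continuous_intros)
  have \<rho>Eb: "cmod (\<rho>E m n x) \<le> C" if "x \<in> \<Omega> L H" for m n x
    using \<rho>(2)[OF that] by (simp add: \<rho>E_def norm_mult norm_divide)
  have \<rho>Ei: "(LINT s:{0<..<L}|lebesgue. \<rho>E m n (s, t)) = of_real L * a t (n - m)" for m n t
    unfolding a_def inv_eps_coeff_eq[OF L \<alpha>, symmetric] by (simp add: \<rho>E_def mult.commute)
  have FA: "set_integrable lebesgue (\<Omega> L H) (\<lambda>x. \<rho>E m n x * k (snd x))"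
    "set_integrable lebesgue {-H<..<H} (\<lambda>t. of_real L * a t (n - m) * k t)"
    "(LINT x:\<Omega> L H|lebesgue. \<rho>E m n x * k (snd x))
      = (LINT t:{-H<..<H}|lebesgue. of_real L * a t (n - m) * k t)"
    if k: "set_integrable lebesgue {-H<..<H} k" for m n k
    using tensor_Fubini(1-3)[of 0 L "-H" H "\<rho>E m n" C k, folded \<Omega>_def, OF \<rho>Em \<rho>Eb k]
    unfolding \<rho>Ei by auto
  have Ec: "continuous_on UNIV (E m n)" for m n
    unfolding E_def[abs_def] by (intro continuous_intros)
  have Ei: "(LINT s:{0<..<L}|lebesgue. E m n (s, t)) = (if m = n then of_real L else 0)" for m n t
    using mode_orthogonal[OF L \<alpha>] by (simp add: E_def)
  note FE = tensor_Fubini_continuous[where H = H and L = L, OF Ec, simplified Ei]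
  have Jeq: "J x = (\<Sum>n\<in>N. \<Sum>m\<in>N. \<rho>E m n x * p m n (snd x) - E m n x * r m n (snd x))" for x
    unfolding J_def w_def w'_def \<rho>E_def E_def p_def r_def
    by (simp add: sum_distrib_left sum_distrib_right sum.distrib[symmetric] sum_subtractf[symmetric])
       (auto intro!: sum.cong simp: algebra_simps)
  have Jint: "set_integrable lebesgue (\<Omega> L H) (\<lambda>x. \<rho>E m n x * p m n (snd x))"
    "set_integrable lebesgue (\<Omega> L H) (\<lambda>x. E m n x * r m n (snd x))" if "m \<in> N" "n \<in> N" for m n
    using that by (auto intro: FA(1) FE(1) pi Ic rc)
  show "set_integrable lebesgue (\<Omega> L H) J"
    unfolding Jeq[abs_def] by (intro set_integral_sum(1) set_integral_diff(1) Jint)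
  have cnjc: "continuous_on {-H..H} (\<lambda>t. cnj (c n t))" if "n \<in> N" for n
    by (intro continuous_intros c that)
  have FW: "set_integrable lebesgue (\<Omega> L H) (\<lambda>x. W n x * k (snd x))"
    "set_integrable lebesgue {-H<..<H} (\<lambda>t. (LINT s:{0<..<L}|lebesgue. W n (s, t)) * k t)"
    "(LINT x:\<Omega> L H|lebesgue. W n x * k (snd x))
      = (LINT t:{-H<..<H}|lebesgue. (LINT s:{0<..<L}|lebesgue. W n (s, t)) * k t)"
    if n: "n \<in> N" and k: "set_integrable lebesgue {-H<..<H} k" for n k
    using tensor_Fubini(1-3)[of 0 L "-H" H "W n" "K n" k, folded \<Omega>_def, OF W(1)[OF n] W(2)[OF n] k]
    by auto
  have FWi: "set_integrable lebesgue (\<Omega> L H) (\<lambda>x. W n x * cnj (c n (snd x)))" if n: "n \<in> N" for n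
    by (rule FW(1)[OF n Ic[OF cnjc[OF n]]])
  show "set_integrable lebesgue (\<Omega> L H) P"
    unfolding P_def by (intro set_integral_sum(1) FWi)
  define f where "f n t = (LINT s:{0<..<L}|lebesgue. W n (s, t))" for n t
  define q where "q n t = of_real (\<alpha> n) * (\<Sum>m\<in>N. a t (n - m) * of_real (\<alpha> m) * U m t) - (of_real \<kappa>)\<^sup>2 * U n t + f n t / of_real L" for n t
  have aU: "set_integrable lebesgue {-H<..<H} (\<lambda>t. a t (n - m) * U m t)" if "m \<in> N" for m n
    using FA(2)[OF Ic[OF U[OF that]], where m = m and n = n] L
    by (simp add: mult.assoc set_integrable_mult_right_iff)
  have fi: "set_integrable lebesgue {-H<..<H} (f n)" if n: "n \<in> N" for n
    using FW(2)[OF n Ic[of "\<lambda>_. 1"]] by (simp add: f_def[abs_def])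
  have qi: "set_integrable lebesgue {-H<..<H} (q n)" if n: "n \<in> N" for n
  proof -
    have "set_integrable lebesgue {-H<..<H} (\<lambda>t. of_real (\<alpha> n) * (\<Sum>m\<in>N. of_real (\<alpha> m) * (a t (n - m) * U m t))
        - (of_real \<kappa>)\<^sup>2 * U n t + f n t / of_real L)"
      by (intro set_integral_add(1) set_integral_diff(1) set_integrable_mult_right set_integral_sum(1) aU
            Ic U n set_integrable_divide fi)
    then show ?thesis by (simp add: q_def[abs_def] mult.commute mult.left_commute)
  qed
  have mult_cnjc: "set_integrable lebesgue {-H<..<H} (\<lambda>t. k t * cnj (c n t))"
    if "n \<in> N" "set_integrable lebesgue {-H<..<H} k" for n k
    using set_integrable_continuous_mult_box[of "-H" H k "\<lambda>t. cnj (c n t)"] that cnjc by (simp add: mult.commute)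
  have Qg: "set_integrable lebesgue {-H<..<H} (\<lambda>t. Q n t * cnj (g n t))" if "n \<in> N" for n
    using set_integrable_continuous_mult_box[of "-H" H "\<lambda>t. cnj (g n t)" "Q n"] that gi Q(1) by simp
  \<comment> \<open>Fixing the test index n and summing over m assembles one row of the Toeplitz
    system, that is, one flux.\<close>
  have row: "(\<Sum>m\<in>N. (LINT t:{-H<..<H}|lebesgue. of_real L * a t (n - m) * p m n t)
        - (LINT t:{-H<..<H}|lebesgue. (if m = n then of_real L else 0) * r m n t))
      = of_real L * (Q n H * cnj (c n H) - Q n (-H) * cnj (c n (-H))) - (LINT x:\<Omega> L H|lebesgue. W n x * cnj (c n (snd x)))"
    if n: "n \<in> N" for n
  proof -
    have i1: "set_integrable lebesgue {-H<..<H} (\<lambda>t. of_real L * a t (n - m) * p m n t)" if "m \<in> N" for m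
      using FA(2)[OF pi[OF that n]] .
    have i2: "set_integrable lebesgue {-H<..<H} (\<lambda>t. (if m = n then of_real L else 0) * r m n t)" if "m \<in> N" for m
      by (intro set_integrable_mult_right Ic rc that n)
    have i3: "set_integrable lebesgue {-H<..<H} (\<lambda>t. of_real L * (q n t * cnj (c n t) + Q n t * cnj (g n t)) - f n t * cnj (c n t))"
      by (intro set_integral_diff(1) set_integrable_mult_right set_integral_add(1) mult_cnjc n qi Qg fi)
    have "(\<Sum>m\<in>N. (LINT t:{-H<..<H}|lebesgue. of_real L * a t (n - m) * p m n t)
        - (LINT t:{-H<..<H}|lebesgue. (if m = n then of_real L else 0) * r m n t))
      = (LINT t:{-H<..<H}|lebesgue. \<Sum>m\<in>N. of_real L * a t (n - m) * p m n t - (if m = n then of_real L else 0) * r m n t)"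
      using i1 i2 by (subst set_integral_sum(2)) (auto intro!: set_integral_diff(1) sum.cong simp: set_integral_diff(2))
    \<comment> \<open>The source is added inside \<open>q n\<close> and subtracted outside, so that
      \<open>q n\<close> becomes the full derivative of the flux and integration by parts
      applies.\<close>
    also have "\<dots> = (LINT t:{-H<..<H}|lebesgue. of_real L * (q n t * cnj (c n t) + Q n t * cnj (g n t)) - f n t * cnj (c n t))"
    proof (rule set_integral_lebesgue_AE_cong(2)[OF i3])
      have "of_real L * (q n t * cnj (c n t) + Q n t * cnj (g n t)) - f n t * cnj (c n t)
          = (\<Sum>m\<in>N. of_real L * a t (n - m) * p m n t - (if m = n then of_real L else 0) * r m n t)"
        if t: "t \<in> {-H<..<H} - S" for t
      proof -
        have "(\<Sum>m\<in>N. (if m = n then of_real L else 0) * r m n t) = of_real L * r n n t"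
          using n N by (simp add: if_distrib[of "\<lambda>x. x * _"] cong: if_cong)
        moreover have "(\<Sum>m\<in>N. of_real L * a t (n - m) * p m n t)
          = of_real L * (of_real (\<alpha> n) * (\<Sum>m\<in>N. a t (n - m) * of_real (\<alpha> m) * U m t) * cnj (c n t)
              + (\<Sum>m\<in>N. a t (n - m) * D m t) * cnj (g n t))"
          unfolding p_def by (simp add: sum_distrib_left sum_distrib_right sum.distrib algebra_simps)
        ultimately show ?thesis
          unfolding sum_subtractf Q(2)[OF n t] q_def r_def using L by (simp add: algebra_simps)
      qed
      then show "AE t in lebesgue. t \<in> {-H<..<H} \<longrightarrow>
          of_real L * (q n t * cnj (c n t) + Q n t * cnj (g n t)) - f n t * cnj (c n t)
          = (\<Sum>m\<in>N. of_real L * a t (n - m) * p m n t - (if m = n then of_real L else 0) * r m n t)"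
        using AE_lebesgue_not_in_finite[OF S] by (auto elim!: eventually_mono)
    qed
    also have "\<dots> = of_real L * ((LINT t:{-H<..<H}|lebesgue. q n t * cnj (c n t)) + (LINT t:{-H<..<H}|lebesgue. Q n t * cnj (g n t)))
        - (LINT t:{-H<..<H}|lebesgue. f n t * cnj (c n t))"
      using mult_cnjc[OF n] qi[OF n] Qg[OF n] fi[OF n]
      by (simp add: set_integral_diff(2) set_integral_add)
    also have "(LINT t:{-H<..<H}|lebesgue. q n t * cnj (c n t)) + (LINT t:{-H<..<H}|lebesgue. Q n t * cnj (g n t))
        = Q n H * cnj (c n H) - Q n (-H) * cnj (c n (-H))"
      using H by (intro integration_by_parts_weak[OF _ S Q(1)[OF n] _ qi[OF n] cnjc[OF n] has_weak_derivative_cnj[OF c(2)[OF n]]])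
         (auto simp: q_def f_def intro!: Q(3) n)
    also have "(LINT t:{-H<..<H}|lebesgue. f n t * cnj (c n t)) = (LINT x:\<Omega> L H|lebesgue. W n x * cnj (c n (snd x)))"
      unfolding f_def by (rule FW(3)[OF n Ic[OF cnjc[OF n]], symmetric])
    finally show ?thesis .
  qed
  have "(LINT x:\<Omega> L H|lebesgue. J x)
      = (\<Sum>n\<in>N. \<Sum>m\<in>N. (LINT x:\<Omega> L H|lebesgue. \<rho>E m n x * p m n (snd x)) - (LINT x:\<Omega> L H|lebesgue. E m n x * r m n (snd x)))"
    unfolding Jeq using Jint
    by (simp add: set_integral_sum set_integral_diff cong: sum.cong)
  also have "\<dots> = (\<Sum>n\<in>N. \<Sum>m\<in>N. (LINT t:{-H<..<H}|lebesgue. of_real L * a t (n - m) * p m n t)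
        - (LINT t:{-H<..<H}|lebesgue. (if m = n then of_real L else 0) * r m n t))"
    using FA(3)[OF pi] FE(2)[OF Ic[OF rc]] by (intro sum.cong refl arg_cong2[where f = "(-)"]) auto
  also have "\<dots> = (\<Sum>n\<in>N. of_real L * (Q n H * cnj (c n H) - Q n (-H) * cnj (c n (-H))) - (LINT x:\<Omega> L H|lebesgue. W n x * cnj (c n (snd x))))"
    by (intro sum.cong refl row)
  also have "\<dots> = of_real L * (\<Sum>n\<in>N. Q n H * cnj (c n H) - Q n (-H) * cnj (c n (-H))) - (LINT x:\<Omega> L H|lebesgue. P x)"
    unfolding P_def using FWi by (simp add: set_integral_sum(2) sum_subtractf[symmetric] sum_distrib_left)
  finally show "(LINT x:\<Omega> L H|lebesgue. J x) =
       of_real L * (\<Sum>n\<in>N. Q n H * cnj (c n H) - Q n (-H) * cnj (c n (-H))) - (LINT x:\<Omega> L H|lebesgue. P x)" .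
qed

section \<open>The RCWA solution\<close>

text \<open>Since Re(1/z) = Re z / |z|^2, a lower bound for Re z must be accompanied by an upper
  bound for |z|.\<close>

lemma reciprocal_bounds:
  fixes z :: complex
  assumes "0 < c" "c \<le> Re z" "cmod z \<le> B"
  shows "cmod (1 / z) \<le> 1 / c" "c / B\<^sup>2 \<le> Re (1 / z)"
proof -
  have z: "c \<le> cmod z" using assms(2) complex_Re_le_cmod[of z] by linarith
  then show "cmod (1 / z) \<le> 1 / c" using assms(1) by (simp add: norm_divide frac_le)
  have "Re (1 / z) = Re z / (cmod z)\<^sup>2"
    by (simp add: Re_divide cmod_power2)
  moreover have "c / B\<^sup>2 \<le> Re z / (cmod z)\<^sup>2"
    using assms z by (intro frac_le power_mono) auto
  ultimately show "c / B\<^sup>2 \<le> Re (1 / z)" by simp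
qed

lemma permittivity_bounds:
  assumes H: "0 < H" and m: "is_mesh H S h" and C2: "piecewise_C2_on (\<Omega> L H) \<epsilon>"
    and pos: "(\<exists>c>0. \<forall>x\<in>\<Omega> L H. Im (\<epsilon> x) = 0 \<and> Re (\<epsilon> x) \<ge> c) \<or>
         (\<exists>c1>0. \<exists>c2>0. \<forall>x\<in>\<Omega> L H. Im (\<epsilon> x) > c1 \<and> Re (\<epsilon> x) > c2)"
  obtains c C where "0 < c" "\<And>x. x \<in> \<Omega> L H \<Longrightarrow> cmod (1 / sliced h \<epsilon> x) \<le> C"
    "\<And>x. x \<in> \<Omega> L H \<Longrightarrow> c \<le> Re (1 / sliced h \<epsilon> x)"
proof -
  obtain b where b: "0 < b" "\<And>x. x \<in> \<Omega> L H \<Longrightarrow> b \<le> Re (\<epsilon> x)"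
    using pos by (meson less_imp_le)
  have "bounded (\<Omega> L H)" by (simp add: \<Omega>_eq_box bounded_box)
  then obtain B where B: "\<And>x. x \<in> \<Omega> L H \<Longrightarrow> cmod (\<epsilon> x) \<le> B"
    using piecewise_C2_on_bounded[OF C2] by blast
  \<comment> \<open>The maximum with 1 makes the bound positive, so that the coercivity constant
    \<open>b / B'\<^sup>2\<close> is positive as well.\<close>
  define B' where "B' = max B 1"
  have B': "0 < B'" "\<And>x. x \<in> \<Omega> L H \<Longrightarrow> cmod (\<epsilon> x) \<le> B'"
    using B by (auto simp: B'_def le_max_iff_disj)
  show thesis
  proof (rule that[of "b / B'\<^sup>2" "1 / b"])
    show "0 < b / B'\<^sup>2" using b B' by simp
    fix x assume "x \<in> \<Omega> L H"
    then obtain y where "y \<in> \<Omega> L H" "sliced h \<epsilon> x = \<epsilon> y" using sliced_sample[OF m] by blast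
    then show "cmod (1 / sliced h \<epsilon> x) \<le> 1 / b" "b / B'\<^sup>2 \<le> Re (1 / sliced h \<epsilon> x)"
      using reciprocal_bounds[OF b(1) b(2) B'(2)] by simp_all
  qed
qed

lemma sliced_const:
  assumes m: "is_mesh H S h" and j: "j \<in> {1..S}" and t: "t \<in> {h (j - 1)<..<h j}" "t' \<in> {h (j - 1)<..<h j}"
  shows "sliced h \<epsilon> (s, t') = sliced h \<epsilon> (s, t)"
  using t by (simp add: sliced_eq[OF m j])

lemma set_borel_measurable_reciprocal:
  fixes f :: "'a \<Rightarrow> complex"
  assumes "set_borel_measurable M A f"
  shows "set_borel_measurable M A (\<lambda>x. 1 / f x)"
proof -
  have "(\<lambda>x. inverse (indicator A x *\<^sub>R f x)) \<in> borel_measurable M"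
    using assms unfolding set_borel_measurable_def by (intro borel_measurable_inverse)
  moreover have "inverse (indicator A x *\<^sub>R f x) = indicator A x *\<^sub>R (1 / f x)" for x
    by (simp add: indicator_def divide_inverse)
  ultimately show ?thesis by (simp add: set_borel_measurable_def)
qed

text \<open>Coercivity is needed at each individual height, so the section must be measurable for
  every t; Borel measurability in the plane guarantees this.\<close>

lemma set_borel_measurable_section:
  fixes f :: "real \<times> real \<Rightarrow> complex"
  assumes f: "set_borel_measurable borel (\<Omega> L H) f" and t: "t \<in> {-H<..<H}"
  shows "set_borel_measurable lebesgue {0<..<L} (\<lambda>s. f (s, t))"
proof -
  have "(\<lambda>s. indicator (\<Omega> L H) (s, t) *\<^sub>R f (s, t)) \<in> borel_measurable borel"
    by (rule measurable_compose[OF _ f[unfolded set_borel_measurable_def]])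
       (intro borel_measurable_continuous_onI continuous_intros)
  moreover have "indicator (\<Omega> L H) (s, t) = (indicator {0<..<L} s :: real)" for s
    using t by (auto simp: \<Omega>_def indicator_def)
  ultimately show ?thesis by (simp add: set_borel_measurable_def measurable_completion)
qed

text \<open>Exhibiting weak derivatives term by term pins down the arbitrary choices in the form. It
  serves the RCWA solution, with its pointwise derivatives, as well as the test function.\<close>

lemma weak_gradient_mode_sum:
  fixes c g :: "int \<Rightarrow> real \<Rightarrow> complex" and L H :: real
  assumes L: "0 < L" and v: "\<forall>x\<in>\<Omega> L H. v x = (\<Sum>n\<in>N. c n (snd x) * mode \<alpha> n (fst x))"
    and c: "\<forall>n\<in>N. has_weak_derivative (c n) (g n) 1 {-H<..<H}"
  shows "AE x in lebesgue. x \<in> \<Omega> L H \<longrightarrow> weak_derivative (\<Omega> L H) (1, 0) v x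
      = (\<Sum>n\<in>N. c n (snd x) * (\<i> * of_real (\<alpha> n) * mode \<alpha> n (fst x)))"
    and "AE x in lebesgue. x \<in> \<Omega> L H \<longrightarrow> weak_derivative (\<Omega> L H) (0, 1) v x
      = (\<Sum>n\<in>N. g n (snd x) * mode \<alpha> n (fst x))"
proof -
  have "has_weak_derivative (\<lambda>x. \<Sum>n\<in>N. c n (snd x) * mode \<alpha> n (fst x))
      (\<lambda>x. \<Sum>n\<in>N. c n (snd x) * (\<i> * of_real (\<alpha> n) * mode \<alpha> n (fst x))) (1, 0) (\<Omega> L H)"
    unfolding \<Omega>_eq_box
    by (intro has_weak_derivative_sum, fold \<Omega>_eq_box, intro has_weak_derivative_separated_fst[OF L] mode_has_vector_derivative
          continuous_intros) (use c in \<open>simp add: has_weak_derivative_def\<close>)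
  then have "has_weak_derivative v (\<lambda>x. \<Sum>n\<in>N. c n (snd x) * (\<i> * of_real (\<alpha> n) * mode \<alpha> n (fst x))) (1, 0) (\<Omega> L H)"
    using v by (subst has_weak_derivative_cong) auto
  then show "AE x in lebesgue. x \<in> \<Omega> L H \<longrightarrow> weak_derivative (\<Omega> L H) (1, 0) v x
      = (\<Sum>n\<in>N. c n (snd x) * (\<i> * of_real (\<alpha> n) * mode \<alpha> n (fst x)))"
    unfolding \<Omega>_eq_box by (rule weak_derivative_AE)
  have "has_weak_derivative (\<lambda>x. \<Sum>n\<in>N. c n (snd x) * mode \<alpha> n (fst x))
      (\<lambda>x. \<Sum>n\<in>N. g n (snd x) * mode \<alpha> n (fst x)) (0, 1) (\<Omega> L H)"
    unfolding \<Omega>_eq_box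
    by (intro has_weak_derivative_sum, fold \<Omega>_eq_box, intro has_weak_derivative_separated_snd c[rule_format] continuous_intros)
  then have "has_weak_derivative v (\<lambda>x. \<Sum>n\<in>N. g n (snd x) * mode \<alpha> n (fst x)) (0, 1) (\<Omega> L H)"
    using v by (subst has_weak_derivative_cong) auto
  then show "AE x in lebesgue. x \<in> \<Omega> L H \<longrightarrow> weak_derivative (\<Omega> L H) (0, 1) v x
      = (\<Sum>n\<in>N. g n (snd x) * mode \<alpha> n (fst x))"
    unfolding \<Omega>_eq_box by (rule weak_derivative_AE)
qed

theorem theorem7:
  fixes L H \<kappa> \<epsilon>p \<epsilon>m \<theta> :: real
    and \<epsilon> \<epsilon>h :: "real \<times> real \<Rightarrow> complex"
    and \<alpha> :: "int \<Rightarrow> real"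
    and S M :: nat
    and h :: "nat \<Rightarrow> real"
    and U :: "int \<Rightarrow> real \<Rightarrow> complex"
  defines "\<alpha> \<equiv> alpha L \<kappa> \<epsilon>p \<theta>"
    and "\<epsilon>h \<equiv> sliced h \<epsilon>"
  assumes "0 < L" and "0 < H" and "0 < \<kappa>" and "0 < \<epsilon>p" and "0 < \<epsilon>m"
    and "\<And>n. (\<alpha> n)\<^sup>2 \<noteq> \<kappa>\<^sup>2 * \<epsilon>p" and "\<And>n. (\<alpha> n)\<^sup>2 \<noteq> \<kappa>\<^sup>2 * \<epsilon>m"
    and "\<And>x1 x2. \<epsilon> (x1 + L, x2) = \<epsilon> (x1, x2)"
    and "\<And>x1 x2. x2 > H \<Longrightarrow> \<epsilon> (x1, x2) = of_real \<epsilon>p"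
    and "\<And>x1 x2. x2 < - H \<Longrightarrow> \<epsilon> (x1, x2) = of_real \<epsilon>m"
    and "piecewise_C2_on (\<Omega> L H) \<epsilon>"
    and "(\<exists>c>0. \<forall>x\<in>\<Omega> L H. Im (\<epsilon> x) = 0 \<and> Re (\<epsilon> x) \<ge> c) \<or>
         (\<exists>c1>0. \<exists>c2>0. \<forall>x\<in>\<Omega> L H. Im (\<epsilon> x) > c1 \<and> Re (\<epsilon> x) > c2)"
    and "is_mesh H S h"
    and "rcwa_solution L H \<kappa> \<alpha> \<epsilon>p \<epsilon>m \<theta> S h \<epsilon>h M U"
  shows "mode_sum \<alpha> M U \<in> V_space L H \<alpha> M \<and>
         (\<forall>v\<in>V_space L H \<alpha> M.
            B_form L H \<kappa> \<alpha> \<epsilon>p \<epsilon>m \<epsilon>h (mode_sum \<alpha> M U) v = f_functional L H \<kappa> \<epsilon>p \<theta> \<epsilon>h v)"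
proof -
  define N where "N = {-int M..int M}"
  define a where "a t k = inv_eps_coeff L \<epsilon>h t k" for t k
  define Z where "Z = h ` {..S}"
  have L: "0 < L" and H: "0 < H" and m: "is_mesh H S h"
    and C2: "piecewise_C2_on (\<Omega> L H) \<epsilon>" and sol: "rcwa_solution L H \<kappa> \<alpha> \<epsilon>p \<epsilon>m \<theta> S h \<epsilon>h M U"
    using assms by simp_all
  have N: "finite N" and Z: "finite Z" by (simp_all add: N_def Z_def)
  have \<alpha>: "\<alpha> n - \<alpha> m = 2 * pi * of_int (n - m) / L" for n m
    by (simp add: \<alpha>_def alpha_def algebra_simps diff_divide_distrib)
  obtain c0 C where c0: "0 < c0" and C: "\<And>x. x \<in> \<Omega> L H \<Longrightarrow> cmod (1 / \<epsilon>h x) \<le> C"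
    and Re_lower: "\<And>x. x \<in> \<Omega> L H \<Longrightarrow> c0 \<le> Re (1 / \<epsilon>h x)"
    using permittivity_bounds[OF H m C2 assms(14)] unfolding \<epsilon>h_def by metis
  have \<rho>m: "set_borel_measurable borel (\<Omega> L H) (\<lambda>x. 1 / \<epsilon>h x)"
    unfolding \<epsilon>h_def
    by (intro set_borel_measurable_reciprocal sliced_measurable[OF m] piecewise_C2_on_measurable C2)
  have U: "continuous_on {-H..H} (U n)" if "n \<in> N" for n
    using sol that by (simp add: rcwa_solution_def N_def)
  obtain dU ddU Q dp dm where
    slices: "\<forall>j\<in>{1..S}. \<forall>t\<in>{h (j - 1)<..<h j}. \<forall>n\<in>N.
           (U n has_vector_derivative dU n t) (at t) \<and>
           (dU n has_vector_derivative ddU n t) (at t) \<and>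
           (\<Sum>m\<in>N. a t (n - m) * ddU m t) =
             of_real (\<alpha> n) * (\<Sum>m\<in>N. a t (n - m) * of_real (\<alpha> m) * U m t)
             - (of_real \<kappa>)\<^sup>2 * U n t + src_coeff L \<kappa> \<alpha> \<epsilon>p \<theta> \<epsilon>h n t \<and>
           Q n t = (\<Sum>m\<in>N. a t (n - m) * dU m t)"
    and ends: "\<forall>n\<in>N. continuous_on {-H..H} (Q n) \<and>
           (U n has_vector_derivative dp n) (at H within {H..}) \<and>
           (U n has_vector_derivative dm n) (at (-H) within {..-H}) \<and>
           Q n H = dp n / of_real \<epsilon>p \<and> Q n (-H) = dm n / of_real \<epsilon>m"
    and bc: "\<forall>s\<in>{0<..<L}.
           1 / of_real \<epsilon>p * (\<Sum>n\<in>N. dp n * mode \<alpha> n s) =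
             DtN L \<kappa> \<alpha> \<epsilon>p (\<lambda>s. mode_sum \<alpha> M U (s, H)) s \<and>
           1 / of_real \<epsilon>m * (\<Sum>n\<in>N. dm n * mode \<alpha> n s) =
             - DtN L \<kappa> \<alpha> \<epsilon>m (\<lambda>s. mode_sum \<alpha> M U (s, -H)) s"
    using sol unfolding rcwa_solution_def N_def a_def by (elim conjE exE)
  \<comment> \<open>The Toeplitz matrix is constant within a slice, so the flux can be
    differentiated term by term and the RCWA equation gives its derivative.\<close>
  have a_const: "a t' k = a t k" if "j \<in> {1..S}" "t \<in> {h (j - 1)<..<h j}" "t' \<in> {h (j - 1)<..<h j}" for j t t' k
    unfolding a_def inv_eps_coeff_def \<epsilon>h_def using sliced_const[OF m that] by simp
  have Qc: "continuous_on {-H..H} (Q n)" if "n \<in> N" for n using ends that by blast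
  define W where "W = src_kernel \<kappa> \<epsilon>p \<theta> \<epsilon>h \<alpha>"
  have src: "src_coeff L \<kappa> \<alpha> \<epsilon>p \<theta> \<epsilon>h n t = (LINT s:{0<..<L}|lebesgue. W n (s, t)) / of_real L"
    if "j \<in> {1..S}" "t \<in> {h (j - 1)<..<h j}" for j t n
    unfolding W_def
  proof (rule src_coeff_eq[OF that(2)])
    show "\<epsilon>h (s, t') = \<epsilon>h (s, t)" if "t' \<in> {h (j - 1)<..<h j}" for s t'
      unfolding \<epsilon>h_def by (rule sliced_const[OF m \<open>j \<in> {1..S}\<close> \<open>t \<in> _\<close> that])
  qed
  have Q_deriv: "(Q n has_vector_derivative
        of_real (\<alpha> n) * (\<Sum>m\<in>N. a t (n - m) * of_real (\<alpha> m) * U m t) - (of_real \<kappa>)\<^sup>2 * U n t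
        + (LINT s:{0<..<L}|lebesgue. W n (s, t)) / of_real L) (at t)"
    if n: "n \<in> N" and t: "t \<in> {-H<..<H} - Z" for n t
  proof -
    obtain j where j: "j \<in> {1..S}" "t \<in> {h (j - 1)<..<h j}"
      using mesh_open_slice[OF m] t unfolding Z_def by metis
    have sl: "(\<Sum>m\<in>N. a t (n - m) * ddU m t) =
             of_real (\<alpha> n) * (\<Sum>m\<in>N. a t (n - m) * of_real (\<alpha> m) * U m t)
             - (of_real \<kappa>)\<^sup>2 * U n t + (LINT s:{0<..<L}|lebesgue. W n (s, t)) / of_real L"
      using slices j n src[OF j, of n] by auto
    have "((\<lambda>t'. \<Sum>m\<in>N. a t (n - m) * dU m t') has_vector_derivative (\<Sum>m\<in>N. a t (n - m) * ddU m t)) (at t)"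
      using slices j by (intro has_vector_derivative_sum has_vector_derivative_mult_right) blast
    then have "(Q n has_vector_derivative (\<Sum>m\<in>N. a t (n - m) * ddU m t)) (at t)"
    proof (rule has_vector_derivative_transform_within_open[OF _ open_greaterThanLessThan j(2)])
      fix t' assume t': "t' \<in> {h (j - 1)<..<h j}"
      show "(\<Sum>m\<in>N. a t (n - m) * dU m t') = Q n t'"
        using slices j(1) t' n by (simp add: a_const[OF j(1) t' j(2)])
    qed
    then show ?thesis unfolding sl .
  qed
  \<comment> \<open>Nothing is known about \<open>dU\<close> at the mesh heights; the value 0 there
    makes the bound below hold at every height.\<close>
  define D where "D n t = (if t \<in> Z then 0 else dU n t)" for n t
  have D: "(U n has_vector_derivative D n t) (at t)" "continuous (at t) (dU n)"
    "Q n t = (\<Sum>m\<in>N. a t (n - m) * D m t)" if n: "n \<in> N" and t: "t \<in> {-H<..<H} - Z" for n t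
  proof -
    obtain j where j: "j \<in> {1..S}" "t \<in> {h (j - 1)<..<h j}"
      using mesh_open_slice[OF m] t unfolding Z_def by metis
    show "(U n has_vector_derivative D n t) (at t)" "Q n t = (\<Sum>m\<in>N. a t (n - m) * D m t)"
      using slices j n t by (auto simp: D_def)
    have "(dU n has_vector_derivative ddU n t) (at t)" using slices j n by blast
    then show "continuous (at t) (dU n)" by (rule has_vector_derivative_continuous)
  qed
  have Dm: "set_borel_measurable lebesgue {-H<..<H} (D n)" if n: "n \<in> N" for n
  proof -
    \<comment> \<open>Away from the mesh heights \<open>dU n\<close> is differentiable, hence
      continuous on an open set.\<close>
    have "set_borel_measurable lebesgue ({-H<..<H} - Z) (dU n)"
      using D(2)[OF n] borel_closed[OF finite_imp_closed[OF Z]]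
      by (intro set_borel_measurable_lebesgue_continuous continuous_at_imp_continuous_on) auto
    moreover have "indicator ({-H<..<H} - Z) t *\<^sub>R dU n t = indicator {-H<..<H} t *\<^sub>R D n t" for t
      by (simp add: D_def indicator_def)
    ultimately show ?thesis by (simp add: set_borel_measurable_def)
  qed
  have "\<exists>B. \<forall>t\<in>{-H..H}. cmod (Q n t) \<le> B" if "n \<in> N" for n
  proof -
    have "compact (Q n ` {-H..H})" by (intro compact_continuous_image Qc that) auto
    then show ?thesis by (metis bounded_iff compact_imp_bounded imageI)
  qed
  then obtain B where B: "\<And>n t. n \<in> N \<Longrightarrow> t \<in> {-H..H} \<Longrightarrow> cmod (Q n t) \<le> B n" by metis
  \<comment> \<open>The Toeplitz estimate bounds |D|^2 by the quotient; the summand 1 converts this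
    into a bound for |D| by y \<le> 1 + y^2.\<close>
  define K where "K = 1 + (\<Sum>n\<in>N. (B n)\<^sup>2) / c0\<^sup>2"
  have Db: "cmod (D n t) \<le> K" if n: "n \<in> N" and t: "t \<in> {-H<..<H}" for n t
  proof (cases "t \<in> Z")
    case True
    then show ?thesis by (simp add: D_def K_def sum_nonneg)
  next
    case False
    then have t': "t \<in> {-H<..<H} - Z" using t by simp
    have st: "(s, t) \<in> \<Omega> L H" if "s \<in> {0<..<L}" for s using t that by (simp add: \<Omega>_def)
    have "c0 * (\<Sum>n\<in>N. (cmod (D n t))\<^sup>2)
        \<le> Re (\<Sum>n\<in>N. (\<Sum>m\<in>N. inv_eps_coeff L \<epsilon>h t (n - m) * D m t) * cnj (D n t))"
      by (rule Toeplitz_coercive[OF L \<alpha> N set_borel_measurable_section[OF \<rho>m t] C[OF st] Re_lower[OF st]])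
    also have "\<dots> = Re (\<Sum>n\<in>N. Q n t * cnj (D n t))"
      using D(3)[OF _ t'] by (simp add: a_def)
    finally have "(cmod (D n t))\<^sup>2 \<le> (\<Sum>n\<in>N. (cmod (Q n t))\<^sup>2) / c0\<^sup>2"
      by (rule Toeplitz_inverse_bound[OF c0 N _ n])
    also have "\<dots> \<le> (\<Sum>n\<in>N. (B n)\<^sup>2) / c0\<^sup>2"
      using B t by (intro divide_right_mono sum_mono power_mono) auto
    finally have "(cmod (D n t))\<^sup>2 \<le> (\<Sum>n\<in>N. (B n)\<^sup>2) / c0\<^sup>2" .
    moreover have "y \<le> 1 + y\<^sup>2" for y :: real
      using zero_le_power2[of "y - 1/2"] by (simp add: power2_eq_square algebra_simps)
    ultimately show ?thesis unfolding K_def by (meson add_left_mono order_trans)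
  qed
  have UD: "has_weak_derivative (U n) (D n) 1 {-H<..<H}" if n: "n \<in> N" for n
  proof (rule has_weak_derivative_piecewise[OF _ Z U[OF n] D(1)[OF n]])
    show "L2_on {-H<..<H} (D n)"
      using L2_on_bounded_measurable[of "-H" H "D n" K] Dm[OF n] Db[OF n] by simp
  qed (use H in auto)
  have "U n \<in> H1 H" if "n \<in> N" for n
    unfolding H1_def using U[OF that] UD[OF that] by blast
  then have "mode_sum \<alpha> M U \<in> V_space L H \<alpha> M"
    unfolding V_space_def mode_sum_def N_def by (intro CollectI exI[of _ U]) auto
  moreover have "B_form L H \<kappa> \<alpha> \<epsilon>p \<epsilon>m \<epsilon>h (mode_sum \<alpha> M U) v = f_functional L H \<kappa> \<epsilon>p \<theta> \<epsilon>h v"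
    if v: "v \<in> V_space L H \<alpha> M" for v
  proof -
    obtain c where c: "\<forall>n\<in>N. c n \<in> H1 H"
      and vc: "\<forall>x\<in>{0..L} \<times> {-H..H}. v x = (\<Sum>n\<in>N. c n (snd x) * mode \<alpha> n (fst x))"
      using v unfolding V_space_def N_def by blast
    have cc: "continuous_on {-H..H} (c n)" if "n \<in> N" for n using c that by (auto simp: H1_def)
    have "\<forall>n\<in>N. \<exists>g. has_weak_derivative (c n) g 1 {-H<..<H}" using c by (auto simp: H1_def)
    then obtain g where g: "\<And>n. n \<in> N \<Longrightarrow> has_weak_derivative (c n) (g n) 1 {-H<..<H}"
      by metis
    have v\<Omega>: "v x = (\<Sum>n\<in>N. c n (snd x) * mode \<alpha> n (fst x))" if "x \<in> \<Omega> L H" for x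
      using vc that by (auto simp: \<Omega>_def)
    \<comment> \<open>The integrand of the form with the explicit weak derivatives \<open>D\<close>
      and \<open>g\<close> in place of the chosen ones.\<close>
    define J where "J x = 1 / \<epsilon>h x *
        ((\<Sum>n\<in>N. U n (snd x) * (\<i> * of_real (\<alpha> n) * mode \<alpha> n (fst x)))
          * cnj (\<Sum>n\<in>N. c n (snd x) * (\<i> * of_real (\<alpha> n) * mode \<alpha> n (fst x)))
        + (\<Sum>n\<in>N. D n (snd x) * mode \<alpha> n (fst x)) * cnj (\<Sum>n\<in>N. g n (snd x) * mode \<alpha> n (fst x)))
        - (of_real \<kappa>)\<^sup>2 * (\<Sum>n\<in>N. U n (snd x) * mode \<alpha> n (fst x)) * cnj (\<Sum>n\<in>N. c n (snd x) * mode \<alpha> n (fst x))" for x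
    define P where "P x = (\<Sum>n\<in>N. W n x * cnj (c n (snd x)))" for x
    have Wm: "set_borel_measurable borel (\<Omega> L H) (W n)" for n
      unfolding W_def by (rule src_kernel_measurable[OF \<rho>m \<Omega>_borel])
    define KW where "KW n = \<bar>(\<kappa> * sqrt \<epsilon>p * cos \<theta>)\<^sup>2 + \<kappa> * sqrt \<epsilon>p * sin \<theta> * \<alpha> n\<bar> * (cmod (1 / of_real \<epsilon>p) + C)" for n
    have Wb: "cmod (W n x) \<le> KW n" if "x \<in> \<Omega> L H" for n x
      unfolding W_def KW_def by (rule src_kernel_bound[where \<epsilon>h = \<epsilon>h, OF C[OF that]])
    note VI = variational_identity[where U = U and D = D and Q = Q and c = c and g = g and W = W and \<epsilon>h = \<epsilon>h
        and N = N and S = Z and \<alpha> = \<alpha> and C = C and C' = K and K = KW and \<kappa> = \<kappa>,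
        OF L H N Z \<alpha> \<rho>m C U Dm Db Qc D(3)[unfolded a_def] Q_deriv[unfolded a_def] Wm Wb cc g, folded J_def P_def]
    have J: "set_integrable lebesgue (\<Omega> L H) J" "set_integrable lebesgue (\<Omega> L H) P"
      "(LINT x:\<Omega> L H|lebesgue. J x) =
       of_real L * (\<Sum>n\<in>N. Q n H * cnj (c n H) - Q n (-H) * cnj (c n (-H))) - (LINT x:\<Omega> L H|lebesgue. P x)"
      by (rule VI; assumption)+
    have UU: "mode_sum \<alpha> M U x = (\<Sum>n\<in>N. U n (snd x) * mode \<alpha> n (fst x))" for x
      by (simp add: mode_sum_def N_def)
    have UU': "\<forall>x\<in>\<Omega> L H. mode_sum \<alpha> M U x = (\<Sum>n\<in>N. U n (snd x) * mode \<alpha> n (fst x))"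
      and UD': "\<forall>n\<in>N. has_weak_derivative (U n) (D n) 1 {-H<..<H}"
      and v': "\<forall>x\<in>\<Omega> L H. v x = (\<Sum>n\<in>N. c n (snd x) * mode \<alpha> n (fst x))"
      and g': "\<forall>n\<in>N. has_weak_derivative (c n) (g n) 1 {-H<..<H}"
      using UU UD v\<Omega> g by blast+
    have volume: "(LINT x:\<Omega> L H|lebesgue.
        1 / \<epsilon>h x *
          (weak_derivative (\<Omega> L H) (1, 0) (mode_sum \<alpha> M U) x * cnj (weak_derivative (\<Omega> L H) (1, 0) v x) +
           weak_derivative (\<Omega> L H) (0, 1) (mode_sum \<alpha> M U) x * cnj (weak_derivative (\<Omega> L H) (0, 1) v x))
        - (of_real \<kappa>)\<^sup>2 * mode_sum \<alpha> M U x * cnj (v x)) = (LINT x:\<Omega> L H|lebesgue. J x)"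
    proof (rule set_integral_lebesgue_AE_cong(2)[OF J(1)])
      show "AE x in lebesgue. x \<in> \<Omega> L H \<longrightarrow> J x = 1 / \<epsilon>h x *
          (weak_derivative (\<Omega> L H) (1, 0) (mode_sum \<alpha> M U) x * cnj (weak_derivative (\<Omega> L H) (1, 0) v x) +
           weak_derivative (\<Omega> L H) (0, 1) (mode_sum \<alpha> M U) x * cnj (weak_derivative (\<Omega> L H) (0, 1) v x))
        - (of_real \<kappa>)\<^sup>2 * mode_sum \<alpha> M U x * cnj (v x)"
        using weak_gradient_mode_sum[OF L UU' UD'] weak_gradient_mode_sum[OF L v' g']
      proof eventually_elim
        case (elim x)
        show ?case
        proof
          assume x: "x \<in> \<Omega> L H"
          show "J x = 1 / \<epsilon>h x *
          (weak_derivative (\<Omega> L H) (1, 0) (mode_sum \<alpha> M U) x * cnj (weak_derivative (\<Omega> L H) (1, 0) v x) +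
           weak_derivative (\<Omega> L H) (0, 1) (mode_sum \<alpha> M U) x * cnj (weak_derivative (\<Omega> L H) (0, 1) v x))
        - (of_real \<kappa>)\<^sup>2 * mode_sum \<alpha> M U x * cnj (v x)"
            unfolding J_def elim(1)[rule_format, OF x] elim(2)[rule_format, OF x] elim(3)[rule_format, OF x]
              elim(4)[rule_format, OF x] UU v\<Omega>[OF x] ..
        qed
      qed
    qed
    have boundary: "(LINT s:{0<..<L}|lebesgue. cnj (v (s, y)) * X s) = of_real L * (\<Sum>n\<in>N. q n * cnj (c n y))"
      if "y \<in> {-H..H}" "\<And>s. s \<in> {0<..<L} \<Longrightarrow> X s = (\<Sum>n\<in>N. q n * mode \<alpha> n s)" for y X q
    proof -
      have "(LINT s:{0<..<L}|lebesgue. cnj (v (s, y)) * X s)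
          = (LINT s:{0<..<L}|lebesgue. (\<Sum>n\<in>N. q n * mode \<alpha> n s) * cnj (\<Sum>n\<in>N. c n y * mode \<alpha> n s))"
        using vc that by (intro set_lebesgue_integral_cong) (auto simp: mult.commute)
      then show ?thesis by (simp only: mode_sum_pairing[OF L \<alpha> N])
    qed
    \<comment> \<open>The boundary condition contains the same Dirichlet-to-Neumann expression as
      the form, so it can be replaced directly by \<open>dp n / \<epsilon>p\<close>, which is the
      flux at H.\<close>
    have top: "(LINT s:{0<..<L}|lebesgue. cnj (v (s, H)) * DtN L \<kappa> \<alpha> \<epsilon>p (\<lambda>s. mode_sum \<alpha> M U (s, H)) s)
        = of_real L * (\<Sum>n\<in>N. Q n H * cnj (c n H))"
    proof (rule boundary)
      show "DtN L \<kappa> \<alpha> \<epsilon>p (\<lambda>s. mode_sum \<alpha> M U (s, H)) s = (\<Sum>n\<in>N. Q n H * mode \<alpha> n s)" if "s \<in> {0<..<L}" for s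
        using bspec[OF bc that] ends by (simp add: sum_divide_distrib cong: sum.cong)
    qed (use H in auto)
    \<comment> \<open>The minus sign in the lower boundary condition matches the sign of the lower
      end in the integration by parts.\<close>
    have bottom: "(LINT s:{0<..<L}|lebesgue. cnj (v (s, -H)) * DtN L \<kappa> \<alpha> \<epsilon>m (\<lambda>s. mode_sum \<alpha> M U (s, -H)) s)
        = of_real L * (\<Sum>n\<in>N. - Q n (-H) * cnj (c n (-H)))"
    proof (rule boundary)
      show "DtN L \<kappa> \<alpha> \<epsilon>m (\<lambda>s. mode_sum \<alpha> M U (s, -H)) s = (\<Sum>n\<in>N. - Q n (-H) * mode \<alpha> n s)" if "s \<in> {0<..<L}" for s
      proof -
        have "DtN L \<kappa> \<alpha> \<epsilon>m (\<lambda>s. mode_sum \<alpha> M U (s, -H)) s = - (1 / of_real \<epsilon>m * (\<Sum>n\<in>N. dm n * mode \<alpha> n s))"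
          using bspec[OF bc that] by simp
        then show ?thesis using ends by (simp add: sum_divide_distrib sum_negf cong: sum.cong)
      qed
    qed (use H in auto)
    have "f_functional L H \<kappa> \<epsilon>p \<theta> \<epsilon>h v = - (LINT x:\<Omega> L H|lebesgue. P x)"
      unfolding f_functional_def
    proof (rule arg_cong[of _ _ uminus], rule set_integral_lebesgue_AE_cong(2)[OF J(2)])
      \<comment> \<open>Off the mesh heights a whole open slice surrounds the point, so the
        classical x_2 derivative in the pairing can be computed.\<close>
      have eq: "P x = div_src_pairing \<kappa> \<epsilon>p \<theta> \<epsilon>h v x" if x: "x \<in> \<Omega> L H" "snd x \<notin> Z" for x
      proof -
        obtain s t where st: "x = (s, t)" "s \<in> {0<..<L}" "t \<in> {-H<..<H}" using x by (auto simp: \<Omega>_def)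
        have t: "t \<in> {-H<..<H} - Z" using st x by simp
        obtain j where j: "j \<in> {1..S}" "t \<in> {h (j - 1)<..<h j}"
          using mesh_open_slice[OF m] t unfolding Z_def by metis
        have "div_src_pairing \<kappa> \<epsilon>p \<theta> \<epsilon>h v (s, t) = (\<Sum>n\<in>N. src_kernel \<kappa> \<epsilon>p \<theta> \<epsilon>h \<alpha> n (s, t) * cnj (c n t))"
        proof (rule div_src_pairing_eq[OF j(2)])
          show "\<epsilon>h (s, t') = \<epsilon>h (s, t)" if "t' \<in> {h (j - 1)<..<h j}" for t'
            unfolding \<epsilon>h_def by (rule sliced_const[OF m j that])
          show "v (s, t) = (\<Sum>n\<in>N. c n t * mode \<alpha> n s)" using v\<Omega>[OF x(1)] st by simp
          have d: "((\<lambda>s. \<Sum>n\<in>N. c n t * mode \<alpha> n s) has_vector_derivative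
              (\<Sum>n\<in>N. c n t * (\<i> * of_real (\<alpha> n) * mode \<alpha> n s))) (at s)"
            by (intro has_vector_derivative_sum has_vector_derivative_mult_right mode_has_vector_derivative)
          have "(\<Sum>n\<in>N. c n t * mode \<alpha> n s') = v (s', t)" if "s' \<in> {0<..<L}" for s'
            using v\<Omega>[of "(s', t)"] that st by (simp add: \<Omega>_def)
          \<comment> \<open>Membership in \<open>V_space\<close> fixes v only on the closed
            rectangle; the derivative is determined because (0, L) is a neighbourhood of s.\<close>
          then show "((\<lambda>s. v (s, t)) has_vector_derivative
              (\<Sum>n\<in>N. c n t * (\<i> * of_real (\<alpha> n) * mode \<alpha> n s))) (at s)"
            by (rule has_vector_derivative_transform_within_open[OF d open_greaterThanLessThan st(2)])
        qed
        then show ?thesis by (simp add: P_def W_def st)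
      qed
      have "AE t in lborel. t \<notin> Z"
        using AE_lebesgue_not_in_finite[OF Z] by (simp add: AE_completion_iff)
      then have "AE x in lebesgue. snd (x :: real \<times> real) \<notin> Z"
        by (intro AE_completion AE_lborel_snd)
      then show "AE x in lebesgue. x \<in> \<Omega> L H \<longrightarrow> P x = div_src_pairing \<kappa> \<epsilon>p \<theta> \<epsilon>h v x"
        by eventually_elim (use eq in blast)
    qed
    then show ?thesis
      unfolding B_form_def volume J(3) top bottom
      by (simp add: sum_subtractf sum_negf algebra_simps)
  qed
  ultimately show ?thesis by blast
qed

end
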